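(* Let $(R,\mathfrak{m})$ be a Cohen-Macaulay (noetherian) local ring and let $I$ be a Cohen-Macaulay ideal of $R$ of height two and of finite projective dimension. Then $\mu(\operatorname{Ext}^2_R(R/I,R))=\mu(I)-1$.
   Context: $\mu(-)$ denotes the minimal number of generators of a finitely generated module. An ideal $I$ is called Cohen-Macaulay if the ring $R/I$ is Cohen-Macaulay. "$I$ of finite projective dimension" means that $I$ (equivalently $R/I$) has finite projective dimension as an $R$-module. *)

theory Defs
  imports "HOL-Library.Extended_Nat" "HOL-Algebra.Module" "HOL-Algebra.QuotRing" "HOL-Algebra.Ring_Divisibility"
begin

section \<open>Krull dimension, height and depth\<close>

definition krull_dim :: "('a, 'r) ring_scheme \<Rightarrow> enat" where
  "krull_dim R = Sup {enat n | n p.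
     (\<forall>i\<le>n. primeideal (p i) R) \<and> (\<forall>i<n. p i \<subset> p (Suc i))}"

definition prime_height :: "('a, 'r) ring_scheme \<Rightarrow> 'a set \<Rightarrow> enat" where
  "prime_height R Q = Sup {enat n | n p.
     (\<forall>i\<le>n. primeideal (p i) R) \<and> (\<forall>i<n. p i \<subset> p (Suc i)) \<and> p n = Q}"

text \<open>The unit ideal has height \<open>\<infinity>\<close>.\<close>

definition height :: "('a, 'r) ring_scheme \<Rightarrow> 'a set \<Rightarrow> enat" where
  "height R I = Inf (prime_height R ` {Q. primeideal Q R \<and> I \<subseteq> Q})"

text \<open>The second condition says that \<open>x\<^sub>i\<close> is a nonzerodivisor on
  \<open>R/(x\<^sub>1,\<dots>,x\<^sub>i\<^sub>-\<^sub>1)\<close>.\<close>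

definition regular_sequence :: "('a, 'r) ring_scheme \<Rightarrow> 'a list \<Rightarrow> bool" where
  "regular_sequence R xs \<longleftrightarrow>
     set xs \<subseteq> carrier R \<and>
     (\<forall>i<length xs. \<forall>a\<in>carrier R.
        (xs ! i) \<otimes>\<^bsub>R\<^esub> a \<in> Idl\<^bsub>R\<^esub> (set (take i xs)) \<longrightarrow> a \<in> Idl\<^bsub>R\<^esub> (set (take i xs))) \<and>
     Idl\<^bsub>R\<^esub> (set xs) \<noteq> carrier R"

definition depth :: "('a, 'r) ring_scheme \<Rightarrow> 'a set \<Rightarrow> enat" where
  "depth R J = Sup {enat (length xs) | xs. regular_sequence R xs \<and> set xs \<subseteq> J}"


section \<open>Cohen-Macaulay local rings and Cohen-Macaulay ideals\<close>

definition local_ring :: "('a, 'r) ring_scheme \<Rightarrow> 'a set \<Rightarrow> bool" where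
  "local_ring R \<mm> \<longleftrightarrow>
     cring R \<and> maximalideal \<mm> R \<and> (\<forall>J. maximalideal J R \<longrightarrow> J = \<mm>)"

definition cohen_macaulay_local_ring :: "('a, 'r) ring_scheme \<Rightarrow> 'a set \<Rightarrow> bool" where
  "cohen_macaulay_local_ring R \<mm> \<longleftrightarrow>
     noetherian_ring R \<and> local_ring R \<mm> \<and> depth R \<mm> = krull_dim R"

text \<open>Only meant for ideals of local rings: a nonzero quotient is then again local,
  so its Cohen-Macaulayness needs no localisation.\<close>

definition cohen_macaulay_ideal :: "('a, 'r) ring_scheme \<Rightarrow> 'a set \<Rightarrow> bool" where
  "cohen_macaulay_ideal R I \<longleftrightarrow>
     ideal I R \<and> (\<exists>\<nn>. cohen_macaulay_local_ring (R Quot I) \<nn>)"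


section \<open>Modules\<close>

text \<open>The fields \<open>mult\<close> and \<open>one\<close>, which the record type of modules inherits from that of
  rings, play no role for modules and are left undefined.\<close>

definition ring_module :: "('a, 'r) ring_scheme \<Rightarrow> ('a, 'a) module" where
  "ring_module R =
     \<lparr>carrier = carrier R, mult = undefined, one = undefined,
      zero = \<zero>\<^bsub>R\<^esub>, add = add R, smult = mult R\<rparr>"

definition ideal_module :: "('a, 'r) ring_scheme \<Rightarrow> 'a set \<Rightarrow> ('a, 'a) module" where
  "ideal_module R I = (ring_module R)\<lparr>carrier := I\<rparr>"

definition quotient_module :: "('a, 'b) module \<Rightarrow> 'b set \<Rightarrow> ('a, 'b set) module" where
  "quotient_module M N =
     \<lparr>carrier = a_rcosets\<^bsub>M\<^esub> N, mult = undefined, one = undefined,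
      zero = N, add = set_add M,
      smult = (\<lambda>a X. \<Union>x\<in>X. N +>\<^bsub>M\<^esub> (a \<odot>\<^bsub>M\<^esub> x))\<rparr>"

definition span :: "('a, 'r) ring_scheme \<Rightarrow> ('a, 'b) module \<Rightarrow> 'b set \<Rightarrow> 'b set" where
  "span R M S = \<Inter>{N. submodule N R M \<and> S \<subseteq> N}"

text \<open>The value is \<open>\<infinity>\<close> if the module is not finitely generated.\<close>

definition min_gens :: "('a, 'r) ring_scheme \<Rightarrow> ('a, 'b) module \<Rightarrow> enat" where
  "min_gens R M = Inf {enat (card S) | S. finite S \<and> S \<subseteq> carrier M \<and> span R M S = carrier M}"

text \<open>Homomorphisms are represented by extensional functions, so that they form a module.\<close>

definition Hom_module ::
  "('a, 'r) ring_scheme \<Rightarrow> ('a, 'b) module \<Rightarrow> ('a, 'c) module \<Rightarrow> ('a, 'b \<Rightarrow> 'c) module" where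
  "Hom_module R M N =
     \<lparr>carrier = {f \<in> carrier M \<rightarrow>\<^sub>E carrier N.
        (\<forall>x\<in>carrier M. \<forall>y\<in>carrier M. f (x \<oplus>\<^bsub>M\<^esub> y) = f x \<oplus>\<^bsub>N\<^esub> f y) \<and>
        (\<forall>a\<in>carrier R. \<forall>x\<in>carrier M. f (a \<odot>\<^bsub>M\<^esub> x) = a \<odot>\<^bsub>N\<^esub> f x)},
      mult = undefined, one = undefined,
      zero = (\<lambda>x\<in>carrier M. \<zero>\<^bsub>N\<^esub>),
      add = (\<lambda>f g. \<lambda>x\<in>carrier M. f x \<oplus>\<^bsub>N\<^esub> g x),
      smult = (\<lambda>a f. \<lambda>x\<in>carrier M. a \<odot>\<^bsub>N\<^esub> f x)\<rparr>"

abbreviation Homs ::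
  "('a, 'r) ring_scheme \<Rightarrow> ('a, 'b) module \<Rightarrow> ('a, 'c) module \<Rightarrow> ('b \<Rightarrow> 'c) set" where
  "Homs R M N \<equiv> carrier (Hom_module R M N)"

definition free_module :: "('a, 'r) ring_scheme \<Rightarrow> 'x set \<Rightarrow> ('a, 'x \<Rightarrow> 'a) module" where
  "free_module R X =
     \<lparr>carrier = {f \<in> X \<rightarrow>\<^sub>E carrier R. finite {x \<in> X. f x \<noteq> \<zero>\<^bsub>R\<^esub>}},
      mult = undefined, one = undefined,
      zero = (\<lambda>x\<in>X. \<zero>\<^bsub>R\<^esub>),
      add = (\<lambda>f g. \<lambda>x\<in>X. f x \<oplus>\<^bsub>R\<^esub> g x),
      smult = (\<lambda>a f. \<lambda>x\<in>X. a \<otimes>\<^bsub>R\<^esub> f x)\<rparr>"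


section \<open>Projective resolutions and Ext\<close>

text \<open>A module is projective if it is isomorphic to a direct summand of a free module, i.e. if
  it is a retract of one.  Basis sets in the type of the elements of \<open>M\<close> suffice: if \<open>M\<close> is a
  retract of any free module, it is one of the free module on \<open>carrier M\<close>.\<close>

definition projective_module :: "('a, 'r) ring_scheme \<Rightarrow> ('a, 'b) module \<Rightarrow> bool" where
  "projective_module R M \<longleftrightarrow> module R M \<and>
     (\<exists>(X :: 'b set) i p. i \<in> Homs R M (free_module R X) \<and> p \<in> Homs R (free_module R X) M \<and>
        (\<forall>x\<in>carrier M. p (i x) = x))"

text \<open>The exact sequence \<open>\<dots> \<rightarrow> P 2 \<rightarrow> P 1 \<rightarrow> P 0 \<rightarrow> M \<rightarrow> 0\<close> with differentials
  \<open>d n : P (n + 1) \<rightarrow> P n\<close> and augmentation \<open>\<epsilon> : P 0 \<rightarrow> M\<close>.\<close>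

definition projective_resolution ::
  "('a, 'r) ring_scheme \<Rightarrow> (nat \<Rightarrow> ('a, 'p) module) \<Rightarrow> (nat \<Rightarrow> 'p \<Rightarrow> 'p) \<Rightarrow> ('p \<Rightarrow> 'b)
     \<Rightarrow> ('a, 'b) module \<Rightarrow> bool" where
  "projective_resolution R P d \<epsilon> M \<longleftrightarrow>
     (\<forall>n. projective_module R (P n)) \<and> module R M \<and>
     \<epsilon> \<in> Homs R (P 0) M \<and> (\<forall>n. d n \<in> Homs R (P (Suc n)) (P n)) \<and>
     \<epsilon> ` carrier (P 0) = carrier M \<and>
     d 0 ` carrier (P 1) = {x \<in> carrier (P 0). \<epsilon> x = \<zero>\<^bsub>M\<^esub>} \<and>
     (\<forall>n. d (Suc n) ` carrier (P (Suc (Suc n))) =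
            {x \<in> carrier (P (Suc n)). d n x = \<zero>\<^bsub>P n\<^esub>})"

text \<open>The type argument is the type of the elements of the resolving modules, which HOL cannot
  quantify over.\<close>

definition finite_projective_dimension ::
  "'p itself \<Rightarrow> ('a, 'r) ring_scheme \<Rightarrow> ('a, 'b) module \<Rightarrow> bool" where
  "finite_projective_dimension _ R M \<longleftrightarrow>
     (\<exists>(P :: nat \<Rightarrow> ('a, 'p) module) d \<epsilon> n. projective_resolution R P d \<epsilon> M \<and>
        (\<forall>k>n. carrier (P k) = {\<zero>\<^bsub>P k\<^esub>}))"

definition Ext_cocycles ::
  "('a, 'r) ring_scheme \<Rightarrow> (nat \<Rightarrow> ('a, 'p) module) \<Rightarrow> (nat \<Rightarrow> 'p \<Rightarrow> 'p) \<Rightarrow> nat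
     \<Rightarrow> ('a, 'b) module \<Rightarrow> ('p \<Rightarrow> 'b) set" where
  "Ext_cocycles R P d n N =
     {f \<in> Homs R (P n) N.
        compose (carrier (P (Suc n))) f (d n) = \<zero>\<^bsub>Hom_module R (P (Suc n)) N\<^esub>}"

definition Ext_coboundaries ::
  "('a, 'r) ring_scheme \<Rightarrow> (nat \<Rightarrow> ('a, 'p) module) \<Rightarrow> (nat \<Rightarrow> 'p \<Rightarrow> 'p) \<Rightarrow> nat
     \<Rightarrow> ('a, 'b) module \<Rightarrow> ('p \<Rightarrow> 'b) set" where
  "Ext_coboundaries R P d n N =
     (case n of 0 \<Rightarrow> {\<zero>\<^bsub>Hom_module R (P 0) N\<^esub>}
      | Suc k \<Rightarrow> (\<lambda>g. compose (carrier (P n)) g (d k)) ` Homs R (P k) N)"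

text \<open>\<open>Ext\<^sup>n(M, N)\<close>, computed from a projective resolution \<open>P, d\<close> of \<open>M\<close> as the \<open>n\<close>-th
  cohomology of the complex \<open>Hom(P, N)\<close>; \<open>M\<close> enters only through its resolution.\<close>

definition Ext ::
  "('a, 'r) ring_scheme \<Rightarrow> (nat \<Rightarrow> ('a, 'p) module) \<Rightarrow> (nat \<Rightarrow> 'p \<Rightarrow> 'p) \<Rightarrow> nat
     \<Rightarrow> ('a, 'b) module \<Rightarrow> ('a, ('p \<Rightarrow> 'b) set) module" where
  "Ext R P d n N =
     quotient_module ((Hom_module R (P n) N)\<lparr>carrier := Ext_cocycles R P d n N\<rparr>)
       (Ext_coboundaries R P d n N)"

end

theory Submission
  imports Defs
begin

text \<open>Let \<open>F\<close> be the minimal free resolution of \<open>R/I\<close>.  It is a direct summand, up to homotopy, of any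
  other projective resolution, hence bounded because \<open>I\<close> has finite projective dimension.

  A maximal regular sequence \<open>xs\<close> in \<open>I\<close> has length at most two, since a prime of height two
  contains \<open>I\<close>.  Then \<open>I\<close> consists of zero divisors modulo \<open>xs\<close>, so \<open>I\<close> lies in an associated prime
  of \<open>R/(xs)\<close>.  Extending \<open>xs\<close> by \<open>ys\<close> to a maximal regular sequence of \<open>R\<close> produces a chain of
  \<open>|ys|\<close> primes above that associated prime, whence \<open>depth R/I = dim R/I \<ge> |ys|\<close>.  The inequality of
  Auslander and Buchsbaum, \<open>pd R/I + depth R/I \<le> depth R = |xs| + |ys|\<close>, now bounds the length of
  \<open>F\<close> by two.  It is obtained elementarily: mapping cones of multiplication by a regular sequence on
  \<open>R/I\<close> lengthen \<open>F\<close>, whereas exactness modulo a regular sequence of \<open>R\<close> is lost only in low degrees.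

  So \<open>F\<close> is \<open>0 \<rightarrow> R\<^sup>m \<rightarrow> R\<^sup>n \<rightarrow> R\<close> with \<open>n = \<mu>(I)\<close>, and \<open>m = n - 1\<close> because \<open>I\<close> contains a regular element.
  Finally, \<open>Ext\<^sup>2(R/I, R)\<close> is the cokernel of the dual of \<open>R\<^sup>m \<rightarrow> R\<^sup>n\<close>, a matrix with entries in \<open>\<mm>\<close>, and
  therefore needs exactly \<open>m\<close> generators.\<close>

section \<open>Associated primes and regular sequences\<close>

text \<open>All statements modulo an ideal are made inside \<open>R\<close>, relative to an ideal
  \<open>J\<close>: \<open>regular_mod\<close>, \<open>regular_seq_mod\<close> and
  \<open>exact_mod\<close> speak of \<open>R/J\<close> without forming it. A quotient ring has
  cosets as elements, so each further element of a regular sequence would change the type, and no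
  induction along the sequence could be stated. For the same reason an associated prime of
  \<open>R/J\<close> appears as a prime ideal \<open>colon R J z\<close>, the annihilator of the
  class of an element \<open>z\<close> outside \<open>J\<close>. The ring \<open>R Quot I\<close>
  itself is visited only to unpack the hypothesis on \<open>I\<close>. Three types of resolving
  modules meet: one witnesses the finite projective dimension, one computes Ext, and the minimal
  resolution lives on finite sets of natural numbers. Only chain maps and homotopies pass between
  them. That \<open>I\<close> contains a regular element rests on the lower half of the height
  hypothesis: the associated prime above \<open>I\<close> has height at least two, and the chain
  over it would exceed the dimension of \<open>R\<close> if \<open>xs\<close> were empty.\<close>

definition colon :: "('a, 'r) ring_scheme \<Rightarrow> 'a set \<Rightarrow> 'a \<Rightarrow> 'a set" where
  "colon R J z = {x \<in> carrier R. z \<otimes>\<^bsub>R\<^esub> x \<in> J}"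

definition adjoin :: "('a, 'r) ring_scheme \<Rightarrow> 'a set \<Rightarrow> 'a \<Rightarrow> 'a set" where
  "adjoin R J x = J <+>\<^bsub>R\<^esub> PIdl\<^bsub>R\<^esub> x"

definition regular_mod :: "('a, 'r) ring_scheme \<Rightarrow> 'a set \<Rightarrow> 'a \<Rightarrow> bool" where
  "regular_mod R J x \<longleftrightarrow> (\<forall>a\<in>carrier R. x \<otimes>\<^bsub>R\<^esub> a \<in> J \<longrightarrow> a \<in> J)"

text \<open>Unlike \<open>regular_sequence\<close>, this does not ask the final ideal to be proper.
  For entries in \<open>\<mm>\<close> and \<open>J \<subseteq> \<mm>\<close> properness is
  automatic, and the recursion through \<open>adjoin\<close> lets \<open>J\<close> vary in
  inductions over the list.\<close>

primrec regular_seq_mod :: "('a, 'r) ring_scheme \<Rightarrow> 'a set \<Rightarrow> 'a list \<Rightarrow> bool" where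
  "regular_seq_mod R J [] \<longleftrightarrow> True"
| "regular_seq_mod R J (x # xs) \<longleftrightarrow> regular_mod R J x \<and> regular_seq_mod R (adjoin R J x) xs"

abbreviation adjoins :: "('a, 'r) ring_scheme \<Rightarrow> 'a set \<Rightarrow> 'a list \<Rightarrow> 'a set" where
  "adjoins R \<equiv> foldl (adjoin R)"

definition prime_chain :: "('a, 'r) ring_scheme \<Rightarrow> nat \<Rightarrow> (nat \<Rightarrow> 'a set) \<Rightarrow> bool" where
  "prime_chain R n p \<longleftrightarrow> (\<forall>i\<le>n. primeideal (p i) R) \<and> (\<forall>i<n. p i \<subset> p (Suc i))"

lemma regular_seq_mod_append:
  "regular_seq_mod R J (xs @ ys) \<longleftrightarrow> regular_seq_mod R J xs \<and> regular_seq_mod R (adjoins R J xs) ys"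
  by (induction xs arbitrary: J) auto

lemma regular_seq_mod_iff_nth:
  "regular_seq_mod R J xs \<longleftrightarrow> (\<forall>i<length xs. regular_mod R (adjoins R J (take i xs)) (xs ! i))"
proof (induction xs arbitrary: J)
  case (Cons x xs)
  show ?case by (auto simp: Cons.IH less_Suc_eq_0_disj)
qed simp

section \<open>Annihilators, ideals \<open>J + (x)\<close> and chains of primes\<close>

context cring
begin

lemma colon_ideal: "ideal J R \<Longrightarrow> z \<in> carrier R \<Longrightarrow> ideal (colon R J z) R"
  unfolding colon_def by (rule ideal.helper_max_prime[OF _ is_cring])

lemma adjoin_mem: "y \<in> adjoin R J x \<longleftrightarrow> (\<exists>j\<in>J. \<exists>a\<in>carrier R. y = j \<oplus> a \<otimes> x)"
  unfolding adjoin_def set_add_def' cgenideal_def by auto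

lemma adjoin_ideal: "ideal J R \<Longrightarrow> x \<in> carrier R \<Longrightarrow> ideal (adjoin R J x) R"
  unfolding adjoin_def by (rule add_ideals[OF _ cgenideal_ideal])

lemma adjoin_superset:
  assumes "ideal J R" "x \<in> carrier R" shows "J \<subseteq> adjoin R J x"
proof
  fix j assume "j \<in> J"
  then show "j \<in> adjoin R J x"
    using assms ideal.Icarr unfolding adjoin_mem by (intro bexI[of _ j] bexI[of _ \<zero>]) fastforce+
qed

lemma adjoin_self:
  assumes "ideal J R" "x \<in> carrier R" shows "x \<in> adjoin R J x"
  unfolding adjoin_mem using assms additive_subgroup.zero_closed[OF ideal.axioms(1)[OF assms(1)]]
  by (intro bexI[of _ \<zero>] bexI[of _ \<one>]) auto

lemma adjoin_least:
  assumes "ideal K R" "J \<subseteq> K" "x \<in> K" shows "adjoin R J x \<subseteq> K"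
proof
  fix y assume "y \<in> adjoin R J x"
  then obtain j a where "j \<in> J" "a \<in> carrier R" "y = j \<oplus> a \<otimes> x" unfolding adjoin_mem by blast
  then show "y \<in> K" using assms additive_subgroup.a_closed[OF ideal.axioms(1)[OF assms(1)]] ideal.I_l_closed by fast
qed

lemma adjoins_ideal: "ideal J R \<Longrightarrow> set xs \<subseteq> carrier R \<Longrightarrow> ideal (adjoins R J xs) R"
  by (induction xs arbitrary: J) (auto simp: adjoin_ideal)

lemma adjoins_superset: "ideal J R \<Longrightarrow> set xs \<subseteq> carrier R \<Longrightarrow> J \<subseteq> adjoins R J xs"
proof (induction xs arbitrary: J)
  case (Cons x xs)
  then show ?case using adjoin_ideal[of J x] adjoin_superset[of J x] Cons.IH[of "adjoin R J x"] by auto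
qed simp

lemma adjoins_least: "ideal K R \<Longrightarrow> J \<subseteq> K \<Longrightarrow> set xs \<subseteq> K \<Longrightarrow> adjoins R J xs \<subseteq> K"
proof (induction xs arbitrary: J)
  case (Cons x xs)
  then show ?case using adjoin_least[of K J x] Cons.IH[of "adjoin R J x"] by simp
qed simp

lemma adjoins_mem: "ideal J R \<Longrightarrow> set xs \<subseteq> carrier R \<Longrightarrow> set xs \<subseteq> adjoins R J xs"
proof (induction xs arbitrary: J)
  case (Cons x xs)
  then show ?case
    using adjoin_ideal[of J x] adjoin_self[of J x] Cons.IH[of "adjoin R J x"]
      adjoins_superset[of "adjoin R J x" xs] by auto
qed simp

lemma adjoins_eq_Idl:
  assumes "ideal J R" "set xs \<subseteq> carrier R"
  shows "adjoins R J xs = Idl (J \<union> set xs)"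
proof
  have sub: "J \<union> set xs \<subseteq> carrier R" using assms ideal.Icarr by fast
  show "adjoins R J xs \<subseteq> Idl (J \<union> set xs)"
    using adjoins_least[OF genideal_ideal[OF sub]] genideal_self[OF sub] by blast
  show "Idl (J \<union> set xs) \<subseteq> adjoins R J xs"
    using assms by (intro genideal_minimal adjoins_ideal) (auto dest: adjoins_superset adjoins_mem)
qed

lemma colon_superset:
  assumes "ideal J R" "z \<in> carrier R" shows "J \<subseteq> colon R J z"
  using assms ideal.I_l_closed ideal.Icarr unfolding colon_def by fast

lemma colon_comm: "z \<in> carrier R \<Longrightarrow> x \<in> carrier R \<Longrightarrow> x \<in> colon R J z \<longleftrightarrow> z \<in> colon R J x"
  by (simp add: colon_def m_comm)

lemma prime_chain_append:
  assumes "prime_chain R m p" "prime_chain R n q" "p m = q 0"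
  shows "prime_chain R (m + n) (\<lambda>i. if i \<le> m then p i else q (i - m))"
  unfolding prime_chain_def
proof (intro conjI allI impI)
  fix i assume i: "i < m + n"
  let ?f = "\<lambda>i. if i \<le> m then p i else q (i - m)"
  consider "i < m" | "i = m" | "i > m" by linarith
  then show "?f i \<subset> ?f (Suc i)"
  proof cases
    case 3
    then have "Suc i - m = Suc (i - m)" by simp
    with 3 i assms(2) show ?thesis unfolding prime_chain_def by auto
  qed (use assms i in \<open>auto simp: prime_chain_def\<close>)
qed (use assms in \<open>auto simp: prime_chain_def\<close>)

lemma krull_dim_ge: "prime_chain R n p \<Longrightarrow> enat n \<le> krull_dim R"
  unfolding krull_dim_def prime_chain_def by (rule Sup_upper) auto

lemma prime_height_ge: "prime_chain R n p \<Longrightarrow> enat n \<le> prime_height R (p n)"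
  unfolding prime_height_def prime_chain_def by (rule Sup_upper) auto

text \<open>The supremum may be infinite, in which case no longest chain exists. A strict lower
  bound is nevertheless witnessed by a member of the set.\<close>

lemma prime_height_chain:
  assumes "enat (Suc n) \<le> prime_height R Q"
  shows "\<exists>m p. m > n \<and> prime_chain R m p \<and> p m = Q"
proof -
  have "enat n < prime_height R Q" using assms by (simp add: less_le_trans[of _ "enat (Suc n)"])
  then obtain x where "enat n < x"
    "x \<in> {enat n | n p. (\<forall>i\<le>n. primeideal (p i) R) \<and> (\<forall>i<n. p i \<subset> p (Suc i)) \<and> p n = Q}"
    unfolding prime_height_def less_Sup_iff by (rule bexE)
  then obtain m p where "enat n < enat m" "prime_chain R m p" "p m = Q"
    unfolding prime_chain_def by blast
  then show ?thesis by auto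
qed

lemma prime_height_plus_le:
  assumes "prime_chain R n q" "enat m \<le> prime_height R (q 0)"
  shows "enat (m + n) \<le> krull_dim R"
proof -
  have "\<exists>k p. k \<ge> m \<and> prime_chain R k p \<and> p k = q 0"
  proof (cases m)
    case 0
    have "prime_chain R 0 (\<lambda>_. q 0)" using assms(1) by (simp add: prime_chain_def)
    then show ?thesis using 0 by blast
  next
    case (Suc k)
    then show ?thesis using prime_height_chain[of k "q 0"] assms by (metis Suc_leI)
  qed
  then obtain k p where k: "k \<ge> m" "prime_chain R k p" "p k = q 0" by blast
  have "enat (k + n) \<le> krull_dim R" using prime_chain_append[OF k(2) assms(1) k(3)] by (rule krull_dim_ge)
  moreover have "enat (m + n) \<le> enat (k + n)" using k(1) by simp
  ultimately show ?thesis by (rule order_trans[rotated])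
qed

lemma prime_chain_Cons:
  assumes "primeideal P R" "prime_chain R n p" "P \<subset> p 0"
  shows "prime_chain R (Suc n) (case_nat P p)"
  using assms unfolding prime_chain_def by (auto split: nat.split)

lemma prime_chain_snoc:
  assumes "primeideal Q R" "prime_chain R n p" "p n \<subset> Q"
  shows "prime_chain R (Suc n) (p(Suc n := Q))"
  using assms unfolding prime_chain_def by (auto simp: le_Suc_eq less_Suc_eq)

end

section \<open>Associated primes and prime avoidance in noetherian rings\<close>

locale noetherian_cring = noetherian_ring R + cring R for R (structure)
begin

text \<open>In a noetherian ring a nonempty chain of ideals contains its union, so Zorn's lemma
  applies within any nonempty set of ideals. Maximal annihilators, primes missing a multiplicative
  set and inextendable regular sequences all come from here.\<close>

lemma ideals_maximal:
  assumes "S \<noteq> {}" "\<And>K. K \<in> S \<Longrightarrow> ideal K R"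
  obtains M where "M \<in> S" "\<And>K. K \<in> S \<Longrightarrow> M \<subseteq> K \<Longrightarrow> K = M"
proof -
  have "\<exists>M\<in>S. \<forall>K\<in>S. M \<subseteq> K \<longrightarrow> K = M"
  proof (rule subset_Zorn)
    fix C assume C: "subset.chain S C"
    show "\<exists>U\<in>S. \<forall>X\<in>C. X \<subseteq> U"
    proof (cases "C = {}")
      case False
      have "subset.chain {I. ideal I R} C" using C assms(2) unfolding pred_on.chain_def by blast
      with False have "\<Union>C \<in> C" by (rule ideal_chain_is_trivial)
      then show ?thesis using C unfolding pred_on.chain_def by (meson Union_upper subsetD)
    qed (use assms(1) in auto)
  qed
  then show ?thesis using that by blast
qed

text \<open>If \<open>a b\<close> kills \<open>z\<close> modulo \<open>J\<close> and
  \<open>b\<close> does not, then \<open>z b\<close> is outside \<open>J\<close> and its annihilator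
  contains that of \<open>z\<close>. By maximality the two coincide, and \<open>a\<close> kills
  \<open>z b\<close>.\<close>

lemma maximal_colon_prime:
  assumes J: "ideal J R" and z: "z \<in> carrier R" "z \<notin> J"
    and max: "\<And>w. w \<in> carrier R \<Longrightarrow> w \<notin> J \<Longrightarrow> colon R J z \<subseteq> colon R J w \<Longrightarrow> colon R J w = colon R J z"
  shows "primeideal (colon R J z) R"
proof (rule primeidealI[OF colon_ideal[OF J z(1)] is_cring])
  show "carrier R \<noteq> colon R J z"
    using z one_closed unfolding colon_def by (metis (mono_tags, lifting) mem_Collect_eq r_one)
  fix a b assume ab: "a \<in> carrier R" "b \<in> carrier R" "a \<otimes> b \<in> colon R J z"
  show "a \<in> colon R J z \<or> b \<in> colon R J z"
  proof (rule disjCI)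
    assume "b \<notin> colon R J z"
    then have "z \<otimes> b \<notin> J" using ab by (simp add: colon_def)
    moreover have "colon R J z \<subseteq> colon R J (z \<otimes> b)"
    proof
      fix x assume "x \<in> colon R J z"
      then have x: "x \<in> carrier R" "z \<otimes> x \<in> J" by (auto simp: colon_def)
      then have "(z \<otimes> x) \<otimes> b \<in> J" using ideal.I_r_closed[OF J _ ab(2)] by blast
      moreover have "(z \<otimes> x) \<otimes> b = z \<otimes> b \<otimes> x" using x z ab by algebra
      ultimately show "x \<in> colon R J (z \<otimes> b)" using x by (simp add: colon_def)
    qed
    ultimately have "colon R J (z \<otimes> b) = colon R J z" using max z ab by simp
    moreover have "z \<otimes> b \<otimes> a = z \<otimes> (a \<otimes> b)" using z ab by algebra
    then have "a \<in> colon R J (z \<otimes> b)" using ab by (simp add: colon_def)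
    ultimately show "a \<in> colon R J z" by simp
  qed
qed

lemma maximal_colon_exists:
  assumes J: "ideal J R" and z: "z \<in> carrier R" "z \<notin> J"
  obtains w where "w \<in> carrier R" "w \<notin> J" "colon R J z \<subseteq> colon R J w"
    "\<And>v. v \<in> carrier R \<Longrightarrow> v \<notin> J \<Longrightarrow> colon R J w \<subseteq> colon R J v \<Longrightarrow> colon R J v = colon R J w"
proof -
  obtain M where M: "M \<in> {colon R J w | w. w \<in> carrier R \<and> w \<notin> J \<and> colon R J z \<subseteq> colon R J w}"
    "\<And>K. K \<in> {colon R J w | w. w \<in> carrier R \<and> w \<notin> J \<and> colon R J z \<subseteq> colon R J w} \<Longrightarrow> M \<subseteq> K \<Longrightarrow> K = M"
    by (rule ideals_maximal[of "{colon R J w | w. w \<in> carrier R \<and> w \<notin> J \<and> colon R J z \<subseteq> colon R J w}"])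
      (use z colon_ideal[OF J] in auto)
  then obtain w where w: "w \<in> carrier R" "w \<notin> J" "colon R J z \<subseteq> colon R J w" "M = colon R J w" by blast
  show ?thesis
  proof (rule that[OF w(1-3)])
    fix v assume "v \<in> carrier R" "v \<notin> J" "colon R J w \<subseteq> colon R J v"
    then show "colon R J v = colon R J w" using M(2)[of "colon R J v"] w by auto
  qed
qed

lemma associated_prime_exists:
  assumes "ideal J R" "z \<in> carrier R" "z \<notin> J"
  obtains w where "w \<in> carrier R" "w \<notin> J" "colon R J z \<subseteq> colon R J w" "primeideal (colon R J w) R"
  using maximal_colon_exists[OF assms] maximal_colon_prime[OF assms(1)] by metis

text \<open>Otherwise pick an element outside \<open>P\<close> from each ideal; the product lies in
  every one of them but not in \<open>P\<close>. The factor \<open>carrier R\<close> matters for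
  empty \<open>F\<close>, where \<open>\<Inter>F\<close> is the whole type.\<close>

lemma prime_contains_finite_Int:
  assumes "finite F" "primeideal P R" "\<And>K. K \<in> F \<Longrightarrow> ideal K R" "carrier R \<inter> \<Inter>F \<subseteq> P"
  shows "\<exists>K\<in>F. K \<subseteq> P"
proof (rule ccontr)
  assume "\<not> ?thesis"
  then have neg: "\<And>K. K \<in> F \<Longrightarrow> \<not> K \<subseteq> P" by blast
  have "\<exists>x\<in>carrier R - P. x \<in> \<Inter>F"
    using assms(1,3) neg
  proof (induction F)
    case empty
    then show ?case using primeideal.I_notcarr[OF assms(2)] ideal.Icarr[OF primeideal.axioms(1)[OF assms(2)]] by auto
  next
    case (insert K F)
    then obtain x where x: "x \<in> carrier R" "x \<notin> P" "x \<in> \<Inter>F" by auto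
    obtain y where y: "y \<in> K" "y \<notin> P" using insert.prems(2) by auto
    have yc: "y \<in> carrier R" using y insert.prems(1) ideal.Icarr by fast
    have "x \<otimes> y \<in> K'" if "K' \<in> insert K F" for K'
      using that x y yc insert.prems(1)[OF that] ideal.I_l_closed ideal.I_r_closed by fastforce
    moreover have "x \<otimes> y \<notin> P" using primeideal.I_prime[OF assms(2) x(1) yc] x y by blast
    ultimately show ?case using x yc by blast
  qed
  with assms(4) show False by blast
qed

text \<open>The ideal generated by \<open>J\<close> and \<open>Z\<close> is already generated by
  \<open>J\<close> and a finite \<open>Y \<subseteq> Z\<close>. What kills all of \<open>Y\<close>
  modulo \<open>J\<close> kills all of \<open>Z\<close>, so the prime \<open>colon R J z\<close>
  contains the intersection of finitely many annihilators, hence one of them, and by maximality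
  equals it.\<close>

lemma finite_maximal_colons:
  assumes J: "ideal J R"
  defines "Z \<equiv> {z \<in> carrier R - J. \<forall>w \<in> carrier R - J. colon R J z \<subseteq> colon R J w \<longrightarrow> colon R J w = colon R J z}"
  shows "finite (colon R J ` Z)"
proof -
  let ?S = "{Idl (J \<union> Y) | Y. Y \<subseteq> Z \<and> finite Y}"
  have Jc: "J \<subseteq> carrier R" using ideal.Icarr[OF J] by blast
  have Zc: "Z \<subseteq> carrier R" unfolding Z_def by blast
  obtain M where M: "M \<in> ?S" "\<And>K. K \<in> ?S \<Longrightarrow> M \<subseteq> K \<Longrightarrow> K = M"
    by (rule ideals_maximal[of ?S]) (use Jc Zc in \<open>auto intro!: genideal_ideal\<close>)
  then obtain Y where Y: "Y \<subseteq> Z" "finite Y" "M = Idl (J \<union> Y)" by blast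
  have ZM: "z \<in> M" if z: "z \<in> Z" for z
  proof -
    have sub: "J \<union> insert z Y \<subseteq> carrier R" using Jc Zc Y z by auto
    have "M \<subseteq> Idl (J \<union> insert z Y)" using Y(3) subset_Idl_subset[OF sub] by auto
    moreover have "Idl (J \<union> insert z Y) \<in> ?S" using z Y by blast
    ultimately have "Idl (J \<union> insert z Y) = M" using M(2) by blast
    then show ?thesis using genideal_self[OF sub] by auto
  qed
  have "colon R J z \<in> colon R J ` Y" if z: "z \<in> Z" for z
  proof -
    have zc: "z \<in> carrier R" "z \<notin> J" using z unfolding Z_def by auto
    have prime: "primeideal (colon R J z) R"
      by (rule maximal_colon_prime[OF J zc]) (use z in \<open>auto simp: Z_def\<close>)
    \<comment> \<open>Annihilation is symmetric: \<open>x\<close> kills every element of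
      \<open>Y\<close> exactly if \<open>Y\<close> lies in the ideal \<open>colon R J x\<close>,
      which then contains \<open>M\<close> and thus \<open>z\<close>.\<close>
    have "carrier R \<inter> \<Inter>(colon R J ` Y) \<subseteq> colon R J z"
    proof
      fix x assume x: "x \<in> carrier R \<inter> \<Inter>(colon R J ` Y)"
      have "J \<union> Y \<subseteq> colon R J x"
        using x Y Zc colon_comm colon_superset[OF J] by blast
      then have "M \<subseteq> colon R J x" unfolding Y(3) using x by (intro genideal_minimal colon_ideal J) auto
      then show "x \<in> colon R J z" using ZM[OF z] colon_comm zc x by blast
    qed
    then obtain y where "y \<in> Y" "colon R J y \<subseteq> colon R J z"
      using prime_contains_finite_Int[OF _ prime, of "colon R J ` Y"] Y(1,2) Zc colon_ideal[OF J] by blast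
    then show ?thesis using Y(1) zc unfolding Z_def by blast
  qed
  then have "colon R J ` Z \<subseteq> colon R J ` Y" by blast
  then show ?thesis using Y(2) finite_surj by blast
qed

text \<open>If the element \<open>x\<close> found for \<open>F\<close> lies in the new prime
  \<open>P\<close>, it is corrected by some \<open>y\<close> that lies in \<open>Q\<close> and in
  all members of \<open>F\<close> but not in \<open>P\<close>. Such a \<open>y\<close> exists
  because \<open>P\<close> contains neither \<open>Q\<close> nor, by incomparability, a member of
  \<open>F\<close>.\<close>

lemma prime_avoidance:
  assumes "finite F" "\<And>P. P \<in> F \<Longrightarrow> primeideal P R" "\<And>P P'. P \<in> F \<Longrightarrow> P' \<in> F \<Longrightarrow> P \<subseteq> P' \<Longrightarrow> P = P'"
    and Q: "ideal Q R" "\<And>P. P \<in> F \<Longrightarrow> \<not> Q \<subseteq> P"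
  shows "\<exists>x\<in>Q. \<forall>P\<in>F. x \<notin> P"
  using assms(1-3) Q(2)
proof (induction F)
  case empty
  then show ?case using additive_subgroup.zero_closed[OF ideal.axioms(1)[OF Q(1)]] by blast
next
  case (insert P F)
  then obtain x where x: "x \<in> Q" "\<forall>P\<in>F. x \<notin> P" by auto
  have P: "primeideal P R" using insert.prems(1) by blast
  have idl: "ideal K R" if "K \<in> insert Q F" for K
    using that insert.prems(1) Q(1) primeideal.axioms(1) by blast
  show ?case
  proof (cases "x \<in> P")
    case True
    have "\<not> carrier R \<inter> \<Inter>(insert Q F) \<subseteq> P"
    proof
      assume "carrier R \<inter> \<Inter>(insert Q F) \<subseteq> P"
      then obtain K where "K \<in> insert Q F" "K \<subseteq> P"
        using prime_contains_finite_Int[of "insert Q F" P] insert.hyps(1) P idl by blast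
      then show False using insert.prems(2)[of K P] insert.prems(3)[of P] insert.hyps(2) by auto
    qed
    then obtain y where y: "y \<in> carrier R" "y \<in> Q" "\<forall>K\<in>F. y \<in> K" "y \<notin> P" by auto
    have xc: "x \<in> carrier R" using x ideal.Icarr[OF Q(1)] by blast
    have swap: "\<And>K a b. ideal K R \<Longrightarrow> a \<in> carrier R \<Longrightarrow> b \<in> K \<Longrightarrow> a \<oplus> b \<in> K \<Longrightarrow> a \<in> K"
    proof -
      fix K a b assume K: "ideal K R" and a: "a \<in> carrier R" and b: "b \<in> K" and ab: "a \<oplus> b \<in> K"
      have bc: "b \<in> carrier R" using K b ideal.Icarr by fast
      have "a = (a \<oplus> b) \<oplus> (\<ominus> b)" using a bc by algebra
      then show "a \<in> K"
        using K b ab additive_subgroup.a_closed additive_subgroup.a_inv_closed ideal.axioms(1) by metis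
    qed
    have "x \<oplus> y \<notin> K" if "K \<in> F" for K
      using swap[of K x y] idl[of K] that x y xc by blast
    moreover have "x \<oplus> y \<notin> P"
      using swap[of P y x] primeideal.axioms(1)[OF P] True y xc a_comm by metis
    moreover have "x \<oplus> y \<in> Q" using x y Q(1) by (simp add: additive_subgroup.a_closed ideal.axioms(1))
    ultimately show ?thesis by blast
  qed (use x in blast)
qed

text \<open>An element that is not regular modulo \<open>J\<close> lies in some maximal annihilator.
  These are finitely many pairwise incomparable primes, so avoidance puts all of \<open>Q\<close>
  into a single one.\<close>

lemma zero_divisors_in_associated_prime:
  assumes J: "ideal J R" and Q: "ideal Q R" and zd: "\<And>x. x \<in> Q \<Longrightarrow> \<not> regular_mod R J x"
  obtains z where "z \<in> carrier R" "z \<notin> J" "Q \<subseteq> colon R J z" "primeideal (colon R J z) R"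
proof -
  define Z where "Z = {z \<in> carrier R - J. \<forall>w \<in> carrier R - J. colon R J z \<subseteq> colon R J w \<longrightarrow> colon R J w = colon R J z}"
  have Zc: "z \<in> carrier R" "z \<notin> J" if "z \<in> Z" for z using that unfolding Z_def by auto
  have Zmax: "colon R J w = colon R J z" if "z \<in> Z" "w \<in> carrier R" "w \<notin> J" "colon R J z \<subseteq> colon R J w" for z w
    using that unfolding Z_def by blast
  have prime: "primeideal (colon R J z) R" if "z \<in> Z" for z
    using maximal_colon_prime[OF J Zc[OF that]] Zmax[OF that] by blast
  have fin: "finite (colon R J ` Z)" unfolding Z_def by (rule finite_maximal_colons[OF J])
  have "\<exists>z\<in>Z. Q \<subseteq> colon R J z"
  proof (rule ccontr)
    assume neg: "\<not> ?thesis"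
    have "\<exists>x\<in>Q. \<forall>P\<in>colon R J ` Z. x \<notin> P"
      by (rule prime_avoidance[OF fin _ _ Q]) (use prime neg Zc Zmax in blast)+
    then obtain x where x: "x \<in> Q" "\<And>z. z \<in> Z \<Longrightarrow> x \<notin> colon R J z" by blast
    have xc: "x \<in> carrier R" using x(1) ideal.Icarr[OF Q] by blast
    obtain a where a: "a \<in> carrier R" "x \<otimes> a \<in> J" "a \<notin> J" using zd[OF x(1)] unfolding regular_mod_def by blast
    obtain w where w: "w \<in> carrier R" "w \<notin> J" "colon R J a \<subseteq> colon R J w"
      "\<And>v. v \<in> carrier R \<Longrightarrow> v \<notin> J \<Longrightarrow> colon R J w \<subseteq> colon R J v \<Longrightarrow> colon R J v = colon R J w"
      using maximal_colon_exists[OF J a(1,3)] by blast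
    have "w \<in> Z" using w unfolding Z_def by blast
    moreover have "x \<in> colon R J a" using a xc by (simp add: colon_def m_comm)
    ultimately show False using x(2)[of w] w(3) by blast
  qed
  then show ?thesis using that prime Zc by blast
qed

text \<open>This is the fact that a prime minimal over \<open>J\<close> contains no element regular
  modulo \<open>J\<close>, proved without localisation. \<open>P\<close> is an ideal maximal among
  those that contain \<open>J\<close> and miss all \<open>s a^n\<close> with \<open>s\<close>
  outside \<open>Q\<close>; \<open>J\<close> is one of them as \<open>a\<close> is regular. The case
  \<open>n = 0\<close> gives \<open>P \<subseteq> Q\<close>, and \<open>s = 1\<close>,
  \<open>n = 1\<close> keeps \<open>a\<close> out of \<open>P\<close>.\<close>

lemma prime_below_regular:
  assumes Q: "primeideal Q R" and J: "ideal J R" "J \<subseteq> Q" and a: "a \<in> Q" "regular_mod R J a"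
  obtains P where "primeideal P R" "J \<subseteq> P" "P \<subset> Q"
proof -
  have Qi: "ideal Q R" using Q primeideal.axioms(1) by blast
  have ac: "a \<in> carrier R" using a Qi ideal.Icarr by fast
  let ?S = "{K. ideal K R \<and> J \<subseteq> K \<and> (\<forall>s\<in>carrier R - Q. \<forall>n::nat. s \<otimes> a [^] n \<notin> K)}"
  have "s \<otimes> a [^] n \<notin> J" if "s \<in> carrier R - Q" for s and n :: nat
  proof (induction n)
    case 0 then show ?case using that J by auto
  next
    case (Suc n)
    have "s \<otimes> a [^] Suc n = a \<otimes> (s \<otimes> a [^] n)" using that ac by (simp add: m_lcomm m_comm)
    then show ?case using Suc a(2) that ac unfolding regular_mod_def by auto
  qed
  then have "J \<in> ?S" using J by blast
  then obtain K where K: "K \<in> ?S" "\<And>K'. K' \<in> ?S \<Longrightarrow> K \<subseteq> K' \<Longrightarrow> K' = K"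
    by (rule_tac ideals_maximal[of ?S]) auto
  have Ki: "ideal K R" using K by blast
  have oneQ: "\<one> \<in> carrier R - Q" using primeideal.I_notcarr[OF Q] ideal.one_imp_carrier[OF Qi] by auto
  have KQ: "K \<subseteq> Q"
  proof
    fix x assume "x \<in> K"
    moreover have "x \<otimes> a [^] (0::nat) \<notin> K" if "x \<notin> Q" using that K(1) ideal.Icarr[OF Ki \<open>x \<in> K\<close>] by blast
    ultimately show "x \<in> Q" using ideal.Icarr[OF Ki] by auto
  qed
  have aK: "a \<notin> K"
  proof -
    have "\<one> \<otimes> a [^] (1::nat) \<notin> K" using K(1) oneQ by blast
    then show ?thesis using ac by simp
  qed
  have "primeideal K R"
  proof (rule primeidealI[OF Ki is_cring])
    show "carrier R \<noteq> K" using aK ac by blast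
    fix b c assume bc: "b \<in> carrier R" "c \<in> carrier R" "b \<otimes> c \<in> K"
    show "b \<in> K \<or> c \<in> K"
    proof (rule ccontr)
      assume neg: "\<not> (b \<in> K \<or> c \<in> K)"
      have ex: "\<exists>s\<in>carrier R - Q. \<exists>n::nat. s \<otimes> a [^] n \<in> adjoin R K u" if u: "u \<in> carrier R" "u \<notin> K" for u
      proof (rule ccontr)
        assume "\<not> ?thesis"
        then have "adjoin R K u \<in> ?S" using adjoin_ideal[OF Ki u(1)] adjoin_superset[OF Ki u(1)] K(1) by blast
        then have "adjoin R K u = K" using K(2) adjoin_superset[OF Ki u(1)] by blast
        then show False using adjoin_self[OF Ki u(1)] u by blast
      qed
      obtain s and n :: nat where s: "s \<in> carrier R" "s \<notin> Q" "s \<otimes> a [^] n \<in> adjoin R K b" using ex[OF bc(1)] neg by blast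
      obtain t and m :: nat where t: "t \<in> carrier R" "t \<notin> Q" "t \<otimes> a [^] m \<in> adjoin R K c" using ex[OF bc(2)] neg by blast
      obtain k u where k: "k \<in> K" "u \<in> carrier R" "s \<otimes> a [^] n = k \<oplus> u \<otimes> b" using s(3) unfolding adjoin_mem by blast
      obtain l v where l: "l \<in> K" "v \<in> carrier R" "t \<otimes> a [^] m = l \<oplus> v \<otimes> c" using t(3) unfolding adjoin_mem by blast
      have kl: "k \<in> carrier R" "l \<in> carrier R" using k l ideal.Icarr[OF Ki] by auto
      \<comment> \<open>Each term of the expanded product contains \<open>k\<close>,
        \<open>l\<close> or \<open>b c\<close>, all of them in \<open>K\<close>.\<close>
      have "(s \<otimes> t) \<otimes> a [^] (n + m) = (s \<otimes> a [^] n) \<otimes> (t \<otimes> a [^] m)"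
        using s t ac by (simp add: nat_pow_mult[symmetric] m_ac)
      also have "\<dots> = k \<otimes> (l \<oplus> v \<otimes> c) \<oplus> (l \<otimes> (u \<otimes> b) \<oplus> (b \<otimes> c) \<otimes> (u \<otimes> v))"
        unfolding k(3) l(3) using kl k(2) l(2) bc(1,2) by algebra
      also have "\<dots> \<in> K"
        using ideal.I_r_closed[OF Ki] kl k l bc additive_subgroup.a_closed[OF ideal.axioms(1)[OF Ki]] by simp
      finally have "(s \<otimes> t) \<otimes> a [^] (n + m) \<in> K" .
      moreover have "s \<otimes> t \<in> carrier R - Q" using primeideal.I_prime[OF Q s(1) t(1)] s t by auto
      ultimately show False using K(1) by blast
    qed
  qed
  moreover have "J \<subseteq> K" using K(1) by blast
  ultimately show ?thesis using that KQ aK a(1) by blast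
qed

text \<open>The last entry is regular modulo the ideal of the earlier ones, so there is a prime
  strictly below \<open>Q\<close> that still contains these, and induction continues under it. Hence
  the length of a regular sequence in \<open>Q\<close> is at most the height of
  \<open>Q\<close>.\<close>

lemma prime_chain_below:
  assumes "ideal J R" "regular_seq_mod R J xs" "primeideal Q R" "J \<subseteq> Q" "set xs \<subseteq> Q"
  shows "\<exists>p. prime_chain R (length xs) p \<and> p (length xs) = Q"
  using assms(2-5)
proof (induction xs arbitrary: Q rule: rev_induct)
  case Nil
  then have "prime_chain R 0 (\<lambda>_. Q)" by (simp add: prime_chain_def)
  then show ?case by auto
next
  case (snoc a xs)
  have Qi: "ideal Q R" using snoc.prems(2) primeideal.axioms(1) by blast
  have xsc: "set xs \<subseteq> carrier R" using snoc.prems Qi ideal.Icarr by fastforce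
  have "adjoins R J xs \<subseteq> Q" using adjoins_least[OF Qi] snoc.prems by auto
  moreover have "regular_mod R (adjoins R J xs) a" using snoc.prems(1) by (simp add: regular_seq_mod_append)
  ultimately obtain P where P: "primeideal P R" "adjoins R J xs \<subseteq> P" "P \<subset> Q"
    using prime_below_regular[OF snoc.prems(2) adjoins_ideal[OF assms(1) xsc]] snoc.prems by auto
  have "J \<subseteq> P" "set xs \<subseteq> P" using adjoins_superset[OF assms(1) xsc] adjoins_mem[OF assms(1) xsc] P by auto
  then obtain p where p: "prime_chain R (length xs) p" "p (length xs) = P"
    using snoc.IH[OF _ P(1)] snoc.prems(1) by (auto simp: regular_seq_mod_append)
  then have "prime_chain R (Suc (length xs)) (p(Suc (length xs) := Q))"
    using prime_chain_snoc[OF snoc.prems(2)] P(3) by auto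
  then show ?case by (intro exI[of _ "p(Suc (length xs) := Q)"]) (simp del: fun_upd_apply, simp)
qed

text \<open>Among all extensions one is chosen whose ideal is maximal, which replaces a bound on the
  length. A further regular element \<open>x\<close> would already lie in that ideal; then
  \<open>x\<close> times \<open>\<one>\<close> is in it, and regularity gives
  \<open>\<one>\<close>.\<close>

lemma inextendable_regular_seq:
  assumes J: "ideal J R" and N: "ideal N R" "N \<noteq> carrier R" "J \<subseteq> N"
    and xs: "regular_seq_mod R J xs" "set xs \<subseteq> N"
  obtains ys where "regular_seq_mod R J (xs @ ys)" "set ys \<subseteq> N"
    "\<And>x. x \<in> N \<Longrightarrow> \<not> regular_mod R (adjoins R J (xs @ ys)) x"
proof -
  have Nc: "N \<subseteq> carrier R" using N(1) ideal.Icarr by fast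
  define S where "S = {adjoins R J (xs @ ys) | ys. regular_seq_mod R J (xs @ ys) \<and> set ys \<subseteq> N}"
  have "adjoins R J (xs @ []) \<in> S" unfolding S_def using xs by fastforce
  then have ne: "S \<noteq> {}" by blast
  have idl: "ideal K R" if K: "K \<in> S" for K
  proof -
    obtain ys where "K = adjoins R J (xs @ ys)" "set ys \<subseteq> N" using K unfolding S_def by blast
    then show ?thesis using adjoins_ideal[OF J, of "xs @ ys"] xs(2) Nc by auto
  qed
  obtain M where M: "M \<in> S" "\<And>K. K \<in> S \<Longrightarrow> M \<subseteq> K \<Longrightarrow> K = M"
    by (rule ideals_maximal[OF ne idl]) blast+
  obtain ys where ys: "M = adjoins R J (xs @ ys)" "regular_seq_mod R J (xs @ ys)" "set ys \<subseteq> N"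
    using M(1) unfolding S_def by blast
  have sub: "set (xs @ ys) \<subseteq> N" using xs ys by simp
  have Mi: "ideal M R" using ys adjoins_ideal[OF J] sub Nc by blast
  have MN: "M \<subseteq> N" unfolding ys(1) using adjoins_least[OF N(1,3) sub] .
  show ?thesis
  proof (rule that[OF ys(2,3)], rule notI)
    fix x assume x: "x \<in> N" "regular_mod R (adjoins R J (xs @ ys)) x"
    have xc: "x \<in> carrier R" using x Nc by blast
    have "adjoin R M x = adjoins R J (xs @ (ys @ [x]))" using ys(1) by simp
    moreover have "regular_seq_mod R J (xs @ (ys @ [x]))"
      using ys(2) x(2) regular_seq_mod_append[of R J "xs @ ys" "[x]"] by simp
    ultimately have "adjoin R M x \<in> S" using ys(3) x(1) unfolding S_def
      by (intro CollectI exI[of _ "ys @ [x]"]) simp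
    then have "adjoin R M x = M" using M(2) adjoin_superset[OF Mi xc] by blast
    then have "x \<otimes> \<one> \<in> M" using adjoin_self[OF Mi xc] xc by simp
    then have "\<one> \<in> M" using x(2) ys(1) unfolding regular_mod_def by auto
    then show False using MN N ideal.one_imp_carrier by fast
  qed
qed

end

section \<open>Associated primes and regular sequences in noetherian local rings\<close>

locale noetherian_local_ring = noetherian_cring R for R (structure) +
  fixes \<mm>
  assumes maximal: "maximalideal \<mm> R"
    and maximal_unique: "maximalideal J R \<Longrightarrow> J = \<mm>"
begin

lemma m_ideal: "ideal \<mm> R" using maximal maximalideal.axioms(1) by blast

lemma m_prime: "primeideal \<mm> R" using maximalideal_prime[OF maximal] .

lemma m_carrier: "x \<in> \<mm> \<Longrightarrow> x \<in> carrier R" using ideal.Icarr[OF m_ideal] .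

lemma one_notin: "\<one> \<notin> \<mm>"
  using primeideal.I_notcarr[OF m_prime] ideal.one_imp_carrier[OF m_ideal] by blast

lemma proper_ideal_le:
  assumes "ideal J R" "J \<noteq> carrier R" shows "J \<subseteq> \<mm>"
proof -
  let ?S = "{K. ideal K R \<and> J \<subseteq> K \<and> K \<noteq> carrier R}"
  obtain M where M: "M \<in> ?S" "\<And>K. K \<in> ?S \<Longrightarrow> M \<subseteq> K \<Longrightarrow> K = M"
    by (rule ideals_maximal[of ?S]) (use assms in auto)
  have "maximalideal M R"
  proof (rule maximalidealI)
    fix K assume "ideal K R" "M \<subseteq> K"
    then show "K = M \<or> K = carrier R" using M(1) M(2)[of K] by blast
  qed (use M in auto)
  then show ?thesis using maximal_unique M by blast
qed

lemma unit_iff: "x \<in> carrier R \<Longrightarrow> x \<in> Units R \<longleftrightarrow> x \<notin> \<mm>"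
proof
  assume x: "x \<in> carrier R" "x \<notin> \<mm>"
  have "PIdl x = carrier R" using proper_ideal_le[OF cgenideal_ideal[OF x(1)]] cgenideal_self[OF x(1)] x by blast
  then have "\<one> \<in> PIdl x" by simp
  then show "x \<in> Units R" using x(1) unfolding cgenideal_def Units_def by (auto simp: m_comm)
next
  assume x: "x \<in> carrier R" "x \<in> Units R"
  show "x \<notin> \<mm>"
  proof
    assume "x \<in> \<mm>"
    then have "x \<otimes> inv x \<in> \<mm>" using ideal.I_r_closed[OF m_ideal] x(2) by blast
    then show False using one_notin x by simp
  qed
qed

lemma one_minus_unit:
  assumes "b \<in> \<mm>" shows "\<one> \<ominus> b \<in> Units R"
proof -
  have b: "b \<in> carrier R" using assms m_carrier by blast
  have "\<one> \<ominus> b \<notin> \<mm>"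
  proof
    assume "\<one> \<ominus> b \<in> \<mm>"
    then have "(\<one> \<ominus> b) \<oplus> b \<in> \<mm>" using assms additive_subgroup.a_closed[OF ideal.axioms(1)[OF m_ideal]] by blast
    moreover have "(\<one> \<ominus> b) \<oplus> b = \<one>" using b by algebra
    ultimately show False using one_notin by simp
  qed
  then show ?thesis using b unit_iff by simp
qed

text \<open>The element \<open>w\<close> with annihilator \<open>(J : z)\<close> is chosen such that \<open>J + (w)\<close> is maximal.  Were it
  in \<open>J + (y)\<close>, it would be \<open>a y\<close> modulo \<open>J\<close> for some \<open>a\<close> with the same annihilator, and Nakayama's
  lemma would give a contradiction.  So \<open>w\<close> survives modulo \<open>y\<close>, where \<open>(J : z)\<close> and \<open>y\<close> kill it.\<close>

lemma associated_prime_step: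
  assumes J: "ideal J R" and z: "z \<in> carrier R" "z \<notin> J" and P: "primeideal (colon R J z) R"
    and y: "y \<in> \<mm>" "regular_mod R J y"
  obtains w where "w \<in> carrier R" "w \<notin> adjoin R J y" "primeideal (colon R (adjoin R J y) w) R"
    "colon R J z \<subset> colon R (adjoin R J y) w"
proof -
  have yc: "y \<in> carrier R" using y m_carrier by blast
  have Jy: "ideal (adjoin R J y) R" using adjoin_ideal[OF J yc] .
  have Jadd: "\<And>a b. a \<in> J \<Longrightarrow> b \<in> J \<Longrightarrow> a \<oplus> b \<in> J" using additive_subgroup.a_closed[OF ideal.axioms(1)[OF J]] .
  have Jinv: "\<And>a. a \<in> J \<Longrightarrow> \<ominus> a \<in> J" using additive_subgroup.a_inv_closed[OF ideal.axioms(1)[OF J]] .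
  let ?S = "{adjoin R J w | w. w \<in> carrier R \<and> w \<notin> J \<and> colon R J w = colon R J z}"
  obtain M where M: "M \<in> ?S" "\<And>K. K \<in> ?S \<Longrightarrow> M \<subseteq> K \<Longrightarrow> K = M"
    by (rule ideals_maximal[of ?S]) (use z adjoin_ideal[OF J] in auto)
  then obtain w where w: "M = adjoin R J w" "w \<in> carrier R" "w \<notin> J" "colon R J w = colon R J z" by blast
  have wJy: "w \<notin> adjoin R J y"
  proof
    assume "w \<in> adjoin R J y"
    then obtain j a where a: "j \<in> J" "a \<in> carrier R" "w = j \<oplus> a \<otimes> y" unfolding adjoin_mem by blast
    have jc: "j \<in> carrier R" using a ideal.Icarr[OF J] by blast
    have aJ: "a \<notin> J" using w(3) a Jadd ideal.I_r_closed[OF J _ yc] by blast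
    \<comment> \<open>Modulo \<open>J\<close> one has \<open>w x = y (a x)\<close>, and
      \<open>y\<close> is regular modulo \<open>J\<close>.\<close>
    have "x \<in> colon R J a \<longleftrightarrow> x \<in> colon R J w" if x: "x \<in> carrier R" for x
    proof
      assume "x \<in> colon R J a"
      then have "a \<otimes> x \<in> J" by (simp add: colon_def)
      then have "j \<otimes> x \<oplus> (a \<otimes> x) \<otimes> y \<in> J" using Jadd ideal.I_r_closed[OF J] a x yc by blast
      moreover have "j \<otimes> x \<oplus> (a \<otimes> x) \<otimes> y = w \<otimes> x" unfolding a(3) using jc a(2) x yc by algebra
      ultimately show "x \<in> colon R J w" using x by (simp add: colon_def)
    next
      assume "x \<in> colon R J w"
      then have "w \<otimes> x \<in> J" by (simp add: colon_def)
      then have "w \<otimes> x \<oplus> \<ominus> (j \<otimes> x) \<in> J" using Jadd Jinv ideal.I_r_closed[OF J] a x yc by blast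
      moreover have "w \<otimes> x \<oplus> \<ominus> (j \<otimes> x) = y \<otimes> (a \<otimes> x)" unfolding a(3) using jc a(2) x yc by algebra
      ultimately have "a \<otimes> x \<in> J" using y(2) a x unfolding regular_mod_def by auto
      then show "x \<in> colon R J a" using x by (simp add: colon_def)
    qed
    then have "colon R J a = colon R J z" using w(4) unfolding colon_def by blast
    then have "adjoin R J a \<in> ?S" using a aJ by blast
    moreover have "w \<in> adjoin R J a"
      unfolding adjoin_mem using a yc by (intro bexI[of _ j] bexI[of _ y]) (auto simp: m_comm)
    then have "M \<subseteq> adjoin R J a" unfolding w(1)
      using adjoin_least[OF adjoin_ideal[OF J a(2)] adjoin_superset[OF J a(2)]] by blast
    ultimately have "adjoin R J a = adjoin R J w" using M(2) w(1) by blast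
    then have "a \<in> adjoin R J w" using adjoin_self[OF J a(2)] by simp
    then obtain j' b where b: "j' \<in> J" "b \<in> carrier R" "a = j' \<oplus> b \<otimes> w" unfolding adjoin_mem by blast
    have j'c: "j' \<in> carrier R" using b ideal.Icarr[OF J] by blast
    \<comment> \<open>Substituting \<open>a y = w - j\<close> and then \<open>a = j' + b w\<close>
      leaves \<open>j' + b j\<close>, an element of \<open>J\<close>. As \<open>b y\<close> is in
      \<open>\<mm>\<close>, the factor \<open>\<one> \<ominus> b \<otimes> y\<close> is a
      unit.\<close>
    have "(\<one> \<ominus> b \<otimes> y) \<otimes> a = a \<ominus> b \<otimes> (w \<ominus> j)" unfolding a(3) using a(2) b(2) yc jc by algebra
    also have "\<dots> = j' \<oplus> b \<otimes> j" unfolding b(3) using b(2) j'c jc w(2) by algebra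
    also have "\<dots> \<in> J" using Jadd a b ideal.I_l_closed[OF J] by blast
    finally have in_J: "(\<one> \<ominus> b \<otimes> y) \<otimes> a \<in> J" .
    have u: "\<one> \<ominus> b \<otimes> y \<in> Units R" using one_minus_unit y(1) b ideal.I_l_closed[OF m_ideal] by blast
    have "inv (\<one> \<ominus> b \<otimes> y) \<otimes> ((\<one> \<ominus> b \<otimes> y) \<otimes> a) \<in> J" using in_J u ideal.I_l_closed[OF J] by simp
    then have "a \<in> J" using u a by (metis Units_closed Units_inv_closed Units_l_inv l_one m_assoc)
    then show False using aJ by blast
  qed
  \<comment> \<open>The annihilator of \<open>w\<close> modulo \<open>adjoin R J y\<close> need not
    be prime, so it is enlarged to an associated prime. The inclusion becomes strict through
    \<open>y\<close>, which kills \<open>w\<close> modulo \<open>adjoin R J y\<close> but not modulo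
    \<open>J\<close>.\<close>
  obtain v where v: "v \<in> carrier R" "v \<notin> adjoin R J y" "colon R (adjoin R J y) w \<subseteq> colon R (adjoin R J y) v"
    "primeideal (colon R (adjoin R J y) v) R"
    using associated_prime_exists[OF Jy w(2) wJy] by blast
  have "colon R J w \<subseteq> colon R (adjoin R J y) w" using adjoin_superset[OF J yc] by (auto simp: colon_def)
  moreover have "y \<in> colon R (adjoin R J y) w"
    using colon_superset[OF Jy w(2)] adjoin_self[OF J yc] by blast
  moreover have "y \<notin> colon R J w" using y(2) w yc unfolding regular_mod_def by (auto simp: colon_def m_comm)
  ultimately show ?thesis using that v w(4) by blast
qed

text \<open>Every entry of \<open>ys\<close> turns the current associated prime into a strictly
  larger one modulo one more element. In classical terms, the depth of \<open>R/J\<close> is at most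
  the dimension of \<open>R/P\<close> for each associated prime \<open>P\<close>.\<close>

lemma prime_chain_above:
  assumes "ideal J R" "regular_seq_mod R J ys" "set ys \<subseteq> \<mm>" "z \<in> carrier R" "z \<notin> J" "primeideal (colon R J z) R"
  shows "\<exists>p. prime_chain R (length ys) p \<and> p 0 = colon R J z"
  using assms
proof (induction ys arbitrary: J z)
  case Nil
  then have "prime_chain R 0 (\<lambda>_. colon R J z)" by (simp add: prime_chain_def)
  then show ?case by auto
next
  case (Cons y ys)
  obtain w where w: "w \<in> carrier R" "w \<notin> adjoin R J y" "primeideal (colon R (adjoin R J y) w) R"
    "colon R J z \<subset> colon R (adjoin R J y) w"
    using associated_prime_step[OF Cons.prems(1,4,5,6), of y] Cons.prems by auto
  obtain p where "prime_chain R (length ys) p" "p 0 = colon R (adjoin R J y) w"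
    using Cons.IH[of "adjoin R J y" w] adjoin_ideal[OF Cons.prems(1), of y] Cons.prems w m_carrier by auto
  then have "prime_chain R (length (y # ys)) (case_nat (colon R J z) p)"
    using prime_chain_Cons[OF Cons.prems(6)] w(4) by simp
  then show ?case by (intro exI[of _ "case_nat (colon R J z) p"]) simp
qed

text \<open>If all of \<open>\<mm>\<close> consists of zero divisors modulo \<open>J\<close>, it
  lies in one annihilator: depth zero means a nonzero socle.\<close>

lemma socle_element:
  assumes "ideal J R" "\<And>x. x \<in> \<mm> \<Longrightarrow> \<not> regular_mod R J x"
  obtains z where "z \<in> carrier R" "z \<notin> J" "\<And>x. x \<in> \<mm> \<Longrightarrow> z \<otimes> x \<in> J"
proof -
  obtain z where "z \<in> carrier R" "z \<notin> J" "\<mm> \<subseteq> colon R J z"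
    using zero_divisors_in_associated_prime[OF assms(1) m_ideal assms(2)] by blast
  then show ?thesis using that[of z] unfolding colon_def by blast
qed

end

section \<open>Free modules\<close>

definition unit_vec :: "('a, 'r) ring_scheme \<Rightarrow> 'x set \<Rightarrow> 'x \<Rightarrow> 'x \<Rightarrow> 'a" where
  "unit_vec R X x = (\<lambda>y\<in>X. if y = x then \<one>\<^bsub>R\<^esub> else \<zero>\<^bsub>R\<^esub>)"

text \<open>The linear map that sends the basis vector of \<open>x\<close> to \<open>g x\<close>,
  evaluated at \<open>v\<close>. The sum runs over the support of \<open>v\<close>, because
  \<open>X\<close> may be infinite while \<open>finsum\<close> is meaningful on finite sets
  only.\<close>

definition lincomb :: "('a, 'r) ring_scheme \<Rightarrow> ('a, 'b) module \<Rightarrow> 'x set \<Rightarrow> ('x \<Rightarrow> 'b) \<Rightarrow> ('x \<Rightarrow> 'a) \<Rightarrow> 'b" where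
  "lincomb R N X g v = (\<Oplus>\<^bsub>N\<^esub>x\<in>{x \<in> X. v x \<noteq> \<zero>\<^bsub>R\<^esub>}. v x \<odot>\<^bsub>N\<^esub> g x)"

section \<open>Homomorphisms as extensional functions\<close>

lemma Homs_iff: "f \<in> Homs R M N \<longleftrightarrow> f \<in> carrier M \<rightarrow>\<^sub>E carrier N \<and>
    (\<forall>x\<in>carrier M. \<forall>y\<in>carrier M. f (x \<oplus>\<^bsub>M\<^esub> y) = f x \<oplus>\<^bsub>N\<^esub> f y) \<and>
    (\<forall>a\<in>carrier R. \<forall>x\<in>carrier M. f (a \<odot>\<^bsub>M\<^esub> x) = a \<odot>\<^bsub>N\<^esub> f x)"
  by (simp add: Hom_module_def)

lemma Homs_closed: "f \<in> Homs R M N \<Longrightarrow> x \<in> carrier M \<Longrightarrow> f x \<in> carrier N"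
  unfolding Homs_iff by auto

lemma Homs_add: "f \<in> Homs R M N \<Longrightarrow> x \<in> carrier M \<Longrightarrow> y \<in> carrier M \<Longrightarrow> f (x \<oplus>\<^bsub>M\<^esub> y) = f x \<oplus>\<^bsub>N\<^esub> f y"
  unfolding Homs_iff by auto

lemma Homs_smult: "f \<in> Homs R M N \<Longrightarrow> a \<in> carrier R \<Longrightarrow> x \<in> carrier M \<Longrightarrow> f (a \<odot>\<^bsub>M\<^esub> x) = a \<odot>\<^bsub>N\<^esub> f x"
  unfolding Homs_iff by auto

lemma Homs_eqI: "f \<in> Homs R M N \<Longrightarrow> g \<in> Homs R M N \<Longrightarrow> (\<And>x. x \<in> carrier M \<Longrightarrow> f x = g x) \<Longrightarrow> f = g"
  unfolding Homs_iff by (auto intro: PiE_ext)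

lemma Homs_restrictI:
  assumes "module R M"
    and "\<And>x. x \<in> carrier M \<Longrightarrow> f x \<in> carrier N"
    and "\<And>x y. x \<in> carrier M \<Longrightarrow> y \<in> carrier M \<Longrightarrow> f (x \<oplus>\<^bsub>M\<^esub> y) = f x \<oplus>\<^bsub>N\<^esub> f y"
    and "\<And>a x. a \<in> carrier R \<Longrightarrow> x \<in> carrier M \<Longrightarrow> f (a \<odot>\<^bsub>M\<^esub> x) = a \<odot>\<^bsub>N\<^esub> f x"
  shows "restrict f (carrier M) \<in> Homs R M N"
proof -
  interpret M: module R M by fact
  show ?thesis using assms unfolding Homs_iff by auto
qed

lemma Homs_zero: 
  assumes "module R M" "module R N" "f \<in> Homs R M N" shows "f \<zero>\<^bsub>M\<^esub> = \<zero>\<^bsub>N\<^esub>"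
proof -
  interpret M: module R M by fact
  interpret N: module R N by fact
  have "f (\<zero>\<^bsub>R\<^esub> \<odot>\<^bsub>M\<^esub> \<zero>\<^bsub>M\<^esub>) = \<zero>\<^bsub>R\<^esub> \<odot>\<^bsub>N\<^esub> f \<zero>\<^bsub>M\<^esub>" using assms(3) by (intro Homs_smult) auto
  then show ?thesis using Homs_closed[OF assms(3)] by simp
qed

lemma Homs_inv: 
  assumes "module R M" "module R N" "f \<in> Homs R M N" "x \<in> carrier M" shows "f (\<ominus>\<^bsub>M\<^esub> x) = \<ominus>\<^bsub>N\<^esub> f x"
proof -
  interpret M: module R M by fact
  interpret N: module R N by fact
  have "f (\<ominus>\<^bsub>R\<^esub> \<one>\<^bsub>R\<^esub> \<odot>\<^bsub>M\<^esub> x) = \<ominus>\<^bsub>R\<^esub> \<one>\<^bsub>R\<^esub> \<odot>\<^bsub>N\<^esub> f x" using assms(3,4) by (intro Homs_smult) auto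
  then show ?thesis using Homs_closed[OF assms(3)] assms(4) by (simp add: M.smult_l_minus N.smult_l_minus)
qed

lemma Homs_minus: 
  assumes "module R M" "module R N" "f \<in> Homs R M N" "x \<in> carrier M" "y \<in> carrier M"
  shows "f (x \<ominus>\<^bsub>M\<^esub> y) = f x \<ominus>\<^bsub>N\<^esub> f y"
proof -
  interpret M: module R M by fact
  show ?thesis using assms by (simp add: a_minus_def Homs_add[OF assms(3)] Homs_inv)
qed

lemma Homs_compose:
  assumes "module R L" "f \<in> Homs R L M" "g \<in> Homs R M N" 
  shows "compose (carrier L) g f \<in> Homs R L N"
  unfolding compose_def
  by (rule Homs_restrictI[OF assms(1)]) (auto simp: Homs_closed[OF assms(2)] Homs_add[OF assms(2)] Homs_smult[OF assms(2)]
    Homs_closed[OF assms(3)] Homs_add[OF assms(3)] Homs_smult[OF assms(3)])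

lemma Homs_id:
  assumes "module R M" shows "(\<lambda>x\<in>carrier M. x) \<in> Homs R M M"
  by (rule Homs_restrictI[OF assms]) auto

lemma module_minus_add:
  assumes "module R M" "x \<in> carrier M" "y \<in> carrier M" "x' \<in> carrier M" "y' \<in> carrier M"
  shows "(x \<oplus>\<^bsub>M\<^esub> x') \<ominus>\<^bsub>M\<^esub> (y \<oplus>\<^bsub>M\<^esub> y') = (x \<ominus>\<^bsub>M\<^esub> y) \<oplus>\<^bsub>M\<^esub> (x' \<ominus>\<^bsub>M\<^esub> y')"
proof -
  interpret M: module R M by fact
  show ?thesis using assms by (simp add: a_minus_def M.minus_add M.a_ac)
qed

lemma module_smult_minus:
  assumes "module R M" "a \<in> carrier R" "x \<in> carrier M" "y \<in> carrier M"
  shows "a \<odot>\<^bsub>M\<^esub> (x \<ominus>\<^bsub>M\<^esub> y) = (a \<odot>\<^bsub>M\<^esub> x) \<ominus>\<^bsub>M\<^esub> (a \<odot>\<^bsub>M\<^esub> y)"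
proof -
  interpret M: module R M by fact
  show ?thesis using assms by (simp add: a_minus_def M.smult_r_distr M.smult_r_minus)
qed

lemma module_minus_eq_zero_iff:
  assumes "module R M" "x \<in> carrier M" "y \<in> carrier M"
  shows "x \<ominus>\<^bsub>M\<^esub> y = \<zero>\<^bsub>M\<^esub> \<longleftrightarrow> x = y"
proof -
  interpret M: module R M by fact
  show ?thesis using assms
    by (metis a_minus_def M.add.inv_closed M.minus_equality M.minus_minus M.r_neg)
qed

lemma module_minus_eq_iff:
  assumes "module R M" "x \<in> carrier M" "y \<in> carrier M" "z \<in> carrier M"
  shows "x \<ominus>\<^bsub>M\<^esub> y = z \<longleftrightarrow> x = z \<oplus>\<^bsub>M\<^esub> y"
proof -
  interpret M: module R M by fact
  show ?thesis using assms
    by (metis a_minus_def M.add.inv_closed M.add.inv_solve_right)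
qed

lemma Homs_diff:
  assumes "module R M" "module R N" "f \<in> Homs R M N" "g \<in> Homs R M N"
  shows "(\<lambda>x\<in>carrier M. f x \<ominus>\<^bsub>N\<^esub> g x) \<in> Homs R M N"
proof -
  interpret N: module R N by fact
  show ?thesis
    by (rule Homs_restrictI[OF assms(1)])
      (auto simp: Homs_closed[OF assms(3)] Homs_closed[OF assms(4)] Homs_add[OF assms(3)] Homs_add[OF assms(4)]
        Homs_smult[OF assms(3)] Homs_smult[OF assms(4)] module_minus_add[OF assms(2)] module_smult_minus[OF assms(2)] N.minus_closed)
qed

section \<open>Free modules, their universal property and lifting\<close>

context cring
begin

abbreviation "free X \<equiv> free_module R X"

lemma free_carrier: "v \<in> carrier (free X) \<longleftrightarrow> v \<in> X \<rightarrow>\<^sub>E carrier R \<and> finite {x \<in> X. v x \<noteq> \<zero>}"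
  by (simp add: free_module_def)

lemma free_coord: "v \<in> carrier (free X) \<Longrightarrow> x \<in> X \<Longrightarrow> v x \<in> carrier R"
  by (auto simp: free_carrier)

lemma free_add: "x \<in> X \<Longrightarrow> (v \<oplus>\<^bsub>free X\<^esub> w) x = v x \<oplus> w x"
  by (simp add: free_module_def)

lemma free_smult: "x \<in> X \<Longrightarrow> (a \<odot>\<^bsub>free X\<^esub> v) x = a \<otimes> v x"
  by (simp add: free_module_def)

lemma free_zero: "x \<in> X \<Longrightarrow> \<zero>\<^bsub>free X\<^esub> x = \<zero>"
  by (simp add: free_module_def)

lemma free_eqI:
  "v \<in> carrier (free X) \<Longrightarrow> w \<in> carrier (free X) \<Longrightarrow> (\<And>x. x \<in> X \<Longrightarrow> v x = w x) \<Longrightarrow> v = w"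
  unfolding free_carrier by (auto intro: PiE_ext)

lemma free_closed:
  assumes "v \<in> carrier (free X)" "w \<in> carrier (free X)" "a \<in> carrier R"
  shows "v \<oplus>\<^bsub>free X\<^esub> w \<in> carrier (free X)" "a \<odot>\<^bsub>free X\<^esub> v \<in> carrier (free X)"
proof -
  have "{x \<in> X. v x \<oplus> w x \<noteq> \<zero>} \<subseteq> {x \<in> X. v x \<noteq> \<zero>} \<union> {x \<in> X. w x \<noteq> \<zero>}" by auto
  moreover have "{x \<in> X. a \<otimes> v x \<noteq> \<zero>} \<subseteq> {x \<in> X. v x \<noteq> \<zero>}" using assms(3) by auto
  ultimately have fin: "finite {x \<in> X. v x \<oplus> w x \<noteq> \<zero>}" "finite {x \<in> X. a \<otimes> v x \<noteq> \<zero>}"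
    using assms(1,2) by (auto simp: free_carrier intro: finite_subset)
  have "{x \<in> X. (\<lambda>x\<in>X. v x \<oplus> w x) x \<noteq> \<zero>} = {x \<in> X. v x \<oplus> w x \<noteq> \<zero>}"
    "{x \<in> X. (\<lambda>x\<in>X. a \<otimes> v x) x \<noteq> \<zero>} = {x \<in> X. a \<otimes> v x \<noteq> \<zero>}" by auto
  with fin show "v \<oplus>\<^bsub>free X\<^esub> w \<in> carrier (free X)" "a \<odot>\<^bsub>free X\<^esub> v \<in> carrier (free X)"
    using assms by (auto simp: free_module_def)
qed

lemma free_zero_closed: "\<zero>\<^bsub>free X\<^esub> \<in> carrier (free X)"
proof -
  have "{x \<in> X. (\<lambda>x\<in>X. \<zero>) x \<noteq> \<zero>} = {}" by auto
  then show ?thesis by (auto simp: free_module_def)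
qed

lemma free_module: "module R (free X)"
proof (rule moduleI[OF is_cring])
  show "abelian_group (free X)"
  proof (rule abelian_groupI)
    fix x assume x: "x \<in> carrier (free X)"
    show "\<exists>y\<in>carrier (free X). y \<oplus>\<^bsub>free X\<^esub> x = \<zero>\<^bsub>free X\<^esub>"
    proof (rule bexI[of _ "\<ominus> \<one> \<odot>\<^bsub>free X\<^esub> x"])
      show c: "\<ominus> \<one> \<odot>\<^bsub>free X\<^esub> x \<in> carrier (free X)" using free_closed(2)[OF x x] by simp
      show "\<ominus> \<one> \<odot>\<^bsub>free X\<^esub> x \<oplus>\<^bsub>free X\<^esub> x = \<zero>\<^bsub>free X\<^esub>"
        by (rule free_eqI[OF free_closed(1)[OF c x one_closed] free_zero_closed])
          (simp add: free_add free_smult free_zero free_coord[OF x] l_minus l_neg)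
    qed
  qed (auto intro!: free_eqI free_closed free_zero_closed simp: free_add free_zero free_coord a_ac)
qed (auto intro!: free_eqI free_closed simp: free_add free_smult free_coord l_distr r_distr m_assoc)

lemma free_inv:
  assumes "v \<in> carrier (free X)" "x \<in> X" shows "(\<ominus>\<^bsub>free X\<^esub> v) x = \<ominus> v x"
proof -
  interpret F: module R "free X" by (rule free_module)
  have "\<ominus>\<^bsub>free X\<^esub> v = \<ominus> \<one> \<odot>\<^bsub>free X\<^esub> v" using assms by (simp add: F.smult_l_minus)
  then show ?thesis using assms by (simp add: free_smult l_minus free_coord)
qed

lemma free_minus:
  assumes "v \<in> carrier (free X)" "w \<in> carrier (free X)" "x \<in> X" shows "(v \<ominus>\<^bsub>free X\<^esub> w) x = v x \<ominus> w x"
  using assms by (simp add: a_minus_def free_add free_inv)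

lemma unit_vec_closed: "unit_vec R X x \<in> carrier (free X)"
proof -
  have "{y \<in> X. unit_vec R X x y \<noteq> \<zero>} \<subseteq> {x}" by (auto simp: unit_vec_def)
  then show ?thesis by (auto simp: free_carrier unit_vec_def intro: finite_subset)
qed

text \<open>Vectors with different supports can be added under one sum only over a common finite
  set; this passes from the support to any such set.\<close>

lemma lincomb_eq:
  assumes "module R N" "v \<in> carrier (free X)" "g \<in> X \<rightarrow> carrier N" "finite S" "S \<subseteq> X" "{x \<in> X. v x \<noteq> \<zero>} \<subseteq> S"
  shows "lincomb R N X g v = (\<Oplus>\<^bsub>N\<^esub>x\<in>S. v x \<odot>\<^bsub>N\<^esub> g x)"
proof -
  interpret N: module R N by fact
  show ?thesis unfolding lincomb_def
  proof (rule N.add.finprod_mono_neutral_cong_left[OF assms(4,6)])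
    show "v i \<odot>\<^bsub>N\<^esub> g i = \<zero>\<^bsub>N\<^esub>" if "i \<in> S - {x \<in> X. v x \<noteq> \<zero>}" for i
    proof -
      have "v i = \<zero>" "g i \<in> carrier N" using that assms(3,5) by auto
      then show ?thesis by simp
    qed
    show "(\<lambda>x. v x \<odot>\<^bsub>N\<^esub> g x) \<in> S \<rightarrow> carrier N"
    proof
      fix x assume "x \<in> S"
      then have "v x \<in> carrier R" "g x \<in> carrier N" using free_coord[OF assms(2)] assms(3,5) by auto
      then show "v x \<odot>\<^bsub>N\<^esub> g x \<in> carrier N" by simp
    qed
  qed auto
qed

lemma lincomb_Homs:
  assumes "module R N" "g \<in> X \<rightarrow> carrier N"
  shows "(\<lambda>v\<in>carrier (free X). lincomb R N X g v) \<in> Homs R (free X) N"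
proof (rule Homs_restrictI[OF free_module])
  interpret N: module R N by fact
  have cl: "(\<lambda>x. v x \<odot>\<^bsub>N\<^esub> g x) \<in> S \<rightarrow> carrier N" if "v \<in> carrier (free X)" "S \<subseteq> X" for v S
  proof
    fix x assume "x \<in> S"
    then have "v x \<in> carrier R" "g x \<in> carrier N" using free_coord[OF that(1)] assms(2) that(2) by auto
    then show "v x \<odot>\<^bsub>N\<^esub> g x \<in> carrier N" by simp
  qed
  have gx: "g x \<in> carrier N" if "x \<in> X" for x using that assms(2) by auto
  show "lincomb R N X g v \<in> carrier N" if "v \<in> carrier (free X)" for v
    unfolding lincomb_def by (rule N.finsum_closed) (rule cl[OF that], blast)
  show "lincomb R N X g (v \<oplus>\<^bsub>free X\<^esub> w) = lincomb R N X g v \<oplus>\<^bsub>N\<^esub> lincomb R N X g w"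
    if vw: "v \<in> carrier (free X)" "w \<in> carrier (free X)" for v w
  proof -
    let ?S = "{x \<in> X. v x \<noteq> \<zero>} \<union> {x \<in> X. w x \<noteq> \<zero>}"
    have S: "finite ?S" "?S \<subseteq> X" using vw by (auto simp: free_carrier)
    have sub: "{x \<in> X. (v \<oplus>\<^bsub>free X\<^esub> w) x \<noteq> \<zero>} \<subseteq> ?S" by (auto simp: free_add)
    have "lincomb R N X g (v \<oplus>\<^bsub>free X\<^esub> w) = (\<Oplus>\<^bsub>N\<^esub>x\<in>?S. (v \<oplus>\<^bsub>free X\<^esub> w) x \<odot>\<^bsub>N\<^esub> g x)"
      using lincomb_eq[OF assms(1) free_closed(1)[OF vw zero_closed] assms(2) S sub] .
    also have "\<dots> = (\<Oplus>\<^bsub>N\<^esub>x\<in>?S. (v x \<odot>\<^bsub>N\<^esub> g x) \<oplus>\<^bsub>N\<^esub> (w x \<odot>\<^bsub>N\<^esub> g x))"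
      using gx free_coord[OF vw(1)] free_coord[OF vw(2)]
      by (intro N.add.finprod_cong') (auto simp: free_add N.smult_l_distr)
    also have "\<dots> = (\<Oplus>\<^bsub>N\<^esub>x\<in>?S. v x \<odot>\<^bsub>N\<^esub> g x) \<oplus>\<^bsub>N\<^esub> (\<Oplus>\<^bsub>N\<^esub>x\<in>?S. w x \<odot>\<^bsub>N\<^esub> g x)"
      using cl[OF vw(1) S(2)] cl[OF vw(2) S(2)] by (rule N.finsum_addf)
    also have "\<dots> = lincomb R N X g v \<oplus>\<^bsub>N\<^esub> lincomb R N X g w"
      using lincomb_eq[OF assms(1) vw(1) assms(2) S] lincomb_eq[OF assms(1) vw(2) assms(2) S] by simp
    finally show ?thesis .
  qed
  show "lincomb R N X g (a \<odot>\<^bsub>free X\<^esub> v) = a \<odot>\<^bsub>N\<^esub> lincomb R N X g v"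
    if a: "a \<in> carrier R" and v: "v \<in> carrier (free X)" for a v
  proof -
    let ?S = "{x \<in> X. v x \<noteq> \<zero>}"
    have S: "finite ?S" "?S \<subseteq> X" using v by (auto simp: free_carrier)
    have sub: "{x \<in> X. (a \<odot>\<^bsub>free X\<^esub> v) x \<noteq> \<zero>} \<subseteq> ?S" using a by (auto simp: free_smult)
    have "lincomb R N X g (a \<odot>\<^bsub>free X\<^esub> v) = (\<Oplus>\<^bsub>N\<^esub>x\<in>?S. (a \<odot>\<^bsub>free X\<^esub> v) x \<odot>\<^bsub>N\<^esub> g x)"
      using lincomb_eq[OF assms(1) free_closed(2)[OF v v a] assms(2) S sub] .
    also have "\<dots> = (\<Oplus>\<^bsub>N\<^esub>x\<in>?S. a \<odot>\<^bsub>N\<^esub> (v x \<odot>\<^bsub>N\<^esub> g x))"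
      using a gx free_coord[OF v] by (intro N.add.finprod_cong') (auto simp: free_smult N.smult_assoc1)
    also have "\<dots> = a \<odot>\<^bsub>N\<^esub> lincomb R N X g v"
      unfolding lincomb_def by (rule N.finsum_smult_ldistr[symmetric, OF S(1) a cl[OF v S(2)]])
    finally show ?thesis .
  qed
qed

text \<open>Subtracting \<open>v s\<close> times a unit vector removes \<open>s\<close> from the
  support, so induction on a finite set containing the support reduces to unit vectors. A linear map
  on a free module is thus determined by its values on the basis.\<close>

lemma Homs_free_eq_lincomb:
  assumes N: "module R N" and h: "h \<in> Homs R (free X) N" and v: "v \<in> carrier (free X)"
  shows "h v = lincomb R N X (\<lambda>x. h (unit_vec R X x)) v"
proof -
  interpret N: module R N by fact
  interpret F: module R "free X" by (rule free_module)
  have u: "h (unit_vec R X x) \<in> carrier N" for x using Homs_closed[OF h unit_vec_closed] .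
  have main: "h v = lincomb R N X (\<lambda>x. h (unit_vec R X x)) v"
    if "finite S" "S \<subseteq> X" "v \<in> carrier (free X)" "{x \<in> X. v x \<noteq> \<zero>} \<subseteq> S" for S v
    using that
  proof (induction S arbitrary: v)
    case empty
    then have "v = \<zero>\<^bsub>free X\<^esub>" by (intro free_eqI free_zero_closed) (auto simp: free_zero)
    moreover have supp: "{x \<in> X. \<zero>\<^bsub>free X\<^esub> x \<noteq> \<zero>} = {}" by (auto simp: free_zero)
    have "lincomb R N X (\<lambda>x. h (unit_vec R X x)) \<zero>\<^bsub>free X\<^esub> = \<zero>\<^bsub>N\<^esub>"
      unfolding lincomb_def supp by simp
    ultimately show ?case using Homs_zero[OF free_module N h] by simp
  next
    case (insert s S)
    have sX: "s \<in> X" and vs: "v s \<in> carrier R" using insert.prems free_coord[of v] by auto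
    let ?u = "v s \<odot>\<^bsub>free X\<^esub> unit_vec R X s"
    let ?w = "v \<ominus>\<^bsub>free X\<^esub> ?u"
    have uc: "?u \<in> carrier (free X)" using vs by (simp add: unit_vec_closed)
    have wc: "?w \<in> carrier (free X)" using insert.prems uc by simp
    have wx: "?w x = (if x = s then \<zero> else v x)" if "x \<in> X" for x
    proof -
      have "?w x = v x \<ominus> v s \<otimes> unit_vec R X s x"
        using free_minus[OF insert.prems(2) uc that] free_smult[OF that] by simp
      then show ?thesis using that vs free_coord[OF insert.prems(2) that]
        by (simp add: unit_vec_def a_minus_def r_neg)
    qed
    have supp: "{x \<in> X. ?w x \<noteq> \<zero>} \<subseteq> S" using insert.prems(3) wx by (auto split: if_splits)
    have SX: "finite (insert s S)" "insert s S \<subseteq> X" "S \<subseteq> X" using insert by auto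
    have hw: "h ?w = (\<Oplus>\<^bsub>N\<^esub>x\<in>S. ?w x \<odot>\<^bsub>N\<^esub> h (unit_vec R X x))"
      using insert.IH[OF SX(3) wc supp] lincomb_eq[OF N wc _ insert.hyps(1) SX(3) supp, of "\<lambda>x. h (unit_vec R X x)"] u by simp
    have "v = ?u \<oplus>\<^bsub>free X\<^esub> ?w"
      using insert.prems(2) uc module_minus_eq_iff[OF free_module insert.prems(2) uc wc] F.a_comm[OF uc wc] by simp
    then have "h v = h ?u \<oplus>\<^bsub>N\<^esub> h ?w" using Homs_add[OF h uc wc] by simp
    also have "h ?u = v s \<odot>\<^bsub>N\<^esub> h (unit_vec R X s)" using Homs_smult[OF h vs unit_vec_closed] .
    also have "h ?w = (\<Oplus>\<^bsub>N\<^esub>x\<in>S. v x \<odot>\<^bsub>N\<^esub> h (unit_vec R X x))"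
      unfolding hw using insert.prems(1,2) insert.hyps(2) u wx free_coord[OF insert.prems(2)]
      by (intro N.add.finprod_cong') (auto simp: subset_iff)
    also have "v s \<odot>\<^bsub>N\<^esub> h (unit_vec R X s) \<oplus>\<^bsub>N\<^esub> \<dots> = (\<Oplus>\<^bsub>N\<^esub>x\<in>insert s S. v x \<odot>\<^bsub>N\<^esub> h (unit_vec R X x))"
      using insert.hyps insert.prems(1,2) u vs free_coord[OF insert.prems(2)]
      by (subst N.finsum_insert) auto
    also have "\<dots> = lincomb R N X (\<lambda>x. h (unit_vec R X x)) v"
      using lincomb_eq[OF N insert.prems(2) _ SX(1,2) insert.prems(3), of "\<lambda>x. h (unit_vec R X x)"] u by simp
    finally show ?case .
  qed
  show ?thesis by (rule main[of "{x \<in> X. v x \<noteq> \<zero>}"]) (use v in \<open>auto simp: free_carrier\<close>)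
qed

lemma Homs_free_eqI:
  assumes N: "module R N" and "h \<in> Homs R (free X) N" "k \<in> Homs R (free X) N" "v \<in> carrier (free X)"
    and "\<And>x. x \<in> X \<Longrightarrow> h (unit_vec R X x) = k (unit_vec R X x)"
  shows "h v = k v"
proof -
  interpret N: module R N by fact
  have "lincomb R N X (\<lambda>x. h (unit_vec R X x)) v = lincomb R N X (\<lambda>x. k (unit_vec R X x)) v"
    unfolding lincomb_def using assms free_coord[OF assms(4)] Homs_closed[OF assms(3) unit_vec_closed]
    by (intro N.add.finprod_cong') auto
  then show ?thesis using Homs_free_eq_lincomb[OF N assms(2,4)] Homs_free_eq_lincomb[OF N assms(3,4)] by simp
qed

lemma lincomb_unit_vec:
  assumes N: "module R N" and g: "g \<in> X \<rightarrow> carrier N" and x: "x \<in> X"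
  shows "lincomb R N X g (unit_vec R X x) = g x"
proof -
  interpret N: module R N by fact
  have gx: "g x \<in> carrier N" using g x by auto
  have "lincomb R N X g (unit_vec R X x) = (\<Oplus>\<^bsub>N\<^esub>y\<in>{x}. unit_vec R X x y \<odot>\<^bsub>N\<^esub> g y)"
    by (rule lincomb_eq[OF N unit_vec_closed g]) (use x in \<open>auto simp: unit_vec_def split: if_splits\<close>)
  also have "\<dots> = g x" using gx x by (simp add: unit_vec_def)
  finally show ?thesis .
qed

lemma Homs_free_exists:
  assumes "module R N" "g \<in> X \<rightarrow> carrier N"
  obtains h where "h \<in> Homs R (free X) N" "\<And>x. x \<in> X \<Longrightarrow> h (unit_vec R X x) = g x"
proof (rule that[OF lincomb_Homs[OF assms]])
  fix x assume "x \<in> X"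
  then show "(\<lambda>v\<in>carrier (free X). lincomb R N X g v) (unit_vec R X x) = g x"
    using lincomb_unit_vec[OF assms] by (simp add: unit_vec_closed)
qed

text \<open>The images of the basis vectors under \<open>\<alpha>\<close> after \<open>p\<close> are
  lifted one by one, extended linearly and restricted along \<open>i\<close>. The type of
  \<open>X\<close> is arbitrary: projective modules bring a basis in their own element type, free
  modules one in another type.\<close>

lemma retract_of_free_lift:
  fixes X :: "'x set"
  assumes P: "module R P" and A: "module R A" and B: "module R B"
    and ip: "i \<in> Homs R P (free X)" "p \<in> Homs R (free X) P" "\<And>x. x \<in> carrier P \<Longrightarrow> p (i x) = x"
    and \<alpha>: "\<alpha> \<in> Homs R P B" and \<gamma>: "\<gamma> \<in> Homs R A B" and im: "\<alpha> ` carrier P \<subseteq> \<gamma> ` carrier A"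
  obtains \<beta> where "\<beta> \<in> Homs R P A" "\<And>x. x \<in> carrier P \<Longrightarrow> \<gamma> (\<beta> x) = \<alpha> x"
proof -
  have "\<exists>b\<in>carrier A. \<gamma> b = \<alpha> (p (unit_vec R X x))" for x
    using im Homs_closed[OF ip(2) unit_vec_closed[of X x]] by (metis imageE image_subset_iff)
  then obtain g where g: "\<And>x. g x \<in> carrier A" "\<And>x. \<gamma> (g x) = \<alpha> (p (unit_vec R X x))" by metis
  obtain h where h: "h \<in> Homs R (free X) A" "\<And>x. x \<in> X \<Longrightarrow> h (unit_vec R X x) = g x"
    using Homs_free_exists[OF A, of g X] g by auto
  have eq: "\<gamma> (h v) = \<alpha> (p v)" if v: "v \<in> carrier (free X)" for v
  proof -
    have "compose (carrier (free X)) \<gamma> h v = compose (carrier (free X)) \<alpha> p v"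
      by (rule Homs_free_eqI[OF B Homs_compose[OF free_module h(1) \<gamma>] Homs_compose[OF free_module ip(2) \<alpha>] v])
        (simp add: compose_def unit_vec_closed h(2) g)
    then show ?thesis using v by (simp add: compose_def)
  qed
  show ?thesis
  proof (rule that[OF Homs_compose[OF P ip(1) h(1)]])
    fix x assume x: "x \<in> carrier P"
    then show "\<gamma> (compose (carrier P) h i x) = \<alpha> x"
      using eq[OF Homs_closed[OF ip(1) x]] ip(3) by (simp add: compose_def)
  qed
qed

lemma projective_lift:
  assumes "projective_module R P" "module R A" "module R B"
    and "\<alpha> \<in> Homs R P B" "\<gamma> \<in> Homs R A B" "\<alpha> ` carrier P \<subseteq> \<gamma> ` carrier A"
  obtains \<beta> where "\<beta> \<in> Homs R P A" "\<And>x. x \<in> carrier P \<Longrightarrow> \<gamma> (\<beta> x) = \<alpha> x"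
  using assms(1) retract_of_free_lift[OF _ assms(2,3) _ _ _ assms(4-6)] unfolding projective_module_def by metis

text \<open>The definition wants a basis set in the type of the module's own elements, whereas
  \<open>X\<close> has another type. So \<open>free X\<close> is exhibited as a retract of the free
  module on its carrier, by lifting the identity along the canonical surjection.\<close>

lemma free_projective:
  fixes X :: "'x set"
  shows "projective_module R (free X)"
  unfolding projective_module_def
proof
  let ?C = "carrier (free X)"
  show "module R (free X)" by (rule free_module)
  obtain c where c: "c \<in> Homs R (free ?C) (free X)" "\<And>x. x \<in> ?C \<Longrightarrow> c (unit_vec R ?C x) = x"
    using Homs_free_exists[OF free_module, of "\<lambda>x. x" ?C] by auto
  have id: "(\<lambda>x\<in>?C. x) \<in> Homs R (free X) (free X)" by (rule Homs_id[OF free_module])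
  have "(\<lambda>x\<in>?C. x) ` ?C \<subseteq> c ` carrier (free ?C)"
  proof
    fix x assume "x \<in> (\<lambda>x\<in>?C. x) ` ?C"
    then have "x \<in> ?C" by auto
    then show "x \<in> c ` carrier (free ?C)" using c(2)[of x] unit_vec_closed[of ?C x] by (metis image_eqI)
  qed
  then obtain \<beta> where \<beta>: "\<beta> \<in> Homs R (free X) (free ?C)" "\<And>x. x \<in> ?C \<Longrightarrow> c (\<beta> x) = (\<lambda>x\<in>?C. x) x"
    using retract_of_free_lift[OF free_module free_module free_module id id _ id c(1)] by auto
  show "\<exists>(Y :: ('x \<Rightarrow> 'a) set) i p. i \<in> Homs R (free X) (free Y) \<and> p \<in> Homs R (free Y) (free X) \<and> (\<forall>x\<in>?C. p (i x) = x)"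
  proof (intro exI conjI ballI)
    show "\<beta> \<in> Homs R (free X) (free ?C)" by (rule \<beta>(1))
    show "c \<in> Homs R (free ?C) (free X)" by (rule c(1))
    show "c (\<beta> x) = x" if "x \<in> ?C" for x using \<beta>(2)[OF that] that by simp
  qed
qed

end

lemma projective_resolutionD:
  assumes "projective_resolution R P d \<epsilon> M"
  shows "projective_module R (P n)" "module R (P n)" "module R M" "\<epsilon> \<in> Homs R (P 0) M" "d n \<in> Homs R (P (Suc n)) (P n)"
    "\<epsilon> ` carrier (P 0) = carrier M" "d 0 ` carrier (P 1) = {x \<in> carrier (P 0). \<epsilon> x = \<zero>\<^bsub>M\<^esub>}"
    "d (Suc n) ` carrier (P (Suc (Suc n))) = {x \<in> carrier (P (Suc n)). d n x = \<zero>\<^bsub>P n\<^esub>}"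
  using assms unfolding projective_resolution_def projective_module_def by auto

section \<open>Comparison of projective resolutions\<close>

definition chain_map ::
  "('a, 'r) ring_scheme \<Rightarrow> (nat \<Rightarrow> ('a, 'b) module) \<Rightarrow> (nat \<Rightarrow> 'b \<Rightarrow> 'b) \<Rightarrow> (nat \<Rightarrow> ('a, 'c) module) \<Rightarrow> (nat \<Rightarrow> 'c \<Rightarrow> 'c)
    \<Rightarrow> (nat \<Rightarrow> 'b \<Rightarrow> 'c) \<Rightarrow> bool" where
  "chain_map R P d P' d' f \<longleftrightarrow> (\<forall>n. f n \<in> Homs R (P n) (P' n)) \<and>
     (\<forall>n. \<forall>x\<in>carrier (P (Suc n)). d' n (f (Suc n) x) = f n (d n x))"

text \<open>The formula \<open>x - u 0 x = d 0 (h 0 x)\<close> in degree \<open>0\<close> is deliberately left out.\<close>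

definition homotopic_to_id ::
  "('a, 'r) ring_scheme \<Rightarrow> (nat \<Rightarrow> ('a, 'b) module) \<Rightarrow> (nat \<Rightarrow> 'b \<Rightarrow> 'b) \<Rightarrow> (nat \<Rightarrow> 'b \<Rightarrow> 'b) \<Rightarrow> (nat \<Rightarrow> 'b \<Rightarrow> 'b) \<Rightarrow> bool" where
  "homotopic_to_id R P d u h \<longleftrightarrow> (\<forall>n. h n \<in> Homs R (P n) (P (Suc n))) \<and>
     (\<forall>n. \<forall>x\<in>carrier (P (Suc n)).
        x \<ominus>\<^bsub>P (Suc n)\<^esub> u (Suc n) x = d (Suc n) (h (Suc n) x) \<oplus>\<^bsub>P (Suc n)\<^esub> h n (d n x))"

lemma chain_mapD:
  assumes "chain_map R P d P' d' f"
  shows "f n \<in> Homs R (P n) (P' n)" "x \<in> carrier (P (Suc n)) \<Longrightarrow> d' n (f (Suc n) x) = f n (d n x)"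
  using assms unfolding chain_map_def by blast+

lemma homotopic_to_idD:
  assumes "homotopic_to_id R P d u h"
  shows "h n \<in> Homs R (P n) (P (Suc n))"
    "x \<in> carrier (P (Suc n)) \<Longrightarrow>
      x \<ominus>\<^bsub>P (Suc n)\<^esub> u (Suc n) x = d (Suc n) (h (Suc n) x) \<oplus>\<^bsub>P (Suc n)\<^esub> h n (d n x)"
  using assms unfolding homotopic_to_id_def by blast+

context cring
begin

lemma chain_map_exists:
  assumes P: "projective_resolution R P d \<epsilon> M" and P': "projective_resolution R P' d' \<epsilon>' M"
  shows "\<exists>f. chain_map R P d P' d' f \<and> (\<forall>x\<in>carrier (P 0). \<epsilon>' (f 0 x) = \<epsilon> x)"
proof -
  note D = projective_resolutionD[OF P] and D' = projective_resolutionD[OF P']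
  \<comment> \<open>For the next map to exist, the values of \<open>f\<close> after
    \<open>d n\<close> must be boundaries; this is carried along as part of the invariant.
    Compatibility with the augmentations concerns only the start.\<close>
  let ?A = "\<lambda>n f. f \<in> Homs R (P n) (P' n) \<and> (\<forall>z\<in>carrier (P (Suc n)). f (d n z) \<in> d' n ` carrier (P' (Suc n)))
      \<and> (n = 0 \<longrightarrow> (\<forall>x\<in>carrier (P 0). \<epsilon>' (f x) = \<epsilon> x))"
  let ?B = "\<lambda>n f g. \<forall>x\<in>carrier (P (Suc n)). d' n (g x) = f (d n x)"
  have base: "\<exists>f. ?A 0 f"
  proof -
    have "\<epsilon> ` carrier (P 0) \<subseteq> \<epsilon>' ` carrier (P' 0)" using D(6) D'(6) by simp
    then obtain f where f: "f \<in> Homs R (P 0) (P' 0)" "\<And>x. x \<in> carrier (P 0) \<Longrightarrow> \<epsilon>' (f x) = \<epsilon> x"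
      by (rule projective_lift[OF D(1) D'(2) D(3) D(4) D'(4)]) auto
    have "f (d 0 z) \<in> d' 0 ` carrier (P' (Suc 0))" if "z \<in> carrier (P (Suc 0))" for z
    proof -
      have "d 0 z \<in> {x \<in> carrier (P 0). \<epsilon> x = \<zero>\<^bsub>M\<^esub>}" using D(7) that by (metis One_nat_def image_eqI)
      then show ?thesis using D'(7) f Homs_closed[OF f(1)] by simp
    qed
    then show ?thesis using f by blast
  qed
  have step: "\<exists>g. ?A (Suc n) g \<and> ?B n f g" if f: "?A n f" for n f
  proof -
    have fH: "f \<in> Homs R (P n) (P' n)" using f by blast
    have "compose (carrier (P (Suc n))) f (d n) ` carrier (P (Suc n)) \<subseteq> d' n ` carrier (P' (Suc n))"
      using f by (auto simp: compose_def)
    then obtain g where g: "g \<in> Homs R (P (Suc n)) (P' (Suc n))"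
      "\<And>x. x \<in> carrier (P (Suc n)) \<Longrightarrow> d' n (g x) = compose (carrier (P (Suc n))) f (d n) x"
      by (rule projective_lift[OF D(1) D'(2) D'(2) Homs_compose[OF D(2) D(5) fH] D'(5)]) auto
    have "g (d (Suc n) z) \<in> d' (Suc n) ` carrier (P' (Suc (Suc n)))" if z: "z \<in> carrier (P (Suc (Suc n)))" for z
    proof -
      have dz: "d (Suc n) z \<in> carrier (P (Suc n))" using z Homs_closed[OF D(5)] by blast
      have "d n (d (Suc n) z) = \<zero>\<^bsub>P n\<^esub>" using D(8)[of n] z by blast
      then have "d' n (g (d (Suc n) z)) = \<zero>\<^bsub>P' n\<^esub>" 
        using g(2)[OF dz] dz Homs_zero[OF D(2) D'(2) fH] by (simp add: compose_def)
      then show ?thesis using D'(8)[of n] Homs_closed[OF g(1) dz] by simp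
    qed
    then show ?thesis using g by (intro exI[of _ g]) (auto simp: compose_def)
  qed
  have "\<exists>f. \<forall>n. ?A n (f n) \<and> ?B n (f n) (f (Suc n))"
    by (rule dependent_nat_choice) (use base step in blast)+
  then obtain f where f: "\<forall>n. ?A n (f n) \<and> ?B n (f n) (f (Suc n))" by (rule exE)
  have "chain_map R P d P' d' f" unfolding chain_map_def using f by blast
  moreover have "\<forall>x\<in>carrier (P 0). \<epsilon>' (f 0 x) = \<epsilon> x" using f by blast
  ultimately show ?thesis by blast
qed

lemma homotopy_exists:
  assumes P: "projective_resolution R P d \<epsilon> M"
    and u: "chain_map R P d P d u" "\<And>x. x \<in> carrier (P 0) \<Longrightarrow> \<epsilon> (u 0 x) = \<epsilon> x"
  shows "\<exists>h. homotopic_to_id R P d u h"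
proof -
  note D = projective_resolutionD[OF P]
  note uH = chain_mapD(1)[OF u(1)] and u3 = chain_mapD(2)[OF u(1)]
  define e where "e n = (\<lambda>x\<in>carrier (P n). (\<lambda>x\<in>carrier (P n). x) x \<ominus>\<^bsub>P n\<^esub> u n x)" for n
  have eH: "e n \<in> Homs R (P n) (P n)" for n
    unfolding e_def by (rule Homs_diff[OF D(2) D(2) Homs_id[OF D(2)] uH])
  have e: "e n x = x \<ominus>\<^bsub>P n\<^esub> u n x" if "x \<in> carrier (P n)" for n x using that by (simp add: e_def)
  have de: "d n (e (Suc n) x) = e n (d n x)" if x: "x \<in> carrier (P (Suc n))" for n x
    using x Homs_closed[OF D(5) x] Homs_closed[OF uH x] u3[OF x]
    by (simp add: e Homs_minus[OF D(2) D(2) D(5)])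
  \<comment> \<open>On boundaries the homotopy formula reads \<open>e = d h\<close>. This is just
    what makes \<open>e (Suc n) x\<close> minus \<open>h (d n x)\<close> a cycle, so that it can be
    lifted along \<open>d (Suc n)\<close>.\<close>
  let ?A = "\<lambda>n h. h \<in> Homs R (P n) (P (Suc n)) \<and> (\<forall>z\<in>carrier (P (Suc n)). e n (d n z) = d n (h (d n z)))
      \<and> (n = 0 \<longrightarrow> (\<forall>x\<in>carrier (P 0). e 0 x = d 0 (h x)))"
  let ?B = "\<lambda>n h k. \<forall>x\<in>carrier (P (Suc n)). e (Suc n) x = d (Suc n) (k x) \<oplus>\<^bsub>P (Suc n)\<^esub> h (d n x)"
  have base: "\<exists>h. ?A 0 h"
  proof -
    interpret M: module R M by (rule D(3))
    have "e 0 ` carrier (P 0) \<subseteq> d 0 ` carrier (P (Suc 0))"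
    proof (rule image_subsetI)
      fix x assume x: "x \<in> carrier (P 0)"
      have "\<epsilon> (e 0 x) = \<epsilon> x \<ominus>\<^bsub>M\<^esub> \<epsilon> (u 0 x)"
        unfolding e[OF x] using x Homs_closed[OF uH x] by (rule Homs_minus[OF D(2) D(3) D(4)])
      also have "\<dots> = \<zero>\<^bsub>M\<^esub>" using u(2)[OF x] Homs_closed[OF D(4) x] by (simp add: a_minus_def M.r_neg)
      finally show "e 0 x \<in> d 0 ` carrier (P (Suc 0))" using D(7) Homs_closed[OF eH x] by simp
    qed
    then obtain h where "h \<in> Homs R (P 0) (P (Suc 0))" "\<And>x. x \<in> carrier (P 0) \<Longrightarrow> d 0 (h x) = e 0 x"
      by (rule projective_lift[OF D(1) D(2) D(2) eH D(5)]) auto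
    then show ?thesis using Homs_closed[OF D(5)[of 0]] by (intro exI[of _ h]) auto
  qed
  have step: "\<exists>k. ?A (Suc n) k \<and> ?B n h k" if h: "?A n h" for n h
  proof -
    interpret Pn: module R "P n" by (rule D(2))
    interpret Pn1: module R "P (Suc n)" by (rule D(2))
    have hH: "h \<in> Homs R (P n) (P (Suc n))" using h by blast
    let ?\<alpha> = "\<lambda>x\<in>carrier (P (Suc n)). e (Suc n) x \<ominus>\<^bsub>P (Suc n)\<^esub> compose (carrier (P (Suc n))) h (d n) x"
    have \<alpha>: "?\<alpha> \<in> Homs R (P (Suc n)) (P (Suc n))"
      by (rule Homs_diff[OF D(2) D(2) eH Homs_compose[OF D(2) D(5) hH]])
    have "?\<alpha> ` carrier (P (Suc n)) \<subseteq> d (Suc n) ` carrier (P (Suc (Suc n)))"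
    proof (rule image_subsetI)
      fix x assume x: "x \<in> carrier (P (Suc n))"
      have dx: "d n x \<in> carrier (P n)" using Homs_closed[OF D(5) x] .
      have "d n (?\<alpha> x) = d n (e (Suc n) x \<ominus>\<^bsub>P (Suc n)\<^esub> h (d n x))" using x by (simp add: compose_def)
      also have "\<dots> = d n (e (Suc n) x) \<ominus>\<^bsub>P n\<^esub> d n (h (d n x))"
        by (rule Homs_minus[OF D(2) D(2) D(5) Homs_closed[OF eH x] Homs_closed[OF hH dx]])
      also have "\<dots> = \<zero>\<^bsub>P n\<^esub>"
        using h x de[OF x] Homs_closed[OF D(5) Homs_closed[OF hH dx]] by (simp add: a_minus_def Pn.r_neg)
      finally show "?\<alpha> x \<in> d (Suc n) ` carrier (P (Suc (Suc n)))"
        unfolding D(8)[of n] using Homs_closed[OF \<alpha> x] by blast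
    qed
    then obtain k where k: "k \<in> Homs R (P (Suc n)) (P (Suc (Suc n)))"
      "\<And>x. x \<in> carrier (P (Suc n)) \<Longrightarrow> d (Suc n) (k x) = ?\<alpha> x"
      by (rule projective_lift[OF D(1) D(2) D(2) \<alpha> D(5)]) auto
    have B: "e (Suc n) x = d (Suc n) (k x) \<oplus>\<^bsub>P (Suc n)\<^esub> h (d n x)" if x: "x \<in> carrier (P (Suc n))" for x
    proof -
      have dx: "d n x \<in> carrier (P n)" using Homs_closed[OF D(5) x] .
      have "e (Suc n) x \<ominus>\<^bsub>P (Suc n)\<^esub> h (d n x) = d (Suc n) (k x)" using k(2)[OF x] x by (simp add: compose_def)
      then show ?thesis
        using module_minus_eq_iff[OF D(2) Homs_closed[OF eH x] Homs_closed[OF hH dx] Homs_closed[OF D(5) Homs_closed[OF k(1) x]]]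
        by simp
    qed
    have "e (Suc n) (d (Suc n) z) = d (Suc n) (k (d (Suc n) z))" if z: "z \<in> carrier (P (Suc (Suc n)))" for z
    proof -
      have dz: "d (Suc n) z \<in> carrier (P (Suc n))" using Homs_closed[OF D(5) z] .
      have "d n (d (Suc n) z) = \<zero>\<^bsub>P n\<^esub>" using D(8)[of n] z by blast
      then show ?thesis using B[OF dz] Homs_zero[OF D(2) D(2) hH] Homs_closed[OF D(5) Homs_closed[OF k(1) dz]] by simp
    qed
    then show ?thesis using k(1) B by blast
  qed
  have ex: "\<exists>h. \<forall>n. ?A n (h n) \<and> ?B n (h n) (h (Suc n))"
    by (rule dependent_nat_choice) (use base step in blast)+
  obtain h where h: "\<forall>n. ?A n (h n) \<and> ?B n (h n) (h (Suc n))" using ex by (rule exE)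
  have hH: "h n \<in> Homs R (P n) (P (Suc n))" for n using h by blast
  have "e (Suc n) x = d (Suc n) (h (Suc n) x) \<oplus>\<^bsub>P (Suc n)\<^esub> h n (d n x)" if "x \<in> carrier (P (Suc n))" for n x
    using h that by blast
  then have "homotopic_to_id R P d u h" unfolding homotopic_to_id_def using hH e by simp
  then show ?thesis by blast
qed

text \<open>Both composites lift the identity of \<open>M\<close>, so each of them is homotopic to
  the identity.\<close>

lemma resolutions_homotopy_equivalent:
  assumes P: "projective_resolution R P d \<epsilon> M" and P': "projective_resolution R P' d' \<epsilon>' M"
  obtains f g h k where "chain_map R P d P' d' f" "chain_map R P' d' P d g"
    "homotopic_to_id R P d (\<lambda>n x. g n (f n x)) h" "homotopic_to_id R P' d' (\<lambda>n x. f n (g n x)) k"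
proof -
  note D = projective_resolutionD[OF P] and D' = projective_resolutionD[OF P']
  obtain f where f: "chain_map R P d P' d' f" "\<forall>x\<in>carrier (P 0). \<epsilon>' (f 0 x) = \<epsilon> x"
    using chain_map_exists[OF P P'] by blast
  obtain g where g: "chain_map R P' d' P d g" "\<forall>x\<in>carrier (P' 0). \<epsilon> (g 0 x) = \<epsilon>' x"
    using chain_map_exists[OF P' P] by blast
  note F = chain_mapD[OF f(1)] and G = chain_mapD[OF g(1)]
  have gf: "chain_map R P d P d (\<lambda>n. compose (carrier (P n)) (g n) (f n))"
    unfolding chain_map_def using F(2) G(2) Homs_closed[OF F(1)] Homs_closed[OF D(5)] Homs_compose[OF D(2) F(1) G(1)]
    by (simp add: compose_def)
  have fg: "chain_map R P' d' P' d' (\<lambda>n. compose (carrier (P' n)) (f n) (g n))"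
    unfolding chain_map_def using F(2) G(2) Homs_closed[OF G(1)] Homs_closed[OF D'(5)] Homs_compose[OF D'(2) G(1) F(1)]
    by (simp add: compose_def)
  obtain h where h: "homotopic_to_id R P d (\<lambda>n. compose (carrier (P n)) (g n) (f n)) h"
    using homotopy_exists[OF P gf] f(2) g(2) Homs_closed[OF F(1)] by (auto simp: compose_def)
  obtain k where k: "homotopic_to_id R P' d' (\<lambda>n. compose (carrier (P' n)) (f n) (g n)) k"
    using homotopy_exists[OF P' fg] f(2) g(2) Homs_closed[OF G(1)] by (auto simp: compose_def)
  have "homotopic_to_id R P d (\<lambda>n x. g n (f n x)) h" using h unfolding homotopic_to_id_def by (simp add: compose_def)
  moreover have "homotopic_to_id R P' d' (\<lambda>n x. f n (g n x)) k" using k unfolding homotopic_to_id_def by (simp add: compose_def)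
  ultimately show ?thesis using that f(1) g(1) by blast
qed

end

section \<open>Mapping cones and the depth inequality\<close>

text \<open>The mapping cone of multiplication by \<open>x\<close> on a free complex has in degree \<open>n\<close> the free module on
  the disjoint union of \<open>K n\<close> and \<open>K (n - 1)\<close>.  Encoding that union inside \<^typ>\<open>nat\<close> keeps the types
  fixed, so that cones can be iterated.\<close>

definition interleave :: "nat set \<Rightarrow> nat set \<Rightarrow> nat set" where
  "interleave X Y = (\<lambda>k. 2 * k) ` X \<union> (\<lambda>k. Suc (2 * k)) ` Y"

definition pair_vec :: "nat set \<Rightarrow> nat set \<Rightarrow> (nat \<Rightarrow> 'a) \<Rightarrow> (nat \<Rightarrow> 'a) \<Rightarrow> nat \<Rightarrow> 'a" where
  "pair_vec X Y a b = (\<lambda>k\<in>interleave X Y. if even k then a (k div 2) else b (k div 2))"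

definition even_part :: "nat set \<Rightarrow> (nat \<Rightarrow> 'a) \<Rightarrow> nat \<Rightarrow> 'a" where
  "even_part X v = (\<lambda>k\<in>X. v (2 * k))"

definition odd_part :: "nat set \<Rightarrow> (nat \<Rightarrow> 'a) \<Rightarrow> nat \<Rightarrow> 'a" where
  "odd_part Y v = (\<lambda>k\<in>Y. v (Suc (2 * k)))"

text \<open>A minimal free resolution of \<open>R/J\<close> with \<open>R\<close> in degree \<open>0\<close>; the module in degree \<open>n\<close> is free on
  \<open>K n\<close>, and \<open>J\<close> is the image of the first differential.\<close>

definition free_resolution :: "('a, 'r) ring_scheme \<Rightarrow> 'a set \<Rightarrow> (nat \<Rightarrow> nat set) \<Rightarrow> (nat \<Rightarrow> (nat \<Rightarrow> 'a) \<Rightarrow> nat \<Rightarrow> 'a)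
    \<Rightarrow> 'a set \<Rightarrow> bool" where
  "free_resolution R \<mm> K D J \<longleftrightarrow> K 0 = {0} \<and> (\<forall>n. finite (K n)) \<and>
     (\<forall>n. D n \<in> Homs R (free_module R (K (Suc n))) (free_module R (K n))) \<and>
     (\<forall>n. D (Suc n) ` carrier (free_module R (K (Suc (Suc n)))) =
        {v \<in> carrier (free_module R (K (Suc n))). D n v = \<zero>\<^bsub>free_module R (K n)\<^esub>}) \<and>
     (\<lambda>v. D 0 v 0) ` carrier (free_module R (K 1)) = J \<and>
     (\<forall>n. \<forall>v\<in>carrier (free_module R (K (Suc n))). \<forall>k\<in>K n. D n v k \<in> \<mm>)"

lemma free_resolutionD:
  assumes "free_resolution R \<mm> K D J"
  shows "K 0 = {0}" "finite (K n)" "D n \<in> Homs R (free_module R (K (Suc n))) (free_module R (K n))"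
    "D (Suc n) ` carrier (free_module R (K (Suc (Suc n)))) =
        {v \<in> carrier (free_module R (K (Suc n))). D n v = \<zero>\<^bsub>free_module R (K n)\<^esub>}"
    "(\<lambda>v. D 0 v 0) ` carrier (free_module R (K 1)) = J"
    "v \<in> carrier (free_module R (K (Suc n))) \<Longrightarrow> k \<in> K n \<Longrightarrow> D n v k \<in> \<mm>"
  using assms unfolding free_resolution_def by blast+

section \<open>Direct sums encoded by parity, cones, and exactness modulo an ideal\<close>

context cring
begin

lemma free_carrier_finite: "finite X \<Longrightarrow> v \<in> carrier (free X) \<longleftrightarrow> v \<in> X \<rightarrow>\<^sub>E carrier R"
  by (simp add: free_carrier)

lemma interleave_finite: "finite X \<Longrightarrow> finite Y \<Longrightarrow> finite (interleave X Y)"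
  by (simp add: interleave_def)

lemma interleave_mem: "2 * k \<in> interleave X Y \<longleftrightarrow> k \<in> X" "Suc (2 * k) \<in> interleave X Y \<longleftrightarrow> k \<in> Y"
  unfolding interleave_def by (auto simp: image_iff) presburger+

lemma interleave_cases:
  assumes "i \<in> interleave X Y"
  obtains k where "i = 2 * k" "k \<in> X" | k where "i = Suc (2 * k)" "k \<in> Y"
  using assms unfolding interleave_def by blast

lemma pair_vec_nth: "k \<in> X \<Longrightarrow> pair_vec X Y a b (2 * k) = a k" "k \<in> Y \<Longrightarrow> pair_vec X Y a b (Suc (2 * k)) = b k"
  by (simp_all add: pair_vec_def interleave_mem)

lemma even_part_nth: "k \<in> X \<Longrightarrow> even_part X v k = v (2 * k)"
  and odd_part_nth: "k \<in> Y \<Longrightarrow> odd_part Y v k = v (Suc (2 * k))"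
  by (simp_all add: even_part_def odd_part_def)

context
  fixes X Y :: "nat set" assumes fin: "finite X" "finite Y"
begin

lemma pair_vec_closed:
  assumes "a \<in> carrier (free X)" "b \<in> carrier (free Y)"
  shows "pair_vec X Y a b \<in> carrier (free (interleave X Y))"
  unfolding free_carrier_finite[OF interleave_finite[OF fin]]
proof (rule PiE_I)
  fix i assume "i \<in> interleave X Y"
  then show "pair_vec X Y a b i \<in> carrier R"
    by (cases rule: interleave_cases) (use assms in \<open>auto simp: pair_vec_nth free_coord\<close>)
qed (simp add: pair_vec_def)

lemma even_part_closed: "v \<in> carrier (free (interleave X Y)) \<Longrightarrow> even_part X v \<in> carrier (free X)"
  unfolding free_carrier_finite[OF fin(1)] free_carrier_finite[OF interleave_finite[OF fin]]
  by (auto simp: even_part_def interleave_mem PiE_iff)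

lemma odd_part_closed: "v \<in> carrier (free (interleave X Y)) \<Longrightarrow> odd_part Y v \<in> carrier (free Y)"
  unfolding free_carrier_finite[OF fin(2)] free_carrier_finite[OF interleave_finite[OF fin]]
  by (auto simp: odd_part_def interleave_mem PiE_iff)

lemma interleave_eqI:
  assumes "v \<in> carrier (free (interleave X Y))" "w \<in> carrier (free (interleave X Y))"
    and "\<And>k. k \<in> X \<Longrightarrow> v (2 * k) = w (2 * k)" "\<And>k. k \<in> Y \<Longrightarrow> v (Suc (2 * k)) = w (Suc (2 * k))"
  shows "v = w"
proof (rule free_eqI[OF assms(1,2)])
  fix i assume "i \<in> interleave X Y"
  then show "v i = w i" by (cases rule: interleave_cases) (use assms(3,4) in auto)
qed

end

lemma free_resolution_ideal:
  assumes "free_resolution R \<mm> K D J" shows "ideal J R"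
proof (rule idealI[OF ring_axioms])
  note D = free_resolutionD[OF assms]
  have J: "J = (\<lambda>v. D 0 v 0) ` carrier (free (K (Suc 0)))" using D(5) by simp
  have H: "D 0 \<in> Homs R (free (K (Suc 0))) (free (K 0))" by (rule D(3))
  have 0: "0 \<in> K 0" using D(1) by simp
  interpret F: module R "free (K (Suc 0))" by (rule free_module)
  show "subgroup J (add_monoid R)"
  proof (rule add.subgroupI)
    show "J \<subseteq> carrier R" using J Homs_closed[OF H] free_coord[OF _ 0] by auto
    show "J \<noteq> {}" using J F.zero_closed by blast
    fix r assume "r \<in> J"
    then obtain v where v: "v \<in> carrier (free (K (Suc 0)))" "r = D 0 v 0" using J by blast
    have "\<ominus> r = D 0 (\<ominus>\<^bsub>free (K (Suc 0))\<^esub> v) 0"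
      using Homs_inv[OF free_module free_module H v(1)] free_inv[OF Homs_closed[OF H v(1)] 0] v(2) by simp
    then show "\<ominus> r \<in> J" using J v by blast
    fix s assume "s \<in> J"
    then obtain w where w: "w \<in> carrier (free (K (Suc 0)))" "s = D 0 w 0" using J by blast
    have "r \<oplus> s = D 0 (v \<oplus>\<^bsub>free (K (Suc 0))\<^esub> w) 0"
      using Homs_add[OF H v(1) w(1)] free_add[OF 0] v w by simp
    then show "r \<oplus> s \<in> J" using J v w by blast
  qed
  fix r x assume "r \<in> J" and x: "x \<in> carrier R"
  then obtain v where v: "v \<in> carrier (free (K (Suc 0)))" "r = D 0 v 0" using J by blast
  have "x \<otimes> r = D 0 (x \<odot>\<^bsub>free (K (Suc 0))\<^esub> v) 0"
    using Homs_smult[OF H x v(1)] free_smult[OF 0] v by simp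
  then show "x \<otimes> r \<in> J" using J v x by blast
  then show "r \<otimes> x \<in> J" using x v free_coord[OF Homs_closed[OF H v(1)] 0] by (simp add: m_comm)
qed

text \<open>The differential is \<open>(a, b) \<mapsto> (D a + x b, - D b)\<close>. Regularity of
  \<open>x\<close> on \<open>R/J\<close> makes the cone acyclic in positive degrees, its cokernel in
  degree zero is \<open>R/(J + (x))\<close>, and \<open>x \<in> \<mm>\<close> preserves
  minimality.\<close>

lemma cone_resolution:
  assumes res: "free_resolution R \<mm> K D J" and \<mm>: "ideal \<mm> R" and x: "x \<in> \<mm>" "regular_mod R J x"
  defines "L \<equiv> \<lambda>n. case n of 0 \<Rightarrow> {} | Suc m \<Rightarrow> K m"
  shows "\<exists>D'. free_resolution R \<mm> (\<lambda>n. interleave (K n) (L n)) D' (adjoin R J x)"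
proof -
  note D = free_resolutionD[OF res]
  have xc: "x \<in> carrier R" using x \<mm> ideal.Icarr by fast
  have Ji: "ideal J R" by (rule free_resolution_ideal[OF res])
  have L: "L 0 = {}" "\<And>n. L (Suc n) = K n" by (simp_all add: L_def)
  have fL: "finite (L n)" for n using D(2) by (cases n) (simp_all add: L)
  \<comment> \<open>\<open>E\<close> is the differential of the complex shifted by one degree; its
    lowest map goes to the free module on the empty set.\<close>
  define E where "E n = (case n of 0 \<Rightarrow> (\<lambda>v\<in>carrier (free (L (Suc 0))). \<zero>\<^bsub>free (L 0)\<^esub>) | Suc m \<Rightarrow> D m)" for n
  have E0: "E 0 v = \<zero>\<^bsub>free (L 0)\<^esub>" if "v \<in> carrier (free (K 0))" for v using that by (simp add: E_def L)
  have ES: "E (Suc n) = D n" for n by (simp add: E_def)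
  have EH: "E n \<in> Homs R (free (K n)) (free (L n))" for n
  proof (cases n)
    case 0
    interpret F: module R "free (L 0)" by (rule free_module)
    show ?thesis unfolding 0 E_def L nat.case using F.zero_closed F.r_zero F.smult_r_null
      by (intro Homs_restrictI[OF free_module]) (auto simp: L)
  qed (simp add: ES L D(3))
  define C where "C n = interleave (K n) (L n)" for n
  have CS: "C (Suc n) = interleave (K (Suc n)) (K n)" for n by (simp add: C_def L)
  define D1 where "D1 n v = (D n (even_part (K (Suc n)) v) \<oplus>\<^bsub>free (K n)\<^esub> (x \<odot>\<^bsub>free (K n)\<^esub> odd_part (K n) v))" for n v
  define D2 where "D2 n v = (\<ominus>\<^bsub>free (L n)\<^esub> E n (odd_part (K n) v))" for n v
  define D' where "D' n = (\<lambda>v\<in>carrier (free (C (Suc n))). pair_vec (K n) (L n) (D1 n v) (D2 n v))" for n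
  interpret F: module R "free X" for X :: "nat set" by (rule free_module)
  have evc: "even_part (K (Suc n)) v \<in> carrier (free (K (Suc n)))" and odc: "odd_part (K n) v \<in> carrier (free (K n))"
    if "v \<in> carrier (free (C (Suc n)))" for n v
    using that even_part_closed[OF D(2) D(2)] odd_part_closed[OF D(2) D(2)] unfolding CS by blast+
  have D1c: "D1 n v \<in> carrier (free (K n))" and D2c: "D2 n v \<in> carrier (free (L n))"
    if "v \<in> carrier (free (C (Suc n)))" for n v
    unfolding D1_def D2_def using Homs_closed[OF D(3) evc[OF that]] odc[OF that] Homs_closed[OF EH odc[OF that]] xc by auto
  have D1k: "D1 n v k = D n (even_part (K (Suc n)) v) k \<oplus> x \<otimes> v (Suc (2 * k))" if "k \<in> K n" for n v k
    unfolding D1_def using that by (simp add: free_add free_smult odd_part_nth)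
  have D2k: "D2 n v k = \<ominus> E n (odd_part (K n) v) k" if "v \<in> carrier (free (C (Suc n)))" "k \<in> L n" for n v k
    unfolding D2_def using that Homs_closed[OF EH odc[OF that(1)]] by (simp add: free_inv)
  have D'c: "D' n v \<in> carrier (free (C n))" if "v \<in> carrier (free (C (Suc n)))" for n v
    using pair_vec_closed[OF D(2) fL D1c[OF that] D2c[OF that]] that by (simp add: D'_def C_def)
  have D'_even: "D' n v (2 * k) = D1 n v k" if "v \<in> carrier (free (C (Suc n)))" "k \<in> K n" for n v k
    using that by (simp add: D'_def pair_vec_nth)
  have D'_odd: "D' n v (Suc (2 * k)) = D2 n v k" if "v \<in> carrier (free (C (Suc n)))" "k \<in> L n" for n v k
    using that by (simp add: D'_def pair_vec_nth)
  have Ceq: "v = w" if "v \<in> carrier (free (C n))" "w \<in> carrier (free (C n))"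
    "\<And>k. k \<in> K n \<Longrightarrow> v (2 * k) = w (2 * k)" "\<And>k. k \<in> L n \<Longrightarrow> v (Suc (2 * k)) = w (Suc (2 * k))" for v w n
    using interleave_eqI[OF D(2) fL] that unfolding C_def by blast
  have memC: "2 * k \<in> C n \<longleftrightarrow> k \<in> K n" "Suc (2 * k) \<in> C n \<longleftrightarrow> k \<in> L n" for k n
    by (simp_all add: C_def interleave_mem)
  have ev_add: "even_part (K (Suc n)) (v \<oplus>\<^bsub>free (C (Suc n))\<^esub> w) = even_part (K (Suc n)) v \<oplus>\<^bsub>free (K (Suc n))\<^esub> even_part (K (Suc n)) w"
    if "v \<in> carrier (free (C (Suc n)))" "w \<in> carrier (free (C (Suc n)))" for n v w
    by (rule free_eqI[of _ "K (Suc n)"]) (use that in \<open>simp_all add: evc odc even_part_nth odd_part_nth free_add memC L\<close>)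
  have ev_sm: "even_part (K (Suc n)) (a \<odot>\<^bsub>free (C (Suc n))\<^esub> v) = a \<odot>\<^bsub>free (K (Suc n))\<^esub> even_part (K (Suc n)) v"
    if "v \<in> carrier (free (C (Suc n)))" "a \<in> carrier R" for n v a
    by (rule free_eqI[of _ "K (Suc n)"]) (use that in \<open>simp_all add: evc odc even_part_nth odd_part_nth free_smult memC L\<close>)
  have od_add: "odd_part (K n) (v \<oplus>\<^bsub>free (C (Suc n))\<^esub> w) = odd_part (K n) v \<oplus>\<^bsub>free (K n)\<^esub> odd_part (K n) w"
    if "v \<in> carrier (free (C (Suc n)))" "w \<in> carrier (free (C (Suc n)))" for n v w
    by (rule free_eqI[of _ "K n"]) (use that in \<open>simp_all add: evc odc even_part_nth odd_part_nth free_add memC L\<close>)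
  have od_sm: "odd_part (K n) (a \<odot>\<^bsub>free (C (Suc n))\<^esub> v) = a \<odot>\<^bsub>free (K n)\<^esub> odd_part (K n) v"
    if "v \<in> carrier (free (C (Suc n)))" "a \<in> carrier R" for n v a
    by (rule free_eqI[of _ "K n"]) (use that in \<open>simp_all add: evc odc even_part_nth odd_part_nth free_smult memC L\<close>)
  have Dk: "D n w k \<in> carrier R" if "w \<in> carrier (free (K (Suc n)))" "k \<in> K n" for n w k
    using free_coord[OF Homs_closed[OF D(3) that(1)] that(2)] .
  have Ek: "E n w k \<in> carrier R" if "w \<in> carrier (free (K n))" "k \<in> L n" for n w k
    using free_coord[OF Homs_closed[OF EH that(1)] that(2)] .
  have vk: "v (Suc (2 * k)) \<in> carrier R" if "v \<in> carrier (free (C (Suc n)))" "k \<in> K n" for n v k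
    using that free_coord[of v "C (Suc n)"] by (simp add: CS interleave_mem)
  have D'H: "D' n \<in> Homs R (free (C (Suc n))) (free (C n))" for n
  proof -
    have "restrict (D' n) (carrier (free (C (Suc n)))) \<in> Homs R (free (C (Suc n))) (free (C n))"
    proof (rule Homs_restrictI[OF free_module D'c])
      fix v w assume v: "v \<in> carrier (free (C (Suc n)))" and w: "w \<in> carrier (free (C (Suc n)))"
      then have vw: "v \<oplus>\<^bsub>free (C (Suc n))\<^esub> w \<in> carrier (free (C (Suc n)))" by simp
      show "D' n (v \<oplus>\<^bsub>free (C (Suc n))\<^esub> w) = D' n v \<oplus>\<^bsub>free (C n)\<^esub> D' n w"
      proof (rule Ceq[of _ n])
        fix k assume k: "k \<in> K n"
        have "D1 n (v \<oplus>\<^bsub>free (C (Suc n))\<^esub> w) k = D n (even_part (K (Suc n)) v) k \<oplus> D n (even_part (K (Suc n)) w) k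
            \<oplus> x \<otimes> (v (Suc (2 * k)) \<oplus> w (Suc (2 * k)))"
          using k by (simp add: D1k ev_add[OF v w] Homs_add[OF D(3) evc[OF v] evc[OF w]] free_add memC L)
        also have "\<dots> = D1 n v k \<oplus> D1 n w k"
          using Dk[OF evc[OF v] k] Dk[OF evc[OF w] k] vk[OF v k] vk[OF w k] xc unfolding D1k[OF k] by algebra
        finally show "D' n (v \<oplus>\<^bsub>free (C (Suc n))\<^esub> w) (2 * k) = (D' n v \<oplus>\<^bsub>free (C n)\<^esub> D' n w) (2 * k)"
          using v w vw k by (simp add: free_add memC D'_even)
      next
        fix k assume k: "k \<in> L n"
        have "D2 n (v \<oplus>\<^bsub>free (C (Suc n))\<^esub> w) k = D2 n v k \<oplus> D2 n w k"
          using k v w vw Ek[OF odc[OF v] k] Ek[OF odc[OF w] k]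
          by (simp add: D2k od_add Homs_add[OF EH odc[OF v] odc[OF w]] free_add minus_add)
        then show "D' n (v \<oplus>\<^bsub>free (C (Suc n))\<^esub> w) (Suc (2 * k)) = (D' n v \<oplus>\<^bsub>free (C n)\<^esub> D' n w) (Suc (2 * k))"
          using v w vw k by (simp add: free_add memC D'_odd)
      qed (use v w vw D'c in auto)
    next
      fix a v assume a: "a \<in> carrier R" and v: "v \<in> carrier (free (C (Suc n)))"
      then have av: "a \<odot>\<^bsub>free (C (Suc n))\<^esub> v \<in> carrier (free (C (Suc n)))" by simp
      show "D' n (a \<odot>\<^bsub>free (C (Suc n))\<^esub> v) = a \<odot>\<^bsub>free (C n)\<^esub> D' n v"
      proof (rule Ceq[of _ n])
        fix k assume k: "k \<in> K n"
        have "D1 n (a \<odot>\<^bsub>free (C (Suc n))\<^esub> v) k = a \<otimes> D n (even_part (K (Suc n)) v) k \<oplus> x \<otimes> (a \<otimes> v (Suc (2 * k)))"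
          using k by (simp add: D1k ev_sm[OF v a] Homs_smult[OF D(3) a evc[OF v]] free_smult memC L)
        also have "\<dots> = a \<otimes> D1 n v k"
          using Dk[OF evc[OF v] k] vk[OF v k] xc a unfolding D1k[OF k] by algebra
        finally show "D' n (a \<odot>\<^bsub>free (C (Suc n))\<^esub> v) (2 * k) = (a \<odot>\<^bsub>free (C n)\<^esub> D' n v) (2 * k)"
          using v av k by (simp add: free_smult memC D'_even)
      next
        fix k assume k: "k \<in> L n"
        have "D2 n (a \<odot>\<^bsub>free (C (Suc n))\<^esub> v) k = a \<otimes> D2 n v k"
          using k v av a Ek[OF odc[OF v] k]
          by (simp add: D2k od_sm Homs_smult[OF EH a odc[OF v]] free_smult r_minus)
        then show "D' n (a \<odot>\<^bsub>free (C (Suc n))\<^esub> v) (Suc (2 * k)) = (a \<odot>\<^bsub>free (C n)\<^esub> D' n v) (Suc (2 * k))"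
          using v av k by (simp add: free_smult memC D'_odd)
      qed (use v a av D'c in auto)
    qed
    moreover have "restrict (D' n) (carrier (free (C (Suc n)))) = D' n" by (auto simp: D'_def)
    ultimately show ?thesis by simp
  qed
  have exact: "D' (Suc n) ` carrier (free (C (Suc (Suc n)))) = {v \<in> carrier (free (C (Suc n))). D' n v = \<zero>\<^bsub>free (C n)\<^esub>}" for n
  proof (intro equalityI subsetI)
    fix v assume "v \<in> D' (Suc n) ` carrier (free (C (Suc (Suc n))))"
    then obtain u where u: "u \<in> carrier (free (C (Suc (Suc n))))" "v = D' (Suc n) u" by blast
    have v: "v \<in> carrier (free (C (Suc n)))" using u D'c by blast
    let ?e = "even_part (K (Suc (Suc n))) u" and ?o = "odd_part (K (Suc n)) u"
    have ev: "even_part (K (Suc n)) v = D (Suc n) ?e \<oplus>\<^bsub>free (K (Suc n))\<^esub> (x \<odot>\<^bsub>free (K (Suc n))\<^esub> ?o)"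
      using D1c[OF u(1)] evc[OF v] unfolding D1_def[symmetric]
      by (intro free_eqI) (auto simp: even_part_nth u(2) D'_even[OF u(1)])
    have Do: "D n ?o \<in> carrier (free (K n))" using Homs_closed[OF D(3) odc[OF u(1)]] .
    have od: "odd_part (K n) v = \<ominus>\<^bsub>free (K n)\<^esub> D n ?o"
    proof (rule free_eqI[OF odc[OF v]])
      show "\<ominus>\<^bsub>free (K n)\<^esub> D n ?o \<in> carrier (free (K n))" using Do by simp
      fix k assume k: "k \<in> K n"
      have "odd_part (K n) v k = D2 (Suc n) u k" using k D'_odd[OF u(1), of k] by (simp add: odd_part_nth u(2) L)
      also have "\<dots> = \<ominus> D n ?o k" using D2k[OF u(1), of k] k by (simp add: L ES)
      also have "\<dots> = (\<ominus>\<^bsub>free (K n)\<^esub> D n ?o) k" using free_inv[OF Do k] by simp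
      finally show "odd_part (K n) v k = (\<ominus>\<^bsub>free (K n)\<^esub> D n ?o) k" .
    qed
    have De: "D (Suc n) ?e \<in> carrier (free (K (Suc n)))" using Homs_closed[OF D(3) evc[OF u(1)]] .
    have "D n (D (Suc n) ?e) = \<zero>\<^bsub>free (K n)\<^esub>" using D(4)[of n] evc[OF u(1)] by blast
    then have "D n (even_part (K (Suc n)) v) = x \<odot>\<^bsub>free (K n)\<^esub> D n ?o"
      unfolding ev using De xc odc[OF u(1)] Do
      by (simp add: Homs_add[OF D(3)] Homs_smult[OF D(3)])
    then have D1z: "D1 n v = \<zero>\<^bsub>free (K n)\<^esub>"
      unfolding D1_def od using Do xc by (simp add: F.smult_r_minus F.r_neg)
    have "E n (D n ?o) = \<zero>\<^bsub>free (L n)\<^esub>"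
    proof (cases n)
      case (Suc m)
      then show ?thesis using D(4)[of m] odc[OF u(1)] by (auto simp: ES L)
    qed (use E0 Do in auto)
    then have D2z: "D2 n v = \<zero>\<^bsub>free (L n)\<^esub>"
      unfolding D2_def od using Homs_inv[OF free_module free_module EH Do] by simp
    have "D' n v = \<zero>\<^bsub>free (C n)\<^esub>"
      by (rule Ceq[OF D'c[OF v] F.zero_closed])
        (auto simp: D'_even[OF v] D'_odd[OF v] D1z D2z free_zero memC)
    with v show "v \<in> {v \<in> carrier (free (C (Suc n))). D' n v = \<zero>\<^bsub>free (C n)\<^esub>}" by blast
  next
    fix v assume "v \<in> {v \<in> carrier (free (C (Suc n))). D' n v = \<zero>\<^bsub>free (C n)\<^esub>}"
    then have v: "v \<in> carrier (free (C (Suc n)))" "D' n v = \<zero>\<^bsub>free (C n)\<^esub>" by auto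
    let ?a = "even_part (K (Suc n)) v" and ?b = "odd_part (K n) v"
    have a: "?a \<in> carrier (free (K (Suc n)))" and b: "?b \<in> carrier (free (K n))" using evc odc v(1) by auto
    have D1z: "D1 n v = \<zero>\<^bsub>free (K n)\<^esub>"
      by (rule free_eqI[OF D1c[OF v(1)] F.zero_closed]) (simp add: D'_even[OF v(1), symmetric] v(2) free_zero memC)
    have D2z: "D2 n v = \<zero>\<^bsub>free (L n)\<^esub>"
      by (rule free_eqI[OF D2c[OF v(1)] F.zero_closed]) (simp add: D'_odd[OF v(1), symmetric] v(2) free_zero memC)
    then have Eb: "E n ?b = \<zero>\<^bsub>free (L n)\<^esub>"
      unfolding D2_def using Homs_closed[OF EH b] by (metis F.add.inv_eq_1_iff)
    have Da: "D n ?a \<in> carrier (free (K n))" using Homs_closed[OF D(3) a] .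
    \<comment> \<open>The second component says that \<open>?b\<close> is a cycle of the shifted
      complex. In degree zero this carries no information; there the first component puts
      \<open>x b\<close> into \<open>J\<close>, and regularity of \<open>x\<close> gives
      \<open>b \<in> J\<close>.\<close>
    have "\<exists>c\<in>carrier (free (K (Suc n))). ?b = D n c"
    proof (cases n)
      case (Suc m)
      then have "?b \<in> {v \<in> carrier (free (K (Suc m))). D m v = \<zero>\<^bsub>free (K m)\<^esub>}" using Eb b by (simp add: ES L)
      then show ?thesis using D(4)[of m] Suc by auto
    next
      case 0
      have k0: "0 \<in> K 0" using D(1) by simp
      have b0: "?b 0 \<in> carrier R" using b k0 0 free_coord by auto
      have "D 0 ?a 0 \<oplus> x \<otimes> ?b 0 = \<zero>"
        using D1z k0 free_zero[OF k0] unfolding 0 by (metis D1_def free_add free_smult)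
      moreover have "D 0 ?a 0 \<in> J" using D(5) a unfolding 0 by auto
      moreover have "x \<otimes> ?b 0 = \<ominus> (D 0 ?a 0)"
        using calculation(1) b0 xc ideal.Icarr[OF Ji calculation(2)]
        by (metis a_comm m_closed minus_equality)
      ultimately have "x \<otimes> ?b 0 \<in> J"
        using additive_subgroup.a_inv_closed[OF ideal.axioms(1)[OF Ji]] by simp
      then have "?b 0 \<in> J" using x(2) b0 unfolding regular_mod_def by blast
      then obtain c where c: "c \<in> carrier (free (K 1))" "?b 0 = D 0 c 0" using D(5) by blast
      have "?b = D 0 c"
        by (rule free_eqI[of _ "K 0"]) (use b c 0 D(1) Homs_closed[OF D(3)[of 0]] in auto)
      then show ?thesis using c 0 by auto
    qed
    then obtain c where c: "c \<in> carrier (free (K (Suc n)))" "?b = D n c" by blast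
    have "D n (?a \<oplus>\<^bsub>free (K (Suc n))\<^esub> (x \<odot>\<^bsub>free (K (Suc n))\<^esub> c)) = \<zero>\<^bsub>free (K n)\<^esub>"
      using D1z[unfolded D1_def c(2)] a c(1) xc
      by (simp add: Homs_add[OF D(3)] Homs_smult[OF D(3)])
    then have "?a \<oplus>\<^bsub>free (K (Suc n))\<^esub> (x \<odot>\<^bsub>free (K (Suc n))\<^esub> c) \<in> D (Suc n) ` carrier (free (K (Suc (Suc n))))"
      unfolding D(4)[of n] using a c xc by simp
    then obtain e where e: "?a \<oplus>\<^bsub>free (K (Suc n))\<^esub> (x \<odot>\<^bsub>free (K (Suc n))\<^esub> c) = D (Suc n) e"
      "e \<in> carrier (free (K (Suc (Suc n))))" by (rule imageE)
    \<comment> \<open>The preimage of \<open>(a, D c)\<close> is \<open>(e, - c)\<close>: the first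
      component of its image is \<open>D e - x c = a\<close>, the second is
      \<open>D c\<close>.\<close>
    define u where "u = pair_vec (K (Suc (Suc n))) (K (Suc n)) e (\<ominus>\<^bsub>free (K (Suc n))\<^esub> c)"
    have u: "u \<in> carrier (free (C (Suc (Suc n))))"
      unfolding u_def CS by (rule pair_vec_closed[OF D(2) D(2) e(2)]) (simp add: c)
    have eu: "even_part (K (Suc (Suc n))) u = e"
      by (rule free_eqI[OF evc[OF u] e(2)]) (simp add: even_part_nth u_def pair_vec_nth)
    have ou: "odd_part (K (Suc n)) u = \<ominus>\<^bsub>free (K (Suc n))\<^esub> c"
      by (rule free_eqI[OF odc[OF u]]) (auto simp: odd_part_nth u_def pair_vec_nth c)
    have "D1 (Suc n) u = ?a"
      unfolding D1_def eu ou e(1)[symmetric] using a c xc by (simp add: F.smult_r_minus F.a_assoc F.r_neg)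
    moreover have "D2 (Suc n) u = ?b"
      unfolding D2_def ou ES L c(2) using c Homs_closed[OF D(3) c(1)] by (simp add: Homs_inv[OF free_module free_module D(3)])
    ultimately have "D' (Suc n) u = v"
      by (intro Ceq[OF D'c[OF u] v(1)]) (auto simp: D'_even[OF u] D'_odd[OF u] even_part_nth odd_part_nth L)
    then show "v \<in> D' (Suc n) ` carrier (free (C (Suc (Suc n))))" using u by blast
  qed
  have JJ: "(\<lambda>v. D' 0 v 0) ` carrier (free (C 1)) = adjoin R J x"
  proof (intro equalityI subsetI)
    have k0: "0 \<in> K 0" using D(1) by simp
    fix r assume "r \<in> (\<lambda>v. D' 0 v 0) ` carrier (free (C 1))"
    then obtain v where v: "v \<in> carrier (free (C (Suc 0)))" "r = D' 0 v 0" by auto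
    have "r = D 0 (even_part (K (Suc 0)) v) 0 \<oplus> v 1 \<otimes> x"
      using D'_even[OF v(1) k0] D1k[OF k0] vk[OF v(1) k0] xc by (simp add: v(2) m_comm)
    moreover have "D 0 (even_part (K (Suc 0)) v) 0 \<in> J" using D(5) evc[OF v(1)] by auto
    ultimately show "r \<in> adjoin R J x" using vk[OF v(1) k0] unfolding adjoin_mem by auto
  next
    have k0: "0 \<in> K 0" using D(1) by simp
    fix r assume "r \<in> adjoin R J x"
    then obtain j a where ja: "j \<in> J" "a \<in> carrier R" "r = j \<oplus> a \<otimes> x" unfolding adjoin_mem by blast
    then obtain w where w: "w \<in> carrier (free (K (Suc 0)))" "j = D 0 w 0" using D(5) by auto
    define b where "b = (\<lambda>k\<in>K 0. a)"
    have b: "b \<in> carrier (free (K 0))" unfolding free_carrier_finite[OF D(2)] b_def using ja by auto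
    define v where "v = pair_vec (K (Suc 0)) (K 0) w b"
    have v: "v \<in> carrier (free (C (Suc 0)))" unfolding CS v_def by (rule pair_vec_closed[OF D(2) D(2) w(1) b])
    have "even_part (K (Suc 0)) v = w" by (rule free_eqI[OF evc[OF v] w(1)]) (simp add: even_part_nth v_def pair_vec_nth)
    moreover have "v (Suc (2 * 0)) = a" unfolding v_def using k0 by (subst pair_vec_nth) (auto simp: b_def)
    ultimately have "D' 0 v 0 = r" using D'_even[OF v k0] D1k[OF k0, of v] ja w xc by (simp add: m_comm)
    then show "r \<in> (\<lambda>v. D' 0 v 0) ` carrier (free (C 1))" using v by auto
  qed
  have minimal: "D' n v i \<in> \<mm>" if v: "v \<in> carrier (free (C (Suc n)))" and i: "i \<in> C n" for n v i
    using i unfolding C_def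
  proof (cases rule: interleave_cases)
    case (1 k)
    then show ?thesis
      using D'_even[OF v] D1k D(6)[OF evc[OF v]] ideal.I_r_closed[OF \<mm> x(1) vk[OF v]]
        additive_subgroup.a_closed[OF ideal.axioms(1)[OF \<mm>]] by simp
  next
    case (2 k)
    have "E n (odd_part (K n) v) k \<in> \<mm>"
      using 2 odc[OF v] D(6) by (cases n) (auto simp: L ES)
    then show ?thesis
      using 2 D'_odd[OF v] D2k[OF v] additive_subgroup.a_inv_closed[OF ideal.axioms(1)[OF \<mm>]] by simp
  qed
  have C0: "C 0 = {0}" using D(1) by (simp add: C_def L interleave_def)
  have finC: "finite (C n)" for n unfolding C_def by (rule interleave_finite[OF D(2) fL])
  have "free_resolution R \<mm> C D' (adjoin R J x)"
    unfolding free_resolution_def by (intro conjI allI ballI C0 finC D'H exact JJ minimal)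
  then show ?thesis unfolding C_def by blast
qed

text \<open>In the cone, degree \<open>p + 1\<close> holds a shifted copy of \<open>K p\<close> and
  nothing lies above it. Each entry of \<open>xs\<close> therefore raises the top degree by exactly
  one.\<close>

lemma iterated_cone_resolution:
  assumes "free_resolution R \<mm> K D J" "ideal \<mm> R" "regular_seq_mod R J xs" "set xs \<subseteq> \<mm>"
    and "K p \<noteq> {}" "\<And>i. i > p \<Longrightarrow> K i = {}"
  shows "\<exists>K' D' J'. free_resolution R \<mm> K' D' J' \<and> K' (p + length xs) \<noteq> {} \<and> (\<forall>i > p + length xs. K' i = {})"
  using assms
proof (induction xs arbitrary: K D J p)
  case (Cons x xs)
  let ?K = "\<lambda>n. interleave (K n) (case n of 0 \<Rightarrow> {} | Suc m \<Rightarrow> K m)"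
  obtain D' where D': "free_resolution R \<mm> ?K D' (adjoin R J x)"
    using cone_resolution[OF Cons.prems(1,2)] Cons.prems(3,4) by auto
  have "?K (Suc p) \<noteq> {}" using Cons.prems(5) by (auto simp: interleave_def)
  moreover have "?K i = {}" if "i > Suc p" for i
    using that Cons.prems(6)[of i] Cons.prems(6)[of "i - 1"] by (cases i) (auto simp: interleave_def)
  ultimately show ?case
    using Cons.IH[OF D' Cons.prems(2), of "Suc p"] Cons.prems(3,4) by simp
qed auto

text \<open>A linear map carries \<open>J F\<close> into \<open>J G\<close>. For
  \<open>J = \<mm>\<close> this controls minimality, for the ideal of a regular sequence it serves
  exactness modulo \<open>J\<close>.\<close>

lemma Homs_free_ideal_coords:
  assumes J: "ideal J R" and h: "h \<in> Homs R (free X) (free Y)" and v: "v \<in> carrier (free X)"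
    and vJ: "\<And>x. x \<in> X \<Longrightarrow> v x \<in> J" and y: "y \<in> Y"
  shows "h v y \<in> J"
proof -
  interpret F: module R "free Y" by (rule free_module)
  note Jz = additive_subgroup.zero_closed[OF ideal.axioms(1)[OF J]]
  have "(\<Oplus>\<^bsub>free Y\<^esub>x\<in>S. v x \<odot>\<^bsub>free Y\<^esub> h (unit_vec R X x)) y \<in> J" if "finite S" "S \<subseteq> X" for S
    using that
  proof (induction S)
    case empty
    then show ?case using y Jz by (simp add: free_zero)
  next
    case (insert s S)
    have cl: "v x \<odot>\<^bsub>free Y\<^esub> h (unit_vec R X x) \<in> carrier (free Y)" if "x \<in> insert s S" for x
      using that insert.prems free_coord[OF v] Homs_closed[OF h unit_vec_closed] by auto
    have "(v s \<odot>\<^bsub>free Y\<^esub> h (unit_vec R X s)) y \<in> J"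
      using vJ[of s] insert.prems y ideal.I_r_closed[OF J] free_coord[OF Homs_closed[OF h unit_vec_closed] y]
      by (simp add: free_smult)
    moreover have "(\<Oplus>\<^bsub>free Y\<^esub>x\<in>S. v x \<odot>\<^bsub>free Y\<^esub> h (unit_vec R X x)) y \<in> J" using insert by simp
    ultimately show ?case
      using insert.hyps cl y additive_subgroup.a_closed[OF ideal.axioms(1)[OF J]]
      by (subst F.finsum_insert) (auto simp: free_add)
  qed
  moreover have "h v = lincomb R (free Y) X (\<lambda>x. h (unit_vec R X x)) v"
    by (rule Homs_free_eq_lincomb[OF free_module h v])
  ultimately show ?thesis using v unfolding lincomb_def by (simp add: free_carrier)
qed

text \<open>Exactness of \<open>F/JF\<close> in all degrees greater than \<open>s\<close>.\<close>

definition exact_mod :: "(nat \<Rightarrow> nat set) \<Rightarrow> (nat \<Rightarrow> (nat \<Rightarrow> 'a) \<Rightarrow> nat \<Rightarrow> 'a) \<Rightarrow> 'a set \<Rightarrow> nat \<Rightarrow> bool" where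
  "exact_mod K D J s \<longleftrightarrow> (\<forall>n\<ge>s. \<forall>z\<in>carrier (free (K (Suc n))). (\<forall>k\<in>K n. D n z k \<in> J) \<longrightarrow>
     (\<exists>u\<in>carrier (free (K (Suc (Suc n)))). \<forall>k\<in>K (Suc n). z k \<ominus> D (Suc n) u k \<in> J))"

lemma exact_mod_zero:
  assumes "free_resolution R \<mm> K D J" shows "exact_mod K D {\<zero>} 0"
  unfolding exact_mod_def
proof (intro allI impI ballI)
  note D = free_resolutionD[OF assms]
  fix n z assume z: "z \<in> carrier (free (K (Suc n)))" "\<forall>k\<in>K n. D n z k \<in> {\<zero>}"
  interpret F: module R "free X" for X :: "nat set" by (rule free_module)
  have "D n z = \<zero>\<^bsub>free (K n)\<^esub>"
    by (rule free_eqI[OF Homs_closed[OF D(3) z(1)] F.zero_closed]) (use z(2) in \<open>simp add: free_zero\<close>)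
  then obtain u where u: "u \<in> carrier (free (K (Suc (Suc n))))" "z = D (Suc n) u" using D(4)[of n] z(1) by blast
  have "z k \<ominus> D (Suc n) u k \<in> {\<zero>}" if "k \<in> K (Suc n)" for k
    using u(2) free_coord[OF z(1) that] by (simp add: a_minus_def r_neg)
  then show "\<exists>u\<in>carrier (free (K (Suc (Suc n)))). \<forall>k\<in>K (Suc n). z k \<ominus> D (Suc n) u k \<in> {\<zero>}" using u(1) by blast
qed

text \<open>A chain level form of the long exact sequence for multiplication by \<open>y\<close> on
  \<open>F/JF\<close>. If \<open>D z = w' + y w\<close> with \<open>w'\<close> in
  \<open>J F\<close>, then \<open>w\<close> is a cycle modulo \<open>J\<close>, since
  \<open>y\<close> is regular. Writing \<open>w\<close> as a boundary \<open>D v\<close> modulo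
  \<open>J\<close> makes \<open>z - y v\<close> a cycle modulo \<open>J\<close>. As \<open>w\<close>
  lives one degree below \<open>z\<close>, one degree of exactness is lost.\<close>

lemma exact_mod_step:
  assumes res: "free_resolution R \<mm> K D I" and J: "ideal J R" and ex: "exact_mod K D J s"
    and y: "y \<in> carrier R" "regular_mod R J y"
  shows "exact_mod K D (adjoin R J y) (Suc s)"
  unfolding exact_mod_def
proof (intro allI impI ballI)
  note D = free_resolutionD[OF res]
  interpret F: module R "free X" for X :: "nat set" by (rule free_module)
  note Jadd = additive_subgroup.a_closed[OF ideal.axioms(1)[OF J]]
    and Jinv = additive_subgroup.a_inv_closed[OF ideal.axioms(1)[OF J]] and Jc = ideal.Icarr[OF J]
  fix n z assume n: "Suc s \<le> n" and z: "z \<in> carrier (free (K (Suc n)))" "\<forall>k\<in>K n. D n z k \<in> adjoin R J y"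
  obtain m where m: "n = Suc m" "m \<ge> s" using n by (cases n) auto
  have "\<forall>k\<in>K n. \<exists>j a. j \<in> J \<and> a \<in> carrier R \<and> D n z k = j \<oplus> a \<otimes> y" using z(2) unfolding adjoin_mem by blast
  then obtain j a where ja: "\<And>k. k \<in> K n \<Longrightarrow> j k \<in> J" "\<And>k. k \<in> K n \<Longrightarrow> a k \<in> carrier R"
    "\<And>k. k \<in> K n \<Longrightarrow> D n z k = j k \<oplus> a k \<otimes> y" by metis
  have jc: "j k \<in> carrier R" if "k \<in> K n" for k using ja(1)[OF that] Jc by blast
  define w' w where "w' = restrict j (K n)" and "w = restrict a (K n)"
  have w'c: "w' \<in> carrier (free (K n))" and wc: "w \<in> carrier (free (K n))"
    unfolding free_carrier_finite[OF D(2)] w'_def w_def using jc ja by auto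
  have Dz: "D n z = w' \<oplus>\<^bsub>free (K n)\<^esub> (y \<odot>\<^bsub>free (K n)\<^esub> w)"
    by (rule free_eqI[OF Homs_closed[OF D(3) z(1)]])
      (use w'c wc y ja in \<open>auto simp: free_add free_smult w'_def w_def m_comm\<close>)
  have w'm: "w' \<in> carrier (free (K (Suc m)))" and wm: "w \<in> carrier (free (K (Suc m)))" using w'c wc m by auto
  have "D m (D n z) = \<zero>\<^bsub>free (K m)\<^esub>" using D(4)[of m] z(1) unfolding m by blast
  then have 0: "D m w' \<oplus>\<^bsub>free (K m)\<^esub> (y \<odot>\<^bsub>free (K m)\<^esub> D m w) = \<zero>\<^bsub>free (K m)\<^esub>"
    unfolding Dz using w'm wm y m by (simp add: Homs_add[OF D(3)] Homs_smult[OF D(3)])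
  have "D m w k \<in> J" if k: "k \<in> K m" for k
  proof -
    have c: "D m w' k \<in> carrier R" "D m w k \<in> carrier R"
      using free_coord[OF Homs_closed[OF D(3)] k] w'm wm by auto
    have "D m w' k \<in> J" by (rule Homs_free_ideal_coords[OF J D(3) w'm _ k]) (use ja(1) m in \<open>auto simp: w'_def\<close>)
    moreover have "D m w' k \<oplus> y \<otimes> D m w k = \<zero>" using 0 k by (metis free_add free_smult free_zero)
    then have "y \<otimes> D m w k = \<ominus> (D m w' k)" using c y by (metis a_comm m_closed minus_equality)
    ultimately have "y \<otimes> D m w k \<in> J" using Jinv by simp
    then show ?thesis using y c unfolding regular_mod_def by blast
  qed
  then obtain v where v: "v \<in> carrier (free (K (Suc n)))" "\<And>k. k \<in> K n \<Longrightarrow> w k \<ominus> D n v k \<in> J"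
    using ex[unfolded exact_mod_def, rule_format, OF m(2) wm] m(1) by blast
  define t where "t = z \<ominus>\<^bsub>free (K (Suc n))\<^esub> (y \<odot>\<^bsub>free (K (Suc n))\<^esub> v)"
  have t: "t \<in> carrier (free (K (Suc n)))" unfolding t_def using z v y by simp
  have "D n t k \<in> J" if k: "k \<in> K n" for k
  proof -
    have c: "D n v k \<in> carrier R" "w k \<in> carrier R" "w' k \<in> carrier R"
      using free_coord[OF Homs_closed[OF D(3) v(1)] k] free_coord[OF wc k] free_coord[OF w'c k] by auto
    have "D n t = D n z \<ominus>\<^bsub>free (K n)\<^esub> (y \<odot>\<^bsub>free (K n)\<^esub> D n v)"
      unfolding t_def using z v y by (simp add: Homs_minus[OF free_module free_module D(3)] Homs_smult[OF D(3)])
    then have "D n t k = D n z k \<ominus> y \<otimes> D n v k"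
      using z v y k Homs_closed[OF D(3)] by (simp add: free_minus free_smult)
    also have "\<dots> = w' k \<oplus> y \<otimes> (w k \<ominus> D n v k)"
      unfolding Dz free_add[OF k] free_smult[OF k] using c y by algebra
    also have "\<dots> \<in> J"
      using Jadd v(2)[OF k] ideal.I_l_closed[OF J] y ja(1)[OF k] k by (simp add: w'_def)
    finally show ?thesis .
  qed
  then obtain u where u: "u \<in> carrier (free (K (Suc (Suc n))))" "\<And>k. k \<in> K (Suc n) \<Longrightarrow> t k \<ominus> D (Suc n) u k \<in> J"
    using ex[unfolded exact_mod_def, rule_format, OF _ t] n by auto
  have "z k \<ominus> D (Suc n) u k \<in> adjoin R J y" if k: "k \<in> K (Suc n)" for k
  proof -
    have c: "z k \<in> carrier R" "v k \<in> carrier R" "D (Suc n) u k \<in> carrier R"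
      using free_coord[OF z(1) k] free_coord[OF v(1) k] free_coord[OF Homs_closed[OF D(3) u(1)] k] by auto
    have "t k = z k \<ominus> y \<otimes> v k" unfolding t_def using z v y k by (simp add: free_minus free_smult)
    then have "z k \<ominus> D (Suc n) u k = (t k \<ominus> D (Suc n) u k) \<oplus> v k \<otimes> y" using c y by (simp, algebra)
    then show ?thesis using u(2)[OF k] c unfolding adjoin_mem by blast
  qed
  then show "\<exists>u\<in>carrier (free (K (Suc (Suc n)))). \<forall>k\<in>K (Suc n). z k \<ominus> D (Suc n) u k \<in> adjoin R J y" using u(1) by blast
qed

lemma exact_mod_adjoins:
  assumes "free_resolution R \<mm> K D I" "ideal J R" "exact_mod K D J s" "set ys \<subseteq> carrier R" "regular_seq_mod R J ys"
  shows "exact_mod K D (adjoins R J ys) (s + length ys)"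
  using assms
proof (induction ys arbitrary: J s)
  case (Cons y ys)
  then show ?case
    using Cons.IH[of "adjoin R J y" "Suc s"] adjoin_ideal[of J y] exact_mod_step[OF Cons.prems(1-3), of y] by simp
qed simp

end

section \<open>The depth inequality and the length of inextendable regular sequences\<close>

context noetherian_local_ring
begin

text \<open>The inequality \<open>pd R/J + depth R/J \<le> depth R\<close> of Auslander and Buchsbaum.  If it failed, the
  iterated cone would be exact modulo \<open>ys\<close> in its top degree.  But there the differential has entries
  in \<open>\<mm>\<close>, so it kills all multiples of a socle element of \<open>R/(ys)\<close>.\<close>

lemma depth_inequality:
  assumes res: "free_resolution R \<mm> K D J" and p: "K p \<noteq> {}" "\<And>i. i > p \<Longrightarrow> K i = {}"
    and xs: "regular_seq_mod R J xs" "set xs \<subseteq> \<mm>"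
    and ys: "regular_seq_mod R {\<zero>} ys" "set ys \<subseteq> \<mm>" "\<And>y. y \<in> \<mm> \<Longrightarrow> \<not> regular_mod R (adjoins R {\<zero>} ys) y"
  shows "p + length xs \<le> length ys"
proof (rule ccontr)
  let ?J = "adjoins R {\<zero>} ys" and ?q = "p + length xs"
  assume "\<not> ?thesis"
  \<comment> \<open>Exactness modulo \<open>ys\<close> holds for cycles in degree
    \<open>Suc n\<close> as soon as \<open>length ys \<le> n\<close>. With the top degree equal to
    \<open>Suc n\<close>, this is precisely the failure of the inequality.\<close>
  then obtain n where n: "?q = Suc n" "length ys \<le> n" by (cases ?q) auto
  have ysc: "set ys \<subseteq> carrier R" using ys(2) m_carrier by blast
  have Ji: "ideal ?J R" by (rule adjoins_ideal[OF zeroideal ysc])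
  obtain K' D' J' where K': "free_resolution R \<mm> K' D' J'" "K' ?q \<noteq> {}" "\<And>i. i > ?q \<Longrightarrow> K' i = {}"
    using iterated_cone_resolution[OF res m_ideal xs p] by blast
  note D = free_resolutionD[OF K'(1)]
  interpret F: module R "free X" for X :: "nat set" by (rule free_module)
  obtain k where k: "k \<in> K' (Suc n)" using K'(2) n(1) by auto
  obtain z where z: "z \<in> carrier R" "z \<notin> ?J" "\<And>x. x \<in> \<mm> \<Longrightarrow> z \<otimes> x \<in> ?J"
    using socle_element[OF Ji ys(3)] by blast
  define v where "v = z \<odot>\<^bsub>free (K' (Suc n))\<^esub> unit_vec R (K' (Suc n)) k"
  have v: "v \<in> carrier (free (K' (Suc n)))" unfolding v_def using z by (simp add: unit_vec_closed)
  have "D' n v i \<in> ?J" if i: "i \<in> K' n" for i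
    unfolding v_def using z D(6)[OF unit_vec_closed i] i by (simp add: Homs_smult[OF D(3)] unit_vec_closed free_smult)
  moreover have "exact_mod K' D' ?J (length ys)"
    using exact_mod_adjoins[OF K'(1) zeroideal exact_mod_zero[OF K'(1)] ysc ys(1)] by simp
  ultimately obtain u where u: "u \<in> carrier (free (K' (Suc (Suc n))))" "v k \<ominus> D' (Suc n) u k \<in> ?J"
    using n(2) v k unfolding exact_mod_def by blast
  have "K' (Suc (Suc n)) = {}" using K'(3)[of "Suc (Suc n)"] n(1) by simp
  then have "u = \<zero>\<^bsub>free (K' (Suc (Suc n)))\<^esub>" using u(1) by (intro free_eqI[OF u(1) F.zero_closed]) simp
  then have "D' (Suc n) u k = \<zero>" using Homs_zero[OF free_module free_module D(3)] free_zero[OF k] by simp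
  moreover have "v k = z" unfolding v_def using k z by (simp add: free_smult unit_vec_def)
  ultimately show False using u(2) z by (simp add: a_minus_def)
qed

text \<open>\<open>R\<close> is its own resolution, concentrated in degree zero. With
  \<open>J = {\<zero>}\<close> and \<open>p = 0\<close> the depth inequality compares two regular
  sequences: an inextendable one is at least as long as any other.\<close>

lemma regular_seq_length_le:
  assumes "regular_seq_mod R {\<zero>} xs" "set xs \<subseteq> \<mm>"
    and "regular_seq_mod R {\<zero>} ys" "set ys \<subseteq> \<mm>" "\<And>y. y \<in> \<mm> \<Longrightarrow> \<not> regular_mod R (adjoins R {\<zero>} ys) y"
  shows "length xs \<le> length ys"
proof -
  define K :: "nat \<Rightarrow> nat set" where "K n = (if n = 0 then {0} else {})" for n
  define D where "D n = (\<lambda>v\<in>carrier (free (K (Suc n))). \<zero>\<^bsub>free (K n)\<^esub>)" for n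
  interpret F: module R "free X" for X :: "nat set" by (rule free_module)
  have z: "v = \<zero>\<^bsub>free (K (Suc n))\<^esub>" if "v \<in> carrier (free (K (Suc n)))" for v n
    by (rule free_eqI[OF that F.zero_closed]) (simp add: K_def)
  have Dv: "D n v = \<zero>\<^bsub>free (K n)\<^esub>" if "v \<in> carrier (free (K (Suc n)))" for n v using that by (simp add: D_def)
  have zm: "\<zero> \<in> \<mm>" using additive_subgroup.zero_closed[OF ideal.axioms(1)[OF m_ideal]] .
  have "free_resolution R \<mm> K D {\<zero>}"
    unfolding free_resolution_def
  proof (intro conjI allI ballI)
    show "D n \<in> Homs R (free (K (Suc n))) (free (K n))" for n
      unfolding D_def by (rule Homs_restrictI[OF free_module]) auto
    show "D (Suc n) ` carrier (free (K (Suc (Suc n)))) = {v \<in> carrier (free (K (Suc n))). D n v = \<zero>\<^bsub>free (K n)\<^esub>}" for n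
    proof (intro equalityI subsetI)
      fix v assume "v \<in> {v \<in> carrier (free (K (Suc n))). D n v = \<zero>\<^bsub>free (K n)\<^esub>}"
      then have "v = D (Suc n) \<zero>\<^bsub>free (K (Suc (Suc n)))\<^esub>" using z[of v n] Dv[of "\<zero>\<^bsub>free (K (Suc (Suc n)))\<^esub>" "Suc n"] by simp
      then show "v \<in> D (Suc n) ` carrier (free (K (Suc (Suc n))))" by blast
    qed (auto simp: Dv)
    show "(\<lambda>v. D 0 v 0) ` carrier (free (K 1)) = {\<zero>}"
      using Dv[of _ 0] F.zero_closed[of "K 1"] by (auto simp: free_zero K_def image_iff)
    show "D n v k \<in> \<mm>" if "v \<in> carrier (free (K (Suc n)))" "k \<in> K n" for n v k
      using that zm by (simp add: Dv free_zero)
  qed (simp_all add: K_def)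
  then show ?thesis using depth_inequality[of K D "{\<zero>}" 0 xs ys] assms by (auto simp: K_def)
qed

end

section \<open>Minimal free resolutions\<close>

text \<open>Testing against all submodules replaces the intersection in \<open>span\<close>.\<close>

definition generates :: "('a, 'r) ring_scheme \<Rightarrow> ('a, 'b) module \<Rightarrow> 'b set \<Rightarrow> bool" where
  "generates R M G \<longleftrightarrow> finite G \<and> G \<subseteq> carrier M \<and> (\<forall>N. submodule N R M \<longrightarrow> G \<subseteq> N \<longrightarrow> carrier M \<subseteq> N)"

lemma span_eq_carrier_iff:
  assumes "module R M" "G \<subseteq> carrier M"
  shows "span R M G = carrier M \<longleftrightarrow> (\<forall>N. submodule N R M \<longrightarrow> G \<subseteq> N \<longrightarrow> carrier M \<subseteq> N)"
proof -
  have "span R M G \<subseteq> carrier M" unfolding span_def using module.carrier_is_submodule[OF assms(1)] assms(2) by blast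
  then show ?thesis unfolding span_def by blast
qed

lemma min_gens_eq_generates:
  assumes "module R M" shows "min_gens R M = Inf {enat (card G) | G. generates R M G}"
proof -
  have "finite G \<and> G \<subseteq> carrier M \<and> span R M G = carrier M \<longleftrightarrow> generates R M G" for G
    unfolding generates_def using span_eq_carrier_iff[OF assms] by blast
  then show ?thesis unfolding min_gens_def by simp
qed

lemma min_gens_attained:
  assumes M: "module R M" and "generates R M G"
  obtains H where "generates R M H" "min_gens R M = enat (card H)" "\<And>H'. generates R M H' \<Longrightarrow> card H \<le> card H'"
proof -
  let ?P = "\<lambda>n. \<exists>H. generates R M H \<and> card H = n"
  have "?P (LEAST n. ?P n)" by (rule LeastI[of ?P "card G"]) (use assms in blast)
  then obtain H where H: "generates R M H" "card H = (LEAST n. ?P n)" by blast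
  have le: "card H \<le> card H'" if "generates R M H'" for H' unfolding H(2) by (rule Least_le) (use that in blast)
  have "min_gens R M = enat (card H)"
    unfolding min_gens_eq_generates[OF M] by (rule antisym) (use H(1) le in \<open>auto intro: Inf_lower Inf_greatest\<close>)
  then show ?thesis using that H(1) le by blast
qed

context module
begin

lemma finsum_in_submodule:
  assumes "submodule N R M" "finite S" "\<And>x. x \<in> S \<Longrightarrow> f x \<in> N"
  shows "(\<Oplus>\<^bsub>M\<^esub>x\<in>S. f x) \<in> N"
  using assms(2,3)
proof (induction S)
  case empty
  have "\<zero>\<^bsub>M\<^esub> \<in> N" using subgroup.one_closed[OF submodule.axioms(1)[OF assms(1)]] by simp
  then show ?case by simp
next
  case (insert x S)
  then show ?case using submoduleE(1,5)[OF assms(1)] by (subst M.finsum_insert) auto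
qed

end

lemma Homs_image_submodule:
  assumes M: "module R M" and N: "module R N" and h: "h \<in> Homs R M N"
  shows "submodule (h ` carrier M) R N"
proof -
  interpret M: module R M by fact
  interpret N: module R N by fact
  show ?thesis
  proof (rule N.submoduleI)
    show "h ` carrier M \<subseteq> carrier N" using Homs_closed[OF h] by blast
    show "\<zero>\<^bsub>N\<^esub> \<in> h ` carrier M" using Homs_zero[OF M N h] M.zero_closed by (metis imageI)
    show "\<ominus>\<^bsub>N\<^esub> a \<in> h ` carrier M" if "a \<in> h ` carrier M" for a
      using that Homs_inv[OF M N h] M.a_inv_closed by (metis (no_types, lifting) imageE imageI)
    show "a \<oplus>\<^bsub>N\<^esub> b \<in> h ` carrier M" if ab: "a \<in> h ` carrier M" "b \<in> h ` carrier M" for a b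
    proof -
      obtain v w where vw: "v \<in> carrier M" "a = h v" "w \<in> carrier M" "b = h w" using ab by blast
      then have "a \<oplus>\<^bsub>N\<^esub> b = h (v \<oplus>\<^bsub>M\<^esub> w)" using Homs_add[OF h] by simp
      then show ?thesis using vw by simp
    qed
    show "a \<odot>\<^bsub>N\<^esub> b \<in> h ` carrier M" if ab: "a \<in> carrier R" "b \<in> h ` carrier M" for a b
    proof -
      obtain v where v: "v \<in> carrier M" "b = h v" using ab by blast
      then have "a \<odot>\<^bsub>N\<^esub> b = h (a \<odot>\<^bsub>M\<^esub> v)" using Homs_smult[OF h ab(1)] by simp
      then show ?thesis using v ab by simp
    qed
  qed
qed

lemma Homs_kernel_submodule:
  assumes M: "module R M" and N: "module R N" and h: "h \<in> Homs R M N"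
  shows "submodule {x \<in> carrier M. h x = \<zero>\<^bsub>N\<^esub>} R M"
proof -
  interpret M: module R M by fact
  interpret N: module R N by fact
  show ?thesis
    by (rule M.submoduleI) (auto simp: Homs_zero[OF M N h] Homs_inv[OF M N h] Homs_add[OF h] Homs_smult[OF h])
qed

lemma Homs_vimage_submodule:
  assumes M: "module R M" and N: "module R N" and h: "h \<in> Homs R M N" and S: "submodule S R N"
  shows "submodule {x \<in> carrier M. h x \<in> S} R M"
proof -
  interpret M: module R M by fact
  interpret N: module R N by fact
  have "\<zero>\<^bsub>N\<^esub> \<in> S" using subgroup.one_closed[OF submodule.axioms(1)[OF S]] by simp
  then show ?thesis
    using N.submoduleE[OF S]
    by (intro M.submoduleI) (auto simp: Homs_zero[OF M N h] Homs_inv[OF M N h] Homs_add[OF h] Homs_smult[OF h])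
qed

context cring
begin

lemma Homs_free_in_submodule:
  assumes N: "module R N" and h: "h \<in> Homs R (free X) N" and v: "v \<in> carrier (free X)"
    and S: "submodule S R N" "\<And>x. x \<in> X \<Longrightarrow> v x \<noteq> \<zero> \<Longrightarrow> h (unit_vec R X x) \<in> S"
  shows "h v \<in> S"
proof -
  interpret N: module R N by fact
  have "(\<Oplus>\<^bsub>N\<^esub>x\<in>{x \<in> X. v x \<noteq> \<zero>}. v x \<odot>\<^bsub>N\<^esub> h (unit_vec R X x)) \<in> S"
  proof (rule N.finsum_in_submodule[OF S(1)])
    show "finite {x \<in> X. v x \<noteq> \<zero>}" using v by (simp add: free_carrier)
    show "v x \<odot>\<^bsub>N\<^esub> h (unit_vec R X x) \<in> S" if "x \<in> {x \<in> X. v x \<noteq> \<zero>}" for x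
      using that S(2) N.submoduleE(4)[OF S(1)] free_coord[OF v] by auto
  qed
  then show ?thesis using Homs_free_eq_lincomb[OF N h v] unfolding lincomb_def by simp
qed

lemma generates_submodule:
  assumes M: "module R M" and N: "submodule N R M" and G: "finite G" "G \<subseteq> N"
    and gen: "\<And>S. submodule S R M \<Longrightarrow> G \<subseteq> S \<Longrightarrow> N \<subseteq> S"
  shows "generates R (M\<lparr>carrier := N\<rparr>) G"
proof -
  interpret M: module R M by fact
  interpret N: module R "M\<lparr>carrier := N\<rparr>" by (rule submodule.submodule_is_module[OF N M])
  have "N \<subseteq> S" if S: "submodule S R (M\<lparr>carrier := N\<rparr>)" "G \<subseteq> S" for S
  proof (rule gen[OF _ S(2)])
    have SN: "S \<subseteq> N" using N.submoduleE(1)[OF S(1)] by simp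
    have NM: "N \<subseteq> carrier M" using M.submoduleE(1)[OF N] .
    show "submodule S R M"
    proof (rule M.submoduleI)
      show "\<zero>\<^bsub>M\<^esub> \<in> S" using subgroup.one_closed[OF submodule.axioms(1)[OF S(1)]] by simp
      show "\<ominus>\<^bsub>M\<^esub> a \<in> S" if a: "a \<in> S" for a
      proof -
        have "(\<ominus> \<one>) \<odot>\<^bsub>M\<^esub> a \<in> S" using N.submoduleE(4)[OF S(1) _ a, of "\<ominus> \<one>"] by simp
        then show ?thesis using a SN NM M.smult_l_minus[of \<one> a] by auto
      qed
    qed (use SN NM N.submoduleE(4,5)[OF S(1)] in auto)
  qed
  then show ?thesis using G unfolding generates_def by simp
qed

end

section \<open>Submodules of free modules of finite rank\<close>

context noetherian_cring
begin

text \<open>Induction on the basis. The \<open>s\<close>-coordinates of vectors of \<open>N\<close>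
  form an ideal, which is finitely generated; the vectors of \<open>N\<close> with
  \<open>s\<close>-coordinate zero form a submodule over the smaller basis. Generators of both parts
  together generate \<open>N\<close>.\<close>

lemma free_submodule_finitely_generated:
  fixes X :: "'x set"
  assumes "finite X" "submodule N R (free X)"
  shows "\<exists>G. finite G \<and> G \<subseteq> N \<and> (\<forall>S. submodule S R (free X) \<longrightarrow> G \<subseteq> S \<longrightarrow> N \<subseteq> S)"
  using assms
proof (induction X arbitrary: N)
  case empty
  interpret F: module R "free {}" by (rule free_module)
  have "N \<subseteq> S" if S: "submodule S R (free {})" for S
  proof
    fix v assume "v \<in> N"
    then have "v \<in> carrier (free {})" using F.submoduleE(1)[OF empty] by blast
    then have "v = \<zero>\<^bsub>free {}\<^esub>" by (intro free_eqI) auto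
    then show "v \<in> S" using subgroup.one_closed[OF submodule.axioms(1)[OF S]] by simp
  qed
  then show ?case by blast
next
  case (insert s X)
  interpret F: module R "free Y" for Y by (rule free_module)
  have fin: "finite (insert s X)" using insert.hyps by simp
  note N = F.submoduleE[OF insert.prems]
  have N0: "\<zero>\<^bsub>free (insert s X)\<^esub> \<in> N" using subgroup.one_closed[OF submodule.axioms(1)[OF insert.prems]] by simp
  define ext where "ext = (\<lambda>v\<in>carrier (free X). \<lambda>x\<in>insert s X. if x = s then \<zero> else v x)"
  have ext: "ext v x = (if x = s then \<zero> else v x)" if "v \<in> carrier (free X)" "x \<in> insert s X" for v x
    using that by (simp add: ext_def)
  have extc: "ext v \<in> carrier (free (insert s X))" if v: "v \<in> carrier (free X)" for v
    unfolding free_carrier_finite[OF fin] using free_coord[OF v] v by (auto simp: ext_def)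
  have extH: "ext \<in> Homs R (free X) (free (insert s X))"
    unfolding ext_def
  proof (rule Homs_restrictI[OF free_module])
    show "(\<lambda>x\<in>insert s X. if x = s then \<zero> else v x) \<in> carrier (free (insert s X))" if "v \<in> carrier (free X)" for v
      using extc[OF that] that by (simp add: ext_def)
  next
    fix v w assume "v \<in> carrier (free X)" "w \<in> carrier (free X)"
    then show "(\<lambda>x\<in>insert s X. if x = s then \<zero> else (v \<oplus>\<^bsub>free X\<^esub> w) x)
        = (\<lambda>x\<in>insert s X. if x = s then \<zero> else v x) \<oplus>\<^bsub>free (insert s X)\<^esub> (\<lambda>x\<in>insert s X. if x = s then \<zero> else w x)"
      by (auto simp: free_module_def fun_eq_iff)
  next
    fix a v assume "a \<in> carrier R" "v \<in> carrier (free X)"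
    then show "(\<lambda>x\<in>insert s X. if x = s then \<zero> else (a \<odot>\<^bsub>free X\<^esub> v) x)
        = a \<odot>\<^bsub>free (insert s X)\<^esub> (\<lambda>x\<in>insert s X. if x = s then \<zero> else v x)"
      by (auto simp: free_module_def fun_eq_iff)
  qed
  define N' where "N' = {v \<in> carrier (free X). ext v \<in> N}"
  have sub': "submodule N' R (free X)"
    unfolding N'_def by (rule Homs_vimage_submodule[OF free_module free_module extH insert.prems])
  obtain G' where G: "finite G' \<and> G' \<subseteq> N' \<and> (\<forall>S. submodule S R (free X) \<longrightarrow> G' \<subseteq> S \<longrightarrow> N' \<subseteq> S)"
    using insert.IH[OF sub'] by (rule exE)
  then have G': "finite G'" "G' \<subseteq> N'" and Ggen: "\<And>S. submodule S R (free X) \<Longrightarrow> G' \<subseteq> S \<Longrightarrow> N' \<subseteq> S" by simp_all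
  have lead_ideal: "ideal ((\<lambda>v. v s) ` S) R" if S: "submodule S R (free (insert s X))" for S
  proof (rule idealI[OF ring_axioms])
    note SE = F.submoduleE[OF S]
    have c: "v s \<in> carrier R" if "v \<in> S" for v using that SE(1) free_coord[of v "insert s X" s] by auto
    show "subgroup ((\<lambda>v. v s) ` S) (add_monoid R)"
    proof (rule add.subgroupI)
      show "\<ominus> a \<in> (\<lambda>v. v s) ` S" if a: "a \<in> (\<lambda>v. v s) ` S" for a
      proof -
        obtain v where v: "v \<in> S" "a = v s" using a by blast
        then have "\<ominus> a = (\<ominus>\<^bsub>free (insert s X)\<^esub> v) s" using SE(1) free_inv[of v "insert s X" s] by auto
        then show ?thesis using SE(3) v by blast
      qed
      show "a \<oplus> b \<in> (\<lambda>v. v s) ` S" if ab: "a \<in> (\<lambda>v. v s) ` S" "b \<in> (\<lambda>v. v s) ` S" for a b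
      proof -
        obtain v w where v: "v \<in> S" "a = v s" "w \<in> S" "b = w s" using ab by blast
        then have "a \<oplus> b = (v \<oplus>\<^bsub>free (insert s X)\<^esub> w) s" by (simp add: free_add)
        then show ?thesis using SE(5) v by blast
      qed
    qed (use c SE(2) in auto)
    fix a x assume a: "a \<in> (\<lambda>v. v s) ` S" and x: "x \<in> carrier R"
    then obtain v where v: "v \<in> S" "a = v s" by blast
    then have "x \<otimes> a = (x \<odot>\<^bsub>free (insert s X)\<^esub> v) s" by (simp add: free_smult)
    then show "x \<otimes> a \<in> (\<lambda>v. v s) ` S" using SE(4) v x by blast
    then show "a \<otimes> x \<in> (\<lambda>v. v s) ` S" using x c v by (simp add: m_comm)
  qed
  obtain A where A: "A \<subseteq> carrier R" "finite A" "(\<lambda>v. v s) ` N = Idl A"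
    using finetely_gen[OF lead_ideal[OF insert.prems]] by blast
  have "\<exists>v. v \<in> N \<and> v s = a" if "a \<in> A" for a
  proof -
    have "a \<in> (\<lambda>v. v s) ` N" using genideal_self[OF A(1)] A(3) that by blast
    then show ?thesis by (rule imageE) auto
  qed
  then obtain g where g: "\<And>a. a \<in> A \<Longrightarrow> g a \<in> N" "\<And>a. a \<in> A \<Longrightarrow> g a s = a"
    using bchoice[of A "\<lambda>a v. v \<in> N \<and> v s = a"] by blast
  let ?G = "ext ` G' \<union> g ` A"
  have "N \<subseteq> S" if S: "submodule S R (free (insert s X))" "?G \<subseteq> S" for S
  proof
    note SE = F.submoduleE[OF S(1)]
    fix v assume v: "v \<in> N"
    have vc: "v \<in> carrier (free (insert s X))" using v N(1) by blast
    have S0: "\<zero>\<^bsub>free (insert s X)\<^esub> \<in> S" using subgroup.one_closed[OF submodule.axioms(1)[OF S(1)]] by simp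
    \<comment> \<open>The vector \<open>w\<close> with the same \<open>s\<close>-coordinate as
      \<open>v\<close> is taken from \<open>S\<close> and \<open>N\<close> at once, so that the
      difference still lies in \<open>N\<close>, where the induction hypothesis applies to
      it.\<close>
    have T: "submodule (S \<inter> N) R (free (insert s X))"
      by (rule F.submoduleI) (use SE N S0 N0 in auto)
    have lead: "Idl A \<subseteq> (\<lambda>v. v s) ` (S \<inter> N)"
    proof (rule genideal_minimal[OF lead_ideal[OF T]], rule subsetI)
      fix a assume "a \<in> A"
      then have "g a \<in> S \<inter> N" "a = g a s" using g S(2) by auto
      then show "a \<in> (\<lambda>v. v s) ` (S \<inter> N)" using image_eqI[of a "\<lambda>v. v s" "g a" "S \<inter> N"] by simp
    qed
    have "v s \<in> Idl A" unfolding A(3)[symmetric] by (rule imageI[OF v])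
    then have "v s \<in> (\<lambda>v. v s) ` (S \<inter> N)" by (rule subsetD[OF lead])
    then obtain w where "v s = w s" "w \<in> S \<inter> N" by (rule imageE)
    then have w: "w \<in> S" "w \<in> N" "w s = v s" by simp_all
    have wc: "w \<in> carrier (free (insert s X))" using w N(1) by blast
    let ?u = "v \<ominus>\<^bsub>free (insert s X)\<^esub> w"
    have uc: "?u \<in> carrier (free (insert s X))" using vc wc by simp
    have uN: "?u \<in> N" using N(3,5) v w by (simp add: a_minus_def)
    let ?r = "restrict ?u X"
    have rc: "?r \<in> carrier (free X)"
      unfolding free_carrier_finite[OF insert.hyps(1)] using free_coord[OF uc] by auto
    have us: "?u s = \<zero>" using free_minus[OF vc wc, of s] w(3) free_coord[OF vc, of s] by (simp add: a_minus_def r_neg)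
    have "ext ?r = ?u"
      by (rule free_eqI[OF extc[OF rc] uc]) (use ext[OF rc] us in auto)
    then have "?r \<in> N'" unfolding N'_def using rc uN by simp
    moreover have "N' \<subseteq> {v \<in> carrier (free X). ext v \<in> S}"
      by (rule Ggen[OF Homs_vimage_submodule[OF free_module free_module extH S(1)]])
        (use G'(2) S(2) in \<open>auto simp: N'_def\<close>)
    ultimately have "?u \<in> S" using \<open>ext ?r = ?u\<close> by auto
    moreover have "v = ?u \<oplus>\<^bsub>free (insert s X)\<^esub> w"
      using module_minus_eq_iff[OF free_module vc wc uc] by simp
    ultimately show "v \<in> S" using SE(5) w(1) by metis
  qed
  moreover have "finite ?G" using G' A by simp
  moreover have "?G \<subseteq> N" using G'(2) g unfolding N'_def by auto
  ultimately show ?case by blast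
qed

end

section \<open>Minimal covers by free modules\<close>

context noetherian_local_ring
begin

lemma minimal_cover:
  assumes M: "module R M" and G: "generates R M G"
  obtains n :: nat and \<phi> where "min_gens R M = enat n" "\<phi> \<in> Homs R (free {..<n}) M" "\<phi> ` carrier (free {..<n}) = carrier M"
    "\<And>v j. v \<in> carrier (free {..<n}) \<Longrightarrow> \<phi> v = \<zero>\<^bsub>M\<^esub> \<Longrightarrow> j < n \<Longrightarrow> v j \<in> \<mm>"
proof -
  interpret M: module R M by fact
  interpret F: module R "free X" for X :: "nat set" by (rule free_module)
  obtain H where H: "generates R M H" "min_gens R M = enat (card H)" "\<And>H'. generates R M H' \<Longrightarrow> card H \<le> card H'"
    using min_gens_attained[OF M G] by blast
  let ?n = "card H"
  have Hf: "finite H" "H \<subseteq> carrier M" using H(1) unfolding generates_def by auto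
  obtain g where g: "bij_betw g {..<?n} H" using ex_bij_betw_nat_finite[OF Hf(1)] by (auto simp: atLeast0LessThan)
  obtain \<phi> where \<phi>: "\<phi> \<in> Homs R (free {..<?n}) M" "\<And>i. i \<in> {..<?n} \<Longrightarrow> \<phi> (unit_vec R {..<?n} i) = g i"
    using Homs_free_exists[OF M, of g "{..<?n}"] g Hf(2) bij_betwE by blast
  have "H \<subseteq> \<phi> ` carrier (free {..<?n})"
  proof
    fix x assume "x \<in> H"
    then obtain i where "i \<in> {..<?n}" "x = g i" using g by (metis bij_betw_imp_surj_on imageE)
    then show "x \<in> \<phi> ` carrier (free {..<?n})" using \<phi>(2) unit_vec_closed by (metis image_eqI)
  qed
  then have surj: "\<phi> ` carrier (free {..<?n}) = carrier M"
    using H(1) Homs_image_submodule[OF free_module M \<phi>(1)] Homs_closed[OF \<phi>(1)] unfolding generates_def by blast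
  show ?thesis
  proof (rule that[OF H(2) \<phi>(1) surj], rule ccontr)
    fix v j assume v: "v \<in> carrier (free {..<?n})" "\<phi> v = \<zero>\<^bsub>M\<^esub>" and j: "j < ?n" and vj: "v j \<notin> \<mm>"
    have vjc: "v j \<in> carrier R" using free_coord[OF v(1)] j by simp
    have unit: "v j \<in> Units R" using unit_iff vjc vj by blast
    let ?X = "{..<?n}"
    let ?w = "v \<ominus>\<^bsub>free ?X\<^esub> (v j \<odot>\<^bsub>free ?X\<^esub> unit_vec R ?X j)"
    have uc: "v j \<odot>\<^bsub>free ?X\<^esub> unit_vec R ?X j \<in> carrier (free ?X)" using vjc by (simp add: unit_vec_closed)
    have wc: "?w \<in> carrier (free ?X)" using v(1) uc by simp
    have gj: "g j \<in> H" "g j \<in> carrier M" using g j Hf(2) bij_betwE by fastforce+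
    have wj: "?w j = \<zero>"
      using free_minus[OF v(1) uc, of j] j vjc by (simp add: free_smult unit_vec_def a_minus_def r_neg)
    have \<phi>w: "\<phi> ?w = \<ominus>\<^bsub>M\<^esub> (v j \<odot>\<^bsub>M\<^esub> g j)"
      using Homs_minus[OF free_module M \<phi>(1) v(1) uc] Homs_smult[OF \<phi>(1) vjc unit_vec_closed] \<phi>(2)[of j] j v(2) vjc gj
      by (simp add: a_minus_def)
    have "carrier M \<subseteq> S" if S: "submodule S R M" "H - {g j} \<subseteq> S" for S
    proof -
      have "\<phi> ?w \<in> S"
      proof (rule Homs_free_in_submodule[OF M \<phi>(1) wc S(1)])
        fix x assume x: "x \<in> ?X" "?w x \<noteq> \<zero>"
        then have "x \<noteq> j" using wj by blast
        then have "g x \<in> H - {g j}" using g x(1) j unfolding bij_betw_def inj_on_def by auto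
        then show "\<phi> (unit_vec R ?X x) \<in> S" using \<phi>(2)[OF x(1)] S(2) by auto
      qed
      then have "\<ominus>\<^bsub>M\<^esub> (\<phi> ?w) \<in> S" using M.submoduleE(3)[OF S(1)] by blast
      then have "inv v j \<odot>\<^bsub>M\<^esub> (v j \<odot>\<^bsub>M\<^esub> g j) \<in> S"
        using \<phi>w vjc gj M.submoduleE(4)[OF S(1)] unit by simp
      then have "g j \<in> S" using unit vjc gj by (simp add: M.smult_assoc1[symmetric])
      then have "H \<subseteq> S" using S(2) by blast
      then show ?thesis using H(1) S(1) unfolding generates_def by blast
    qed
    then have "generates R M (H - {g j})" using Hf unfolding generates_def by auto
    then have "card H \<le> card (H - {g j})" using H(3) by blast
    then show False using gj Hf(1) by (metis card_Diff1_less linorder_not_less)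
  qed
qed

text \<open>One step of the construction of the minimal resolution. The last property makes the
  entries of the following differential lie in \<open>\<mm>\<close>, because its image is the kernel
  of \<open>\<phi>\<close>.\<close>

lemma kernel_cover:
  fixes a b :: nat
  assumes D: "D \<in> Homs R (free {..<a}) (free {..<b})"
  obtains n :: nat and \<phi> where "\<phi> \<in> Homs R (free {..<n}) (free {..<a})"
    "\<phi> ` carrier (free {..<n}) = {v \<in> carrier (free {..<a}). D v = \<zero>\<^bsub>free {..<b}\<^esub>}"
    "\<And>v j. v \<in> carrier (free {..<n}) \<Longrightarrow> \<phi> v = \<zero>\<^bsub>free {..<a}\<^esub> \<Longrightarrow> j < n \<Longrightarrow> v j \<in> \<mm>"
proof -
  interpret F: module R "free X" for X :: "nat set" by (rule free_module)
  let ?N = "{v \<in> carrier (free {..<a}). D v = \<zero>\<^bsub>free {..<b}\<^esub>}"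
  have N: "submodule ?N R (free {..<a})" by (rule Homs_kernel_submodule[OF free_module free_module D])
  let ?M = "(free {..<a})\<lparr>carrier := ?N\<rparr>"
  obtain G where G: "finite G \<and> G \<subseteq> ?N \<and> (\<forall>S. submodule S R (free {..<a}) \<longrightarrow> G \<subseteq> S \<longrightarrow> ?N \<subseteq> S)"
    by (rule exE[OF free_submodule_finitely_generated[OF _ N]]) simp_all
  have gen: "generates R ?M G"
    by (rule generates_submodule[OF free_module N G[THEN conjunct1] G[THEN conjunct2, THEN conjunct1]])
      (rule G[THEN conjunct2, THEN conjunct2, rule_format])
  show ?thesis
  proof (rule minimal_cover[OF submodule.submodule_is_module[OF N free_module] gen])
    fix n :: nat and \<phi>
    assume \<phi>: "\<phi> \<in> Homs R (free {..<n}) ?M" "\<phi> ` carrier (free {..<n}) = carrier ?M"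
      "\<And>v j. v \<in> carrier (free {..<n}) \<Longrightarrow> \<phi> v = \<zero>\<^bsub>?M\<^esub> \<Longrightarrow> j < n \<Longrightarrow> v j \<in> \<mm>"
    have "\<phi> \<in> Homs R (free {..<n}) (free {..<a})" using \<phi>(1) unfolding Homs_iff by (auto simp: PiE_iff)
    then show ?thesis using that[of \<phi> n] \<phi>(2,3) by simp
  qed
qed

end

context cring
begin

lemma ring_module: "module R (ring_module R)"
  by (rule moduleI[OF is_cring])
    (auto simp: ring_module_def l_distr r_distr m_assoc a_ac l_neg r_neg intro!: abelian_groupI bexI[of _ "\<ominus> x" for x])

lemma ring_module_simps:
  "carrier (ring_module R) = carrier R" "\<zero>\<^bsub>ring_module R\<^esub> = \<zero>" "x \<oplus>\<^bsub>ring_module R\<^esub> y = x \<oplus> y" "x \<odot>\<^bsub>ring_module R\<^esub> y = x \<otimes> y"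
  by (simp_all add: ring_module_def)

lemma ideal_module_simps:
  "carrier (ideal_module R I) = I" "\<zero>\<^bsub>ideal_module R I\<^esub> = \<zero>" "x \<oplus>\<^bsub>ideal_module R I\<^esub> y = x \<oplus> y" "x \<odot>\<^bsub>ideal_module R I\<^esub> y = x \<otimes> y"
  by (simp_all add: ideal_module_def ring_module_def)

lemma ideal_submodule:
  assumes "ideal I R" shows "submodule I R (ring_module R)"
proof -
  interpret M: module R "ring_module R" by (rule ring_module)
  interpret I: ideal I R by fact
  have inv: "\<ominus>\<^bsub>ring_module R\<^esub> a = \<ominus> a" if "a \<in> carrier R" for a
    using M.smult_l_minus[of \<one> a] that by (simp add: ring_module_simps l_minus)
  show ?thesis
    by (rule M.submoduleI) (use I.a_subset I.I_l_closed inv in \<open>auto simp: ring_module_simps\<close>)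
qed

lemma submodule_ideal:
  assumes "submodule I R (ring_module R)" shows "ideal I R"
proof -
  interpret M: module R "ring_module R" by (rule ring_module)
  note E = M.submoduleE[OF assms]
  have sub: "I \<subseteq> carrier R" using E(1) by (simp add: ring_module_simps)
  have smult: "x \<otimes> a \<in> I" if "a \<in> I" "x \<in> carrier R" for a x using E(4)[of x a] that by (simp add: ring_module_simps)
  show ?thesis
  proof (rule idealI[OF ring_axioms])
    show "subgroup I (add_monoid R)"
    proof (rule add.subgroupI[OF sub E(2)])
      show "\<ominus> a \<in> I" if "a \<in> I" for a using smult[OF that, of "\<ominus> \<one>"] that sub by (auto simp: l_minus)
      show "a \<oplus> b \<in> I" if "a \<in> I" "b \<in> I" for a b using E(5)[OF that] by (simp add: ring_module_simps)
    qed
    show "x \<otimes> a \<in> I" "a \<otimes> x \<in> I" if "a \<in> I" "x \<in> carrier R" for a x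
      using smult[OF that] that sub m_comm[of a x] by auto
  qed
qed

lemma ideal_module: "ideal I R \<Longrightarrow> module R (ideal_module R I)"
  unfolding ideal_module_def by (rule submodule.submodule_is_module[OF ideal_submodule ring_module])

end

section \<open>The minimal resolution of an ideal and its boundedness\<close>

context noetherian_local_ring
begin

lemma minimal_resolution_exists:
  assumes I: "ideal I R" "I \<subseteq> \<mm>"
  obtains r :: "nat \<Rightarrow> nat" and D where "free_resolution R \<mm> (\<lambda>n. {..<r n}) D I" "min_gens R (ideal_module R I) = enat (r 1)"
proof -
  interpret F: module R "free X" for X :: "nat set" by (rule free_module)
  obtain A where A: "A \<subseteq> carrier R" "finite A" "I = Idl A" using finetely_gen[OF I(1)] by blast
  have "generates R (ideal_module R I) A"
    unfolding ideal_module_def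
    by (rule generates_submodule[OF ring_module ideal_submodule[OF I(1)] A(2)])
      (use A genideal_self genideal_minimal submodule_ideal in auto)
  then obtain n :: nat and \<phi> where \<phi>: "min_gens R (ideal_module R I) = enat n" "\<phi> \<in> Homs R (free {..<n}) (ideal_module R I)"
    "\<phi> ` carrier (free {..<n}) = I"
    "\<And>v j. v \<in> carrier (free {..<n}) \<Longrightarrow> \<phi> v = \<zero> \<Longrightarrow> j < n \<Longrightarrow> v j \<in> \<mm>"
    using minimal_cover[OF ideal_module[OF I(1)]] unfolding ideal_module_simps by blast
  have \<phi>c: "\<phi> v \<in> I" "\<phi> v \<in> carrier R" if "v \<in> carrier (free {..<n})" for v
    using Homs_closed[OF \<phi>(2) that] ideal.Icarr[OF I(1)] by (auto simp: ideal_module_simps)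
  define D0 where "D0 = (\<lambda>v\<in>carrier (free {..<n}). \<lambda>k\<in>{..<1::nat}. \<phi> v)"
  have D0: "D0 v k = \<phi> v" if "v \<in> carrier (free {..<n})" "k < 1" for v k using that by (simp add: D0_def)
  have D0H: "D0 \<in> Homs R (free {..<n}) (free {..<1})"
    unfolding D0_def
    by (rule Homs_restrictI[OF free_module], unfold free_carrier_finite[OF finite_lessThan])
      (use \<phi>c Homs_add[OF \<phi>(2)] Homs_smult[OF \<phi>(2)] in \<open>auto simp: free_carrier_finite ideal_module_simps free_module_def fun_eq_iff\<close>)
  have D0z: "D0 v = \<zero>\<^bsub>free {..<1}\<^esub> \<longleftrightarrow> \<phi> v = \<zero>" if "v \<in> carrier (free {..<n})" for v
  proof
    assume "D0 v = \<zero>\<^bsub>free {..<1}\<^esub>"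
    then show "\<phi> v = \<zero>" using D0[OF that, of 0] by (simp add: free_zero)
  next
    assume "\<phi> v = \<zero>"
    then show "D0 v = \<zero>\<^bsub>free {..<1}\<^esub>"
      by (intro free_eqI[OF Homs_closed[OF D0H that] F.zero_closed]) (simp add: D0[OF that] free_zero)
  qed
  \<comment> \<open>A state \<open>(a, b, D)\<close> stores the ranks of source and target along
    with the map, since the ranks are chosen in the same recursion.\<close>
  let ?A = "\<lambda>(a, b, D). D \<in> Homs R (free {..<a}) (free {..<b}) \<and>
      (\<forall>v\<in>carrier (free {..<a}). D v = \<zero>\<^bsub>free {..<b}\<^esub> \<longrightarrow> (\<forall>j<a. v j \<in> \<mm>))"
  let ?B = "\<lambda>(a, b, D) (a', b', D'). b' = a \<and> D' ` carrier (free {..<a'}) = {v \<in> carrier (free {..<a}). D v = \<zero>\<^bsub>free {..<b}\<^esub>}"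
  define A' where "A' k s \<longleftrightarrow> ?A s \<and> (k = 0 \<longrightarrow> s = (n, 1, D0))" for k :: nat and s
  have "\<exists>f. \<forall>k. A' k (f k) \<and> ?B (f k) (f (Suc k))"
  proof (rule dependent_nat_choice)
    show "\<exists>s. A' 0 s" unfolding A'_def using D0H D0z \<phi>(4) by (intro exI[of _ "(n, 1, D0)"]) auto
    fix s and k :: nat assume s: "A' k s"
    obtain a b D where abD: "s = (a, b, D)" by (cases s)
    then have D: "D \<in> Homs R (free {..<a}) (free {..<b})" using s unfolding A'_def by auto
    show "\<exists>t. A' (Suc k) t \<and> ?B s t"
    proof (rule kernel_cover[OF D])
      fix a' :: nat and D'
      assume D': "D' \<in> Homs R (free {..<a'}) (free {..<a})"
        "D' ` carrier (free {..<a'}) = {v \<in> carrier (free {..<a}). D v = \<zero>\<^bsub>free {..<b}\<^esub>}"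
        "\<And>v j. v \<in> carrier (free {..<a'}) \<Longrightarrow> D' v = \<zero>\<^bsub>free {..<a}\<^esub> \<Longrightarrow> j < a' \<Longrightarrow> v j \<in> \<mm>"
      have "A' (Suc k) (a', a, D')" unfolding A'_def prod.case using D'(1,3) by blast
      moreover have "?B s (a', a, D')" unfolding abD prod.case using D'(2) by blast
      ultimately show ?thesis by (intro exI conjI)
    qed
  qed
  then obtain f where ff: "\<forall>k. A' k (f k) \<and> ?B (f k) (f (Suc k))" by (rule exE)
  have f: "A' k (f k)" "?B (f k) (f (Suc k))" for k
    using ff[rule_format, THEN conjunct1] ff[rule_format, THEN conjunct2] .
  \<comment> \<open>The indices shift by one: map \<open>i\<close> of the recursion runs from rank
    \<open>r (Suc i)\<close> to rank \<open>r i\<close>, and \<open>r 0 = 1\<close> stands for the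
    ring itself.\<close>
  define r where "r k = (case k of 0 \<Rightarrow> 1 | Suc i \<Rightarrow> fst (f i))" for k
  define D where "D k = snd (snd (f k))" for k
  have f0: "f 0 = (n, 1, D0)" using f(1)[of 0] unfolding A'_def by simp
  have fk: "f k = (r (Suc k), r k, D k)" for k
  proof (cases k)
    case 0 then show ?thesis using f0 by (simp add: r_def D_def)
  next
    case (Suc i)
    have "fst (snd (f (Suc i))) = fst (f i)" using f(2)[of i] by (auto simp: case_prod_beta)
    then show ?thesis unfolding Suc by (simp add: r_def D_def prod_eq_iff)
  qed
  have DH: "D k \<in> Homs R (free {..<r (Suc k)}) (free {..<r k})"
    and Dm: "\<And>v j. v \<in> carrier (free {..<r (Suc k)}) \<Longrightarrow> D k v = \<zero>\<^bsub>free {..<r k}\<^esub> \<Longrightarrow> j < r (Suc k) \<Longrightarrow> v j \<in> \<mm>" for k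
    using f(1)[of k] unfolding A'_def fk by auto
  have Dex: "D (Suc k) ` carrier (free {..<r (Suc (Suc k))}) = {v \<in> carrier (free {..<r (Suc k)}). D k v = \<zero>\<^bsub>free {..<r k}\<^esub>}" for k
    using f(2)[of k] unfolding fk by auto
  have r: "r 0 = 1" "r 1 = n" "D 0 = D0" using f0 fk[of 0] by auto
  have img: "(\<lambda>v. D 0 v 0) ` carrier (free {..<r 1}) = I"
    unfolding r using D0 \<phi>(3) by (metis (no_types, lifting) image_cong less_one)
  have "free_resolution R \<mm> (\<lambda>k. {..<r k}) D I"
    unfolding free_resolution_def
  proof (intro conjI allI ballI)
    fix k v j assume v: "v \<in> carrier (free {..<r (Suc k)})" and j: "j \<in> {..<r k}"
    show "D k v j \<in> \<mm>"
    proof (cases k)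
      case 0
      then show ?thesis using r D0 \<phi>c(1) I(2) v j by (metis One_nat_def lessThan_iff subsetD)
    next
      case (Suc i)
      have "D k v \<in> {v \<in> carrier (free {..<r (Suc i)}). D i v = \<zero>\<^bsub>free {..<r i}\<^esub>}"
        using Dex[of i] v unfolding Suc by blast
      then show ?thesis using Dm[of "D (Suc i) v" i j] j Suc by simp
    qed
  qed (use DH Dex img r in auto)
  then show ?thesis using that \<phi>(1) r by simp
qed

text \<open>Where the bounded resolution vanishes, the identity of the minimal one is homotopic to \<open>0\<close>; by
  minimality its entries are then in \<open>\<mm>\<close>.\<close>

lemma free_resolution_bounded:
  fixes M :: "('a, 'm) module"
  assumes F: "projective_resolution R (\<lambda>n. free (X n)) D \<epsilon> M" and X: "\<And>n. finite (X n :: nat set)"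
    and minimal: "\<And>n v k. v \<in> carrier (free (X (Suc n))) \<Longrightarrow> k \<in> X n \<Longrightarrow> D n v k \<in> \<mm>"
    and fin: "finite_projective_dimension TYPE('q) R M"
  shows "\<exists>N. \<forall>n>N. X n = {}"
proof -
  obtain P :: "nat \<Rightarrow> ('a, 'q) module" and d \<eta> N where P: "projective_resolution R P d \<eta> M"
    "\<And>k. k > N \<Longrightarrow> carrier (P k) = {\<zero>\<^bsub>P k\<^esub>}"
    using fin unfolding finite_projective_dimension_def by blast
  note FD = projective_resolutionD[OF F] and PD = projective_resolutionD[OF P(1)]
  obtain f g h where "chain_map R (\<lambda>n. free (X n)) D P d f" "chain_map R P d (\<lambda>n. free (X n)) D g"
    "homotopic_to_id R (\<lambda>n. free (X n)) D (\<lambda>n x. g n (f n x)) h"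
    using resolutions_homotopy_equivalent[OF F P(1)] by blast
  note f = chain_mapD[OF this(1)] and g = chain_mapD[OF this(2)] and h = homotopic_to_idD[OF this(3)]
  have "X n = {}" if n: "n > Suc N" for n
  proof (rule ccontr)
    assume "X n \<noteq> {}"
    then obtain k where k: "k \<in> X n" by blast
    obtain m where m: "n = Suc m" using n by (cases n) auto
    let ?e = "unit_vec R (X n) k"
    have e: "?e \<in> carrier (free (X (Suc m)))" using m by (simp add: unit_vec_closed)
    have "f n ?e = \<zero>\<^bsub>P n\<^esub>" using Homs_closed[OF f(1) e] P(2)[of n] n m by simp
    then have "g (Suc m) (f (Suc m) ?e) = \<zero>\<^bsub>free (X (Suc m))\<^esub>"
      using Homs_zero[OF PD(2) free_module g(1)] m by simp
    then have "?e = D (Suc m) (h (Suc m) ?e) \<oplus>\<^bsub>free (X (Suc m))\<^esub> h m (D m ?e)"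
      using h(2)[OF e] e module_minus_eq_iff[OF free_module e, of "\<zero>\<^bsub>free (X (Suc m))\<^esub>" "?e"]
      by (metis abelian_group.minus_eq abelian_monoid.r_zero free_module free_zero_closed module.axioms(2) module_minus_eq_iff abelian_group.axioms(1))
    then have "?e k = D (Suc m) (h (Suc m) ?e) k \<oplus> h m (D m ?e) k"
      using k m by (metis free_add)
    moreover have "D (Suc m) (h (Suc m) ?e) k \<in> \<mm>" using minimal[OF Homs_closed[OF h(1) e]] k m by blast
    moreover have "h m (D m ?e) k \<in> \<mm>"
      by (rule Homs_free_ideal_coords[OF m_ideal h(1) Homs_closed[OF FD(5) e]]) (use minimal[OF e] k m in auto)
    ultimately have "?e k \<in> \<mm>" using additive_subgroup.a_closed[OF ideal.axioms(1)[OF m_ideal]] by simp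
    then show False using k one_notin by (simp add: unit_vec_def)
  qed
  then show ?thesis by blast
qed

text \<open>The projective dimension is finite by assumption for \<open>I\<close> as a module. So
  degree zero is dropped from the resolution of \<open>R/I\<close>, and the first differential
  becomes the augmentation onto \<open>I\<close>.\<close>

lemma free_resolution_truncated:
  assumes res: "free_resolution R \<mm> K D I"
  shows "projective_resolution R (\<lambda>n. free (K (Suc n))) (\<lambda>n. D (Suc n)) (\<lambda>v\<in>carrier (free (K 1)). D 0 v 0) (ideal_module R I)"
  unfolding projective_resolution_def
proof (intro conjI allI)
  note D = free_resolutionD[OF res]
  have k0: "0 \<in> K 0" using D(1) by simp
  interpret F: module R "free X" for X :: "nat set" by (rule free_module)
  show "module R (ideal_module R I)" by (rule ideal_module[OF free_resolution_ideal[OF res]])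
  show "(\<lambda>v\<in>carrier (free (K 1)). D 0 v 0) \<in> Homs R (free (K (Suc 0))) (ideal_module R I)"
    using D(5) k0 unfolding One_nat_def
    by (intro Homs_restrictI[OF free_module])
      (auto simp: ideal_module_simps Homs_add[OF D(3)] Homs_smult[OF D(3)] free_add free_smult)
  show "(\<lambda>v\<in>carrier (free (K 1)). D 0 v 0) ` carrier (free (K (Suc 0))) = carrier (ideal_module R I)"
    using D(5) by (simp add: ideal_module_simps)
  have "D 0 v 0 = \<zero> \<longleftrightarrow> D 0 v = \<zero>\<^bsub>free (K 0)\<^esub>" if "v \<in> carrier (free (K (Suc 0)))" for v
  proof
    assume "D 0 v 0 = \<zero>"
    then show "D 0 v = \<zero>\<^bsub>free (K 0)\<^esub>"
      by (intro free_eqI[OF Homs_closed[OF D(3) that] F.zero_closed]) (simp add: D(1) free_zero)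
  qed (simp add: free_zero k0)
  then show "D (Suc 0) ` carrier (free (K (Suc 1))) =
      {x \<in> carrier (free (K (Suc 0))). (\<lambda>v\<in>carrier (free (K 1)). D 0 v 0) x = \<zero>\<^bsub>ideal_module R I\<^esub>}"
    using D(4)[of 0] by (auto simp: ideal_module_simps)
  show "D (Suc n) \<in> Homs R (free (K (Suc (Suc n)))) (free (K (Suc n)))" for n by (rule D(3))
  show "D (Suc (Suc n)) ` carrier (free (K (Suc (Suc (Suc n))))) =
      {x \<in> carrier (free (K (Suc (Suc n)))). D (Suc n) x = \<zero>\<^bsub>free (K (Suc n))\<^esub>}" for n by (rule D(4))
qed (rule free_projective)

lemma minimal_resolution_bounded:
  assumes res: "free_resolution R \<mm> K D I" and fin: "finite_projective_dimension TYPE('q) R (ideal_module R I)"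
  shows "\<exists>N. \<forall>n>N. K n = {}"
proof -
  note D = free_resolutionD[OF res]
  have "\<exists>N. \<forall>n>N. K (Suc n) = {}"
    by (rule free_resolution_bounded[where X = "\<lambda>n. K (Suc n)" and D = "\<lambda>n. D (Suc n)",
          OF free_resolution_truncated[OF res] _ _ fin]) (use D(2,6) in auto)
  then obtain N where "\<And>n. n > N \<Longrightarrow> K (Suc n) = {}" by blast
  then have "K n = {}" if "n > Suc N" for n using that by (cases n) auto
  then show ?thesis by blast
qed

end

section \<open>Passage to quotient rings, ranks and height two ideals\<close>

context cring
begin

lemma quot_coset_mem_iff:
  assumes I: "ideal I R" and J: "ideal J R" "I \<subseteq> J" and a: "a \<in> carrier R"
  shows "I +> a \<in> (+>) I ` J \<longleftrightarrow> a \<in> J"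
proof
  assume "I +> a \<in> (+>) I ` J"
  then obtain b where b: "b \<in> J" "I +> a = I +> b" by blast
  have bc: "b \<in> carrier R" using b J(1) ideal.Icarr by fast
  have "a \<ominus> b \<in> J" using quotient_eq_iff_same_a_r_cos[OF I a bc] b J(2) by blast
  then have "(a \<ominus> b) \<oplus> b \<in> J" using b additive_subgroup.a_closed[OF ideal.axioms(1)[OF J(1)]] by blast
  moreover have "(a \<ominus> b) \<oplus> b = a" using a bc by algebra
  ultimately show "a \<in> J" by simp
qed blast

lemma quot_carrierE:
  assumes "X \<in> carrier (R Quot I)"
  obtains a where "a \<in> carrier R" "X = I +> a"
  using assms unfolding FactRing_def A_RCOSETS_def' by auto

lemma quot_carrierI: "ideal I R \<Longrightarrow> a \<in> carrier R \<Longrightarrow> I +> a \<in> carrier (R Quot I)"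
  unfolding FactRing_def by (simp add: a_rcosetsI additive_subgroup.a_subset ideal.axioms(1))

lemma quot_mult: "ideal I R \<Longrightarrow> a \<in> carrier R \<Longrightarrow> b \<in> carrier R \<Longrightarrow> (I +> a) \<otimes>\<^bsub>R Quot I\<^esub> (I +> b) = I +> (a \<otimes> b)"
  using ring_hom_mult[OF ideal.rcos_ring_hom] by metis

lemma quot_prime:
  assumes I: "ideal I R" and P: "primeideal P R" "I \<subseteq> P"
  shows "primeideal ((+>) I ` P) (R Quot I)"
proof -
  have Pi: "ideal P R" using P(1) primeideal.axioms(1) by blast
  note mem = quot_coset_mem_iff[OF I Pi P(2)]
  show ?thesis
  proof (rule primeidealI[OF ring_ideal_imp_quot_ideal[OF I Pi] ideal.quotient_is_cring[OF I is_cring]])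
    have "\<one> \<notin> P" using primeideal.I_notcarr[OF P(1)] ideal.one_imp_carrier[OF Pi] by blast
    then show "carrier (R Quot I) \<noteq> (+>) I ` P" using mem quot_carrierI[OF I] one_closed by blast
    fix X Y assume XY: "X \<in> carrier (R Quot I)" "Y \<in> carrier (R Quot I)" "X \<otimes>\<^bsub>R Quot I\<^esub> Y \<in> (+>) I ` P"
    obtain a b where ab: "a \<in> carrier R" "X = I +> a" "b \<in> carrier R" "Y = I +> b" using XY(1,2) quot_carrierE by metis
    then have "a \<otimes> b \<in> P" using XY(3) mem[of "a \<otimes> b"] quot_mult[OF I ab(1,3)] by simp
    then show "X \<in> (+>) I ` P \<or> Y \<in> (+>) I ` P" using primeideal.I_prime[OF P(1) ab(1,3)] ab by blast
  qed
qed

text \<open>All primes of the chain contain \<open>I\<close>, so they are unions of cosets, and the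
  inclusions remain strict in the quotient.\<close>

lemma quot_krull_dim_ge:
  assumes I: "ideal I R" and p: "prime_chain R n p" "I \<subseteq> p 0"
  shows "enat n \<le> krull_dim (R Quot I)"
proof -
  have prime: "primeideal (p i) R" if "i \<le> n" for i using p(1) that unfolding prime_chain_def by blast
  have Ip: "I \<subseteq> p i" if "i \<le> n" for i
    using that
  proof (induction i)
    case (Suc i)
    then show ?case using p(1) unfolding prime_chain_def by (meson Suc_leD Suc_le_lessD psubsetE subset_trans)
  qed (use p in simp)
  have "prime_chain (R Quot I) n (\<lambda>i. (+>) I ` p i)"
    unfolding prime_chain_def
  proof (intro conjI allI impI)
    show "primeideal ((+>) I ` p i) (R Quot I)" if "i \<le> n" for i using quot_prime[OF I prime[OF that] Ip[OF that]] .
    fix i assume i: "i < n"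
    have sub: "p i \<subset> p (Suc i)" using p(1) i unfolding prime_chain_def by blast
    then obtain a where a: "a \<in> p (Suc i)" "a \<notin> p i" by blast
    have ac: "a \<in> carrier R" using a(1) prime[of "Suc i"] i ideal.Icarr[OF primeideal.axioms(1)] by (metis Suc_leI)
    have "I +> a \<notin> (+>) I ` p i"
      using quot_coset_mem_iff[OF I primeideal.axioms(1)[OF prime] Ip ac, of i] i a(2) by simp
    then show "(+>) I ` p i \<subset> (+>) I ` p (Suc i)" using sub a(1) by blast
  qed
  then show ?thesis unfolding krull_dim_def prime_chain_def by (intro Sup_upper) auto
qed

text \<open>Generated ideals of \<open>R Quot I\<close> are compared with ideals of \<open>R\<close>
  containing \<open>I\<close>: one inclusion uses the image of \<open>adjoins R I xs\<close>, the
  other the preimage of the generated ideal.\<close>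

lemma quot_Idl_mem_iff:
  assumes I: "ideal I R" and xs: "set xs \<subseteq> carrier R" and a: "a \<in> carrier R"
  shows "I +> a \<in> Idl\<^bsub>R Quot I\<^esub> (set (map ((+>) I) xs)) \<longleftrightarrow> a \<in> adjoins R I xs"
proof
  interpret Q: cring "R Quot I" by (rule ideal.quotient_is_cring[OF I is_cring])
  let ?J = "adjoins R I xs" and ?S = "set (map ((+>) I) xs)"
  have J: "ideal ?J R" "I \<subseteq> ?J" "set xs \<subseteq> ?J"
    using adjoins_ideal[OF I xs] adjoins_superset[OF I xs] adjoins_mem[OF I xs] by auto
  have S: "?S \<subseteq> carrier (R Quot I)" using quot_carrierI[OF I] xs by auto
  show "a \<in> ?J" if "I +> a \<in> Idl\<^bsub>R Quot I\<^esub> ?S"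
  proof -
    have "Idl\<^bsub>R Quot I\<^esub> ?S \<subseteq> (+>) I ` ?J"
      by (rule Q.genideal_minimal[OF ring_ideal_imp_quot_ideal[OF I J(1)]]) (use J(3) in auto)
    then show ?thesis using that quot_coset_mem_iff[OF I J(1,2) a] by blast
  qed
  show "I +> a \<in> Idl\<^bsub>R Quot I\<^esub> ?S" if aJ: "a \<in> ?J"
  proof -
    have G: "ideal (Idl\<^bsub>R Quot I\<^esub> ?S) (R Quot I)" by (rule Q.genideal_ideal[OF S])
    have V: "ideal {r \<in> carrier R. I +> r \<in> Idl\<^bsub>R Quot I\<^esub> ?S} R"
      by (rule ring_hom_ring.ideal_vimage[OF ideal.rcos_ring_hom_ring[OF I] G])
    have "I +> i \<in> Idl\<^bsub>R Quot I\<^esub> ?S" if "i \<in> I" for i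
    proof -
      have "I +> i = \<zero>\<^bsub>R Quot I\<^esub>"
        using abelian_subgroup.a_rcos_const[OF abelian_subgroupI3[OF ideal.axioms(1)[OF I] abelian_group_axioms] that]
        by (simp add: FactRing_def)
      then show ?thesis using additive_subgroup.zero_closed[OF ideal.axioms(1)[OF G]] by simp
    qed
    then have "I \<subseteq> {r \<in> carrier R. I +> r \<in> Idl\<^bsub>R Quot I\<^esub> ?S}" using ideal.Icarr[OF I] by blast
    moreover have "set xs \<subseteq> {r \<in> carrier R. I +> r \<in> Idl\<^bsub>R Quot I\<^esub> ?S}"
      using xs Q.genideal_self[OF S] by auto
    ultimately show ?thesis using adjoins_least[OF V] aJ by blast
  qed
qed

text \<open>Representatives of a regular sequence of \<open>R Quot I\<close> are regular modulo
  \<open>I\<close>. The depth of the quotient ring is thereby measured inside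
  \<open>R\<close>.\<close>

lemma regular_sequence_quot_lift:
  assumes I: "ideal I R" and Xs: "regular_sequence (R Quot I) Xs"
  obtains xs where "Xs = map ((+>) I) xs" "set xs \<subseteq> carrier R" "regular_seq_mod R I xs"
proof -
  have "\<forall>X\<in>set Xs. \<exists>a. a \<in> carrier R \<and> X = I +> a"
    using Xs quot_carrierE unfolding regular_sequence_def by (metis subsetD)
  then obtain f where f: "\<And>X. X \<in> set Xs \<Longrightarrow> f X \<in> carrier R" "\<And>X. X \<in> set Xs \<Longrightarrow> X = I +> f X" by metis
  define xs where "xs = map f Xs"
  have len: "length xs = length Xs" and Xs_eq: "Xs = map ((+>) I) xs" and c: "set xs \<subseteq> carrier R"
    unfolding xs_def using f by (auto simp: map_idI o_def)
  have "regular_mod R (adjoins R I (take i xs)) (xs ! i)" if i: "i < length xs" for i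
    unfolding regular_mod_def
  proof (intro ballI impI)
    fix a assume a: "a \<in> carrier R" and xa: "xs ! i \<otimes> a \<in> adjoins R I (take i xs)"
    have xi: "xs ! i \<in> carrier R" using c i by auto
    have tc: "set (take i xs) \<subseteq> carrier R" using c set_take_subset by fast
    have tk: "take i Xs = map ((+>) I) (take i xs)" unfolding Xs_eq by (rule take_map)
    have "I +> (xs ! i \<otimes> a) \<in> Idl\<^bsub>R Quot I\<^esub> (set (take i Xs))"
      unfolding tk using quot_Idl_mem_iff[OF I tc] xa xi a by blast
    moreover have "I +> (xs ! i \<otimes> a) = Xs ! i \<otimes>\<^bsub>R Quot I\<^esub> (I +> a)"
      using quot_mult[OF I xi a] i Xs_eq by (metis nth_map)
    ultimately have "I +> a \<in> Idl\<^bsub>R Quot I\<^esub> (set (take i Xs))"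
      using Xs quot_carrierI[OF I a] i len unfolding regular_sequence_def by simp
    then show "a \<in> adjoins R I (take i xs)" unfolding tk using quot_Idl_mem_iff[OF I tc a] by blast
  qed
  then show ?thesis using that[OF Xs_eq c] regular_seq_mod_iff_nth by blast
qed

lemma regular_sequence_iff:
  assumes "set xs \<subseteq> carrier R"
  shows "regular_sequence R xs \<longleftrightarrow> regular_seq_mod R {\<zero>} xs \<and> Idl (set xs) \<noteq> carrier R"
proof -
  have "adjoins R {\<zero>} ys = Idl (set ys)" if "set ys \<subseteq> carrier R" for ys
  proof -
    have "\<zero> \<in> Idl (set ys)" using additive_subgroup.zero_closed[OF ideal.axioms(1)[OF genideal_ideal[OF that]]] .
    then have "Idl ({\<zero>} \<union> set ys) = Idl (set ys)"
      using that genideal_self[OF that] genideal_ideal[OF that] subset_Idl_subset[of "{\<zero>} \<union> set ys" "set ys"]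
        genideal_minimal[of "Idl (set ys)" "{\<zero>} \<union> set ys"] by auto
    then show ?thesis using adjoins_eq_Idl[OF zeroideal that] by simp
  qed
  moreover have "set (take i xs) \<subseteq> carrier R" for i using assms set_take_subset by fast
  ultimately show ?thesis
    using assms unfolding regular_sequence_def regular_seq_mod_iff_nth regular_mod_def by simp
qed

lemma finsum_in_ideal:
  assumes "ideal J R" "finite S" "\<And>x. x \<in> S \<Longrightarrow> f x \<in> J"
  shows "(\<Oplus>x\<in>S. f x) \<in> J"
  using assms(2,3)
proof (induction S)
  case empty
  then show ?case using additive_subgroup.zero_closed[OF ideal.axioms(1)[OF assms(1)]] by simp
next
  case (insert x S)
  then show ?case using ideal.Icarr[OF assms(1)] additive_subgroup.a_closed[OF ideal.axioms(1)[OF assms(1)]]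
    by (subst finsum_insert) auto
qed

text \<open>Gaussian elimination over the domain \<open>R/P\<close>, carried out in \<open>R\<close>.\<close>

lemma solve_mod_prime:
  assumes P: "primeideal P R" and "finite Y" "finite X" "card Y < card X"
    and "\<And>x y. x \<in> X \<Longrightarrow> y \<in> Y \<Longrightarrow> A x y \<in> carrier R"
  shows "\<exists>c. (\<forall>x\<in>X. c x \<in> carrier R) \<and> (\<exists>x\<in>X. c x \<notin> P) \<and> (\<forall>y\<in>Y. (\<Oplus>x\<in>X. c x \<otimes> A x y) \<in> P)"
  using assms(2-5)
proof (induction Y arbitrary: X A)
  case empty
  have "\<one> \<notin> P" using primeideal.I_notcarr[OF P] ideal.one_imp_carrier[OF primeideal.axioms(1)[OF P]] by blast
  moreover have "X \<noteq> {}" using empty by auto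
  ultimately show ?case by (intro exI[of _ "\<lambda>_. \<one>"]) auto
next
  case (insert y Y)
  have Pi: "ideal P R" using P primeideal.axioms(1) by blast
  have A: "A x z \<in> carrier R" if "x \<in> X" "z \<in> insert y Y" for x z using insert.prems that by blast
  have cardY: "card (insert y Y) = Suc (card Y)" using insert.hyps by simp
  show ?case
  proof (cases "\<forall>x\<in>X. A x y \<in> P")
    case True
    have "card Y < card X" using insert.prems(2) cardY by simp
    have AY: "A x z \<in> carrier R" if "x \<in> X" "z \<in> Y" for x z using A that by blast
    obtain c where "(\<forall>x\<in>X. c x \<in> carrier R) \<and> (\<exists>x\<in>X. c x \<notin> P) \<and> (\<forall>z\<in>Y. (\<Oplus>x\<in>X. c x \<otimes> A x z) \<in> P)"
      using insert.IH[OF insert.prems(1) \<open>card Y < card X\<close> AY] by (rule exE)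
    then have c: "\<forall>x\<in>X. c x \<in> carrier R" "\<exists>x\<in>X. c x \<notin> P" "\<forall>z\<in>Y. (\<Oplus>x\<in>X. c x \<otimes> A x z) \<in> P" by simp_all
    have "(\<Oplus>x\<in>X. c x \<otimes> A x y) \<in> P"
      by (rule finsum_in_ideal[OF Pi insert.prems(1)]) (use True c(1) ideal.I_l_closed[OF Pi] in blast)
    then show ?thesis using c by blast
  next
    case False
    then obtain x0 where x0: "x0 \<in> X" "A x0 y \<notin> P" by blast
    define u where "u = A x0 y"
    have uc: "u \<in> carrier R" using A x0 unfolding u_def by blast
    let ?X = "X - {x0}"
    \<comment> \<open>Elimination of the unknown at \<open>x0\<close>, with the pivot
      \<open>u\<close> multiplied through in place of a division.\<close>
    define B where "B x z = u \<otimes> A x z \<oplus> (\<ominus> A x0 z) \<otimes> A x y" for x z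
    have Bc: "B x z \<in> carrier R" if "x \<in> ?X" "z \<in> Y" for x z
      unfolding B_def using A[of x z] A[of x0 z] A[of x y] that x0 uc by simp
    have fX: "finite ?X" "card Y < card ?X" using insert.prems(1,2) cardY x0 by auto
    obtain c where "(\<forall>x\<in>?X. c x \<in> carrier R) \<and> (\<exists>x\<in>?X. c x \<notin> P) \<and> (\<forall>z\<in>Y. (\<Oplus>x\<in>?X. c x \<otimes> B x z) \<in> P)"
      using insert.IH[OF fX Bc] by (rule exE)
    then have c: "\<forall>x\<in>?X. c x \<in> carrier R" "\<exists>x\<in>?X. c x \<notin> P" "\<forall>z\<in>Y. (\<Oplus>x\<in>?X. c x \<otimes> B x z) \<in> P" by simp_all
    define S where "S z = (\<Oplus>x\<in>?X. c x \<otimes> A x z)" for z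
    have cAc: "(\<lambda>x. c x \<otimes> A x z) \<in> ?X \<rightarrow> carrier R" if "z \<in> insert y Y" for z using c(1) A that by auto
    have Sc: "S z \<in> carrier R" if "z \<in> insert y Y" for z unfolding S_def using cAc[OF that] by (rule finsum_closed)
    \<comment> \<open>The value at \<open>x0\<close> makes equation \<open>y\<close> hold exactly.
      The other values are multiplied by \<open>u\<close>, and as \<open>u\<close> is outside the
      prime \<open>P\<close>, not all of them fall into \<open>P\<close>.\<close>
    define e where "e x = (if x = x0 then \<ominus> S y else u \<otimes> c x)" for x
    have ec: "e x \<in> carrier R" if "x \<in> X" for x unfolding e_def using that Sc uc c(1) by auto
    have sum: "(\<Oplus>x\<in>X. e x \<otimes> A x z) = \<ominus> S y \<otimes> A x0 z \<oplus> u \<otimes> S z" if z: "z \<in> insert y Y" for z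
    proof -
      have "(\<Oplus>x\<in>X. e x \<otimes> A x z) = (\<Oplus>x\<in>insert x0 ?X. e x \<otimes> A x z)" using x0 by (simp add: insert_absorb)
      also have "\<dots> = e x0 \<otimes> A x0 z \<oplus> (\<Oplus>x\<in>?X. e x \<otimes> A x z)"
        by (rule finsum_insert) (use fX ec A z x0 in auto)
      also have "(\<Oplus>x\<in>?X. e x \<otimes> A x z) = (\<Oplus>x\<in>?X. u \<otimes> (c x \<otimes> A x z))"
        by (rule finsum_cong') (use c(1) A z uc in \<open>auto simp: e_def m_assoc\<close>)
      also have "\<dots> = u \<otimes> S z" unfolding S_def by (rule finsum_rdistr[OF fX(1) uc cAc[OF z], symmetric])
      finally show ?thesis by (simp add: e_def)
    qed
    have "(\<Oplus>x\<in>X. e x \<otimes> A x z) \<in> P" if z: "z \<in> insert y Y" for z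
    proof (cases "z = y")
      case True
      have "\<ominus> S y \<otimes> u \<oplus> u \<otimes> S y = \<zero>" using Sc[of y] uc by (simp add: l_minus m_comm[of u] l_neg)
      then show ?thesis
        using sum[OF z] additive_subgroup.zero_closed[OF ideal.axioms(1)[OF Pi]] True unfolding u_def by simp
    next
      case False
      then have zY: "z \<in> Y" using z by blast
      have m: "\<ominus> A x0 z \<in> carrier R" using A x0 z by simp
      have "(\<Oplus>x\<in>?X. c x \<otimes> B x z) = (\<Oplus>x\<in>?X. u \<otimes> (c x \<otimes> A x z) \<oplus> (\<ominus> A x0 z) \<otimes> (c x \<otimes> A x y))"
      proof (rule finsum_cong')
        fix x assume x: "x \<in> ?X"
        have "c x \<in> carrier R" "A x z \<in> carrier R" "A x y \<in> carrier R" using x c(1) A z by auto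
        then show "c x \<otimes> B x z = u \<otimes> (c x \<otimes> A x z) \<oplus> (\<ominus> A x0 z) \<otimes> (c x \<otimes> A x y)"
          unfolding B_def using m uc by (simp add: r_distr m_lcomm)
      qed (use c(1) A z uc m in auto)
      also have "\<dots> = (\<Oplus>x\<in>?X. u \<otimes> (c x \<otimes> A x z)) \<oplus> (\<Oplus>x\<in>?X. (\<ominus> A x0 z) \<otimes> (c x \<otimes> A x y))"
        by (rule finsum_addf) (use c(1) A z uc m in auto)
      also have "\<dots> = u \<otimes> S z \<oplus> (\<ominus> A x0 z) \<otimes> S y"
        unfolding S_def using finsum_rdistr[OF fX(1) uc cAc[OF z]] finsum_rdistr[OF fX(1) m cAc[of y]] by simp
      also have "\<dots> = \<ominus> S y \<otimes> A x0 z \<oplus> u \<otimes> S z"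
        using Sc[of y, simplified] Sc[OF z] A[OF x0(1) z] uc by algebra
      finally show ?thesis unfolding sum[OF z] using bspec[OF c(3) zY] by (rule subst)
    qed
    moreover have "\<exists>x\<in>X. e x \<notin> P"
    proof -
      obtain x where x: "x \<in> ?X" "c x \<notin> P" using c(2) by blast
      then have "u \<otimes> c x \<notin> P" using primeideal.I_prime[OF P uc, of "c x"] c(1) x0(2) unfolding u_def by blast
      then show ?thesis using x unfolding e_def by auto
    qed
    ultimately show ?thesis using ec by blast
  qed
qed

lemma Homs_free_coord:
  assumes h: "h \<in> Homs R (free X) (free Y)" and X: "finite X" and v: "v \<in> carrier (free X)" and y: "y \<in> Y"
  shows "h v y = (\<Oplus>x\<in>X. v x \<otimes> h (unit_vec R X x) y)"
proof -
  interpret F: module R "free Y" by (rule free_module)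
  have hu: "h (unit_vec R X x) \<in> carrier (free Y)" for x using Homs_closed[OF h unit_vec_closed] .
  have "(\<Oplus>\<^bsub>free Y\<^esub>x\<in>S. v x \<odot>\<^bsub>free Y\<^esub> h (unit_vec R X x)) y = (\<Oplus>x\<in>S. v x \<otimes> h (unit_vec R X x) y)"
    if "finite S" "S \<subseteq> X" for S
    using that
  proof (induction S)
    case empty
    then show ?case using y by (simp add: free_zero)
  next
    case (insert s S)
    have c: "v x \<in> carrier R" "h (unit_vec R X x) y \<in> carrier R" if "x \<in> insert s S" for x
      using that insert.prems free_coord[OF v] free_coord[OF hu y] by auto
    have "(\<Oplus>\<^bsub>free Y\<^esub>x\<in>insert s S. v x \<odot>\<^bsub>free Y\<^esub> h (unit_vec R X x)) y
        = v s \<otimes> h (unit_vec R X s) y \<oplus> (\<Oplus>\<^bsub>free Y\<^esub>x\<in>S. v x \<odot>\<^bsub>free Y\<^esub> h (unit_vec R X x)) y"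
      using insert.hyps c hu y by (subst F.finsum_insert) (auto simp: free_add free_smult)
    also have "\<dots> = (\<Oplus>x\<in>insert s S. v x \<otimes> h (unit_vec R X x) y)"
      using insert c by (subst finsum_insert) auto
    finally show ?case .
  qed
  moreover have "h v = (\<Oplus>\<^bsub>free Y\<^esub>x\<in>X. v x \<odot>\<^bsub>free Y\<^esub> h (unit_vec R X x))"
    using Homs_free_eq_lincomb[OF free_module h v] lincomb_eq[OF free_module v _ X, of "\<lambda>x. h (unit_vec R X x)" Y] hu by auto
  ultimately show ?thesis using X by simp
qed

end

section \<open>Ranks, depth, and Cohen-Macaulay ideals of height two\<close>

context noetherian_local_ring
begin

text \<open>With more unknowns than equations there is a solution \<open>c\<close>, nontrivial
  modulo an associated prime \<open>P\<close> of \<open>R\<close>. If \<open>P\<close> is the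
  annihilator of \<open>z\<close>, then \<open>z c\<close> is a nonzero vector of the
  kernel.\<close>

lemma injective_Homs_free_card_le:
  assumes h: "h \<in> Homs R (free X) (free Y)" and XY: "finite X" "finite Y"
    and inj: "\<And>v. v \<in> carrier (free X) \<Longrightarrow> h v = \<zero>\<^bsub>free Y\<^esub> \<Longrightarrow> v = \<zero>\<^bsub>free X\<^esub>"
  shows "card X \<le> card Y"
proof (rule ccontr)
  assume "\<not> ?thesis"
  then have card: "card Y < card X" by simp
  have "\<one> \<notin> {\<zero>}" using one_notin additive_subgroup.zero_closed[OF ideal.axioms(1)[OF m_ideal]] by auto
  then obtain z where z: "z \<in> carrier R" "z \<noteq> \<zero>" "primeideal (colon R {\<zero>} z) R"
    using associated_prime_exists[OF zeroideal one_closed] by blast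
  let ?A = "\<lambda>x y. h (unit_vec R X x) y"
  have Ac: "?A x y \<in> carrier R" if "y \<in> Y" for x y using free_coord[OF Homs_closed[OF h unit_vec_closed] that] .
  obtain c where "(\<forall>x\<in>X. c x \<in> carrier R) \<and> (\<exists>x\<in>X. c x \<notin> colon R {\<zero>} z) \<and>
      (\<forall>y\<in>Y. (\<Oplus>x\<in>X. c x \<otimes> ?A x y) \<in> colon R {\<zero>} z)"
    using solve_mod_prime[OF z(3) XY(2,1) card Ac] by (rule exE)
  then have c: "\<forall>x\<in>X. c x \<in> carrier R" "\<exists>x\<in>X. c x \<notin> colon R {\<zero>} z"
    "\<forall>y\<in>Y. (\<Oplus>x\<in>X. c x \<otimes> ?A x y) \<in> colon R {\<zero>} z" by simp_all
  define v where "v = (\<lambda>x\<in>X. z \<otimes> c x)"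
  have v: "v \<in> carrier (free X)" unfolding free_carrier_finite[OF XY(1)] v_def using c(1) z by auto
  have "h v y = \<zero>" if y: "y \<in> Y" for y
  proof -
    have "h v y = (\<Oplus>x\<in>X. v x \<otimes> ?A x y)" by (rule Homs_free_coord[OF h XY(1) v y])
    also have "\<dots> = (\<Oplus>x\<in>X. z \<otimes> (c x \<otimes> ?A x y))"
      by (rule finsum_cong') (use c(1) z Ac[OF y] in \<open>auto simp: v_def m_assoc\<close>)
    also have "\<dots> = z \<otimes> (\<Oplus>x\<in>X. c x \<otimes> ?A x y)"
      by (rule finsum_rdistr[OF XY(1) z(1), symmetric]) (use c(1) Ac[OF y] in auto)
    also have "\<dots> = \<zero>" using c(3) y by (simp add: colon_def)
    finally show ?thesis .
  qed
  then have "h v = \<zero>\<^bsub>free Y\<^esub>"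
    by (intro free_eqI[OF Homs_closed[OF h v] free_zero_closed]) (simp add: free_zero)
  then have "v = \<zero>\<^bsub>free X\<^esub>" by (rule inj[OF v])
  then have "z \<otimes> c x = \<zero>" if "x \<in> X" for x using that by (metis free_zero restrict_apply' v_def)
  then show False using c(1,2) by (auto simp: colon_def)
qed

text \<open>Multiplication by \<open>x\<close> on \<open>R/I\<close> is zero; hence \<open>R\<^sup>m \<oplus> R\<close> and \<open>R\<^sup>n\<close> embed into each other.\<close>

lemma resolution_rank:
  assumes res: "free_resolution R \<mm> (\<lambda>n. {..<r n}) D I" and r3: "r 3 = 0"
    and x: "x \<in> I" "regular_mod R {\<zero>} x"
  shows "r 2 + 1 = r 1"
proof -
  note D = free_resolutionD[OF res]
  interpret F: module R "free X" for X :: "nat set" by (rule free_module)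
  define m n where "m = r 2" and "n = r 1"
  have r0: "{..<r 0} = {0}" using D(1) .
  have k0: "0 \<in> {..<r 0}" using r0 by simp
  define D1 where "D1 = D 1"
  have H1: "D1 \<in> Homs R (free {..<m}) (free {..<n})" using D(3)[of 1] unfolding m_def n_def D1_def by (simp add: numeral_2_eq_2)
  have H0: "D 0 \<in> Homs R (free {..<n}) (free {..<r 0})" using D(3)[of 0] unfolding n_def by simp
  have ex1: "D1 ` carrier (free {..<m}) = {v \<in> carrier (free {..<n}). D 0 v = \<zero>\<^bsub>free {..<r 0}\<^esub>}"
    using D(4)[of 0] unfolding m_def n_def D1_def by (simp add: numeral_2_eq_2)
  have inj1: "v = \<zero>\<^bsub>free {..<m}\<^esub>" if v: "v \<in> carrier (free {..<m})" "D1 v = \<zero>\<^bsub>free {..<n}\<^esub>" for v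
  proof -
    have "v \<in> D (Suc 1) ` carrier (free {..<r 3})"
      using D(4)[of 1] v unfolding m_def n_def D1_def by (simp add: numeral_2_eq_2 numeral_3_eq_3)
    then obtain w where w: "w \<in> carrier (free {..<r 3})" "v = D 2 w" by (auto simp: numeral_2_eq_2)
    have "w = \<zero>\<^bsub>free {..<r 3}\<^esub>" by (rule free_eqI[OF w(1) F.zero_closed]) (simp add: r3)
    moreover have "D 2 \<in> Homs R (free {..<r 3}) (free {..<m})" using D(3)[of 2] unfolding m_def by (simp add: numeral_3_eq_3)
    ultimately show ?thesis using w(2) Homs_zero[OF free_module free_module] by blast
  qed
  have d0: "D 0 v = \<zero>\<^bsub>free {..<r 0}\<^esub> \<longleftrightarrow> D 0 v 0 = \<zero>" if v: "v \<in> carrier (free {..<n})" for v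
  proof
    assume "D 0 v 0 = \<zero>"
    then show "D 0 v = \<zero>\<^bsub>free {..<r 0}\<^esub>"
      by (intro free_eqI[OF Homs_closed[OF H0 v] F.zero_closed]) (use r0 in \<open>auto simp: free_zero\<close>)
  qed (simp add: free_zero[OF k0])
  have d0c: "D 0 v 0 \<in> carrier R" if v: "v \<in> carrier (free {..<n})" for v
    using free_coord[OF Homs_closed[OF H0 v] k0] .
  obtain w where w: "w \<in> carrier (free {..<n})" "D 0 w 0 = x" using x(1) D(5) unfolding n_def by blast
  have xc: "x \<in> carrier R" using w d0c by blast
  have reg: "a = \<zero>" if "a \<in> carrier R" "x \<otimes> a = \<zero>" for a using x(2) that unfolding regular_mod_def by blast
  have "Suc m \<le> n"
  proof -
    have mc: "restrict v {..<m} \<in> carrier (free {..<m})" "v m \<in> carrier R" if "v \<in> carrier (free {..<Suc m})" for v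
      using that free_coord[OF that] unfolding free_carrier_finite[OF finite_lessThan] by auto
    have radd: "restrict (v \<oplus>\<^bsub>free {..<Suc m}\<^esub> v') {..<m} = restrict v {..<m} \<oplus>\<^bsub>free {..<m}\<^esub> restrict v' {..<m}" for v v'
      by (auto simp: free_module_def fun_eq_iff)
    have rsm: "restrict (a \<odot>\<^bsub>free {..<Suc m}\<^esub> v) {..<m} = a \<odot>\<^bsub>free {..<m}\<^esub> restrict v {..<m}" for a v
      by (auto simp: free_module_def fun_eq_iff)
    \<comment> \<open>The map \<open>(v, t) \<mapsto> D1 v + t w\<close> on \<open>R^m\<close> plus
      \<open>R\<close>, where \<open>w\<close> is a preimage of \<open>x\<close>. Applying
      \<open>D 0\<close> leaves \<open>t x\<close>, so \<open>t\<close> vanishes on the kernel by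
      regularity, and \<open>D1\<close> is injective because \<open>r 3 = 0\<close>.\<close>
    define h where "h = (\<lambda>v\<in>carrier (free {..<Suc m}). D1 (restrict v {..<m}) \<oplus>\<^bsub>free {..<n}\<^esub> (v m \<odot>\<^bsub>free {..<n}\<^esub> w))"
    have hH: "h \<in> Homs R (free {..<Suc m}) (free {..<n})"
      unfolding h_def
    proof (rule Homs_restrictI[OF free_module])
      fix v assume v: "v \<in> carrier (free {..<Suc m})"
      note c = Homs_closed[OF H1 mc(1)[OF v]] mc(2)[OF v]
      show "D1 (restrict v {..<m}) \<oplus>\<^bsub>free {..<n}\<^esub> (v m \<odot>\<^bsub>free {..<n}\<^esub> w) \<in> carrier (free {..<n})" using c w by simp
      fix v' assume v': "v' \<in> carrier (free {..<Suc m})"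
      note c' = Homs_closed[OF H1 mc(1)[OF v']] mc(2)[OF v']
      show "D1 (restrict (v \<oplus>\<^bsub>free {..<Suc m}\<^esub> v') {..<m}) \<oplus>\<^bsub>free {..<n}\<^esub> ((v \<oplus>\<^bsub>free {..<Suc m}\<^esub> v') m \<odot>\<^bsub>free {..<n}\<^esub> w)
          = D1 (restrict v {..<m}) \<oplus>\<^bsub>free {..<n}\<^esub> (v m \<odot>\<^bsub>free {..<n}\<^esub> w) \<oplus>\<^bsub>free {..<n}\<^esub>
            (D1 (restrict v' {..<m}) \<oplus>\<^bsub>free {..<n}\<^esub> (v' m \<odot>\<^bsub>free {..<n}\<^esub> w))"
        using c c' w(1) by (simp add: radd Homs_add[OF H1 mc(1)[OF v] mc(1)[OF v']] free_add F.smult_l_distr F.a_ac)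
    next
      fix a v assume a: "a \<in> carrier R" and v: "v \<in> carrier (free {..<Suc m})"
      note c = Homs_closed[OF H1 mc(1)[OF v]] mc(2)[OF v]
      show "D1 (restrict (a \<odot>\<^bsub>free {..<Suc m}\<^esub> v) {..<m}) \<oplus>\<^bsub>free {..<n}\<^esub> ((a \<odot>\<^bsub>free {..<Suc m}\<^esub> v) m \<odot>\<^bsub>free {..<n}\<^esub> w)
          = a \<odot>\<^bsub>free {..<n}\<^esub> (D1 (restrict v {..<m}) \<oplus>\<^bsub>free {..<n}\<^esub> (v m \<odot>\<^bsub>free {..<n}\<^esub> w))"
        using a c w(1) by (simp add: rsm Homs_smult[OF H1 a mc(1)[OF v]] free_smult F.smult_r_distr F.smult_assoc1)
    qed
    have "card {..<Suc m} \<le> card {..<n}"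
    proof (rule injective_Homs_free_card_le[OF hH])
      fix v assume v: "v \<in> carrier (free {..<Suc m})" and hv: "h v = \<zero>\<^bsub>free {..<n}\<^esub>"
      note c = Homs_closed[OF H1 mc(1)[OF v]] mc(2)[OF v]
      have "D1 (restrict v {..<m}) \<in> {v \<in> carrier (free {..<n}). D 0 v = \<zero>\<^bsub>free {..<r 0}\<^esub>}"
        using ex1 mc(1)[OF v] by blast
      then have "D 0 (D1 (restrict v {..<m})) = \<zero>\<^bsub>free {..<r 0}\<^esub>" by blast
      then have "D 0 (h v) 0 = v m \<otimes> x"
        unfolding h_def using v c w Homs_closed[OF H0 w(1)]
        by (simp add: Homs_add[OF H0] Homs_smult[OF H0] free_smult[OF k0])
      then have "x \<otimes> v m = \<zero>"
        using hv c xc Homs_zero[OF free_module free_module H0] free_zero[OF k0] by (simp add: m_comm)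
      then have vm: "v m = \<zero>" using reg c(2) by blast
      then have "D1 (restrict v {..<m}) = \<zero>\<^bsub>free {..<n}\<^esub>" using hv v c w(1) unfolding h_def by simp
      then have "restrict v {..<m} = \<zero>\<^bsub>free {..<m}\<^esub>" by (rule inj1[OF mc(1)[OF v]])
      then have "v i = \<zero>" if "i < m" for i using that free_zero[of i "{..<m}"] by (metis lessThan_iff restrict_apply')
      then show "v = \<zero>\<^bsub>free {..<Suc m}\<^esub>"
        using vm by (intro free_eqI[OF v F.zero_closed]) (auto simp: free_zero less_Suc_eq)
    qed auto
    then show ?thesis by simp
  qed
  moreover have "n \<le> Suc m"
  proof -
    \<comment> \<open>\<open>\<alpha> v = x v - D(v) w\<close> is a cycle, since
      \<open>D 0 w\<close> has coordinate \<open>x\<close>; hence \<open>\<alpha>\<close> lifts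
      along \<open>D1\<close>. Together with \<open>w\<close>, the lift is a null homotopy of
      multiplication by \<open>x\<close>.\<close>
    define \<alpha> where "\<alpha> = (\<lambda>v\<in>carrier (free {..<n}). (x \<odot>\<^bsub>free {..<n}\<^esub> v) \<ominus>\<^bsub>free {..<n}\<^esub> (D 0 v 0 \<odot>\<^bsub>free {..<n}\<^esub> w))"
    have \<alpha>H: "\<alpha> \<in> Homs R (free {..<n}) (free {..<n})"
    proof -
      have "(\<lambda>v\<in>carrier (free {..<n}). x \<odot>\<^bsub>free {..<n}\<^esub> v) \<in> Homs R (free {..<n}) (free {..<n})"
        by (rule Homs_restrictI[OF free_module])
          (use xc in \<open>auto simp: F.smult_r_distr F.smult_assoc1[symmetric] m_comm\<close>)
      moreover have "(\<lambda>v\<in>carrier (free {..<n}). D 0 v 0 \<odot>\<^bsub>free {..<n}\<^esub> w) \<in> Homs R (free {..<n}) (free {..<n})"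
        by (rule Homs_restrictI[OF free_module])
          (use w d0c in \<open>auto simp: Homs_add[OF H0] Homs_smult[OF H0] free_add[OF k0] free_smult[OF k0] F.smult_l_distr F.smult_assoc1\<close>)
      ultimately have "(\<lambda>v\<in>carrier (free {..<n}). (\<lambda>v\<in>carrier (free {..<n}). x \<odot>\<^bsub>free {..<n}\<^esub> v) v \<ominus>\<^bsub>free {..<n}\<^esub>
          (\<lambda>v\<in>carrier (free {..<n}). D 0 v 0 \<odot>\<^bsub>free {..<n}\<^esub> w) v) \<in> Homs R (free {..<n}) (free {..<n})"
        by (rule Homs_diff[OF free_module free_module])
      moreover have "(\<lambda>v\<in>carrier (free {..<n}). (\<lambda>v\<in>carrier (free {..<n}). x \<odot>\<^bsub>free {..<n}\<^esub> v) v \<ominus>\<^bsub>free {..<n}\<^esub>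
          (\<lambda>v\<in>carrier (free {..<n}). D 0 v 0 \<odot>\<^bsub>free {..<n}\<^esub> w) v) = \<alpha>" unfolding \<alpha>_def by (rule restrict_ext) simp
      ultimately show ?thesis by simp
    qed
    have "\<alpha> ` carrier (free {..<n}) \<subseteq> D1 ` carrier (free {..<m})"
    proof (rule image_subsetI)
      fix v assume v: "v \<in> carrier (free {..<n})"
      note c = d0c[OF v] Homs_closed[OF H0 v] Homs_closed[OF H0 w(1)]
      have "D 0 (\<alpha> v) = (x \<odot>\<^bsub>free {..<r 0}\<^esub> D 0 v) \<ominus>\<^bsub>free {..<r 0}\<^esub> (D 0 v 0 \<odot>\<^bsub>free {..<r 0}\<^esub> D 0 w)"
        unfolding \<alpha>_def using v w(1) xc c by (simp add: Homs_minus[OF free_module free_module H0] Homs_smult[OF H0])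
      then have "D 0 (\<alpha> v) 0 = x \<otimes> D 0 v 0 \<ominus> D 0 v 0 \<otimes> x"
        using xc c w(2) by (simp add: free_minus[OF _ _ k0] free_smult[OF k0])
      then have "D 0 (\<alpha> v) 0 = \<zero>" using xc c by (simp add: m_comm a_minus_def r_neg)
      then show "\<alpha> v \<in> D1 ` carrier (free {..<m})" unfolding ex1 using d0 Homs_closed[OF \<alpha>H v] by blast
    qed
    then obtain \<beta> where \<beta>: "\<beta> \<in> Homs R (free {..<n}) (free {..<m})" "\<And>v. v \<in> carrier (free {..<n}) \<Longrightarrow> D1 (\<beta> v) = \<alpha> v"
      using projective_lift[OF free_projective free_module free_module \<alpha>H H1] by blast
    \<comment> \<open>If \<open>\<beta> v\<close> and \<open>D 0 v\<close> both vanish, then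
      \<open>x v = \<alpha> v + D(v) w = 0\<close>, and \<open>v = 0\<close> as \<open>x\<close> is
      regular. So \<open>v \<mapsto> (\<beta> v, D v)\<close> is injective.\<close>
    define h where "h = (\<lambda>v\<in>carrier (free {..<n}). \<lambda>i\<in>{..<Suc m}. if i < m then \<beta> v i else D 0 v 0)"
    have bc: "\<beta> v i \<in> carrier R" if "v \<in> carrier (free {..<n})" "i < m" for v i
      using free_coord[OF Homs_closed[OF \<beta>(1) that(1)], of i] that(2) by simp
    have hc: "(\<lambda>i\<in>{..<Suc m}. if i < m then \<beta> v i else D 0 v 0) \<in> carrier (free {..<Suc m})" if v: "v \<in> carrier (free {..<n})" for v
      unfolding free_carrier_finite[OF finite_lessThan] using bc[OF v] d0c[OF v] by auto
    have hH: "h \<in> Homs R (free {..<n}) (free {..<Suc m})"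
      unfolding h_def
    proof (rule Homs_restrictI[OF free_module hc])
      fix v v' assume v: "v \<in> carrier (free {..<n})" "v' \<in> carrier (free {..<n})"
      show "(\<lambda>i\<in>{..<Suc m}. if i < m then \<beta> (v \<oplus>\<^bsub>free {..<n}\<^esub> v') i else D 0 (v \<oplus>\<^bsub>free {..<n}\<^esub> v') 0) =
          (\<lambda>i\<in>{..<Suc m}. if i < m then \<beta> v i else D 0 v 0) \<oplus>\<^bsub>free {..<Suc m}\<^esub> (\<lambda>i\<in>{..<Suc m}. if i < m then \<beta> v' i else D 0 v' 0)"
        using v by (intro free_eqI[OF hc] free_closed(1)[OF hc hc, of _ _ \<zero>])
          (auto simp: free_add free_add[OF k0] Homs_add[OF \<beta>(1)] Homs_add[OF H0])
    next
      fix a v assume v: "a \<in> carrier R" "v \<in> carrier (free {..<n})"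
      show "(\<lambda>i\<in>{..<Suc m}. if i < m then \<beta> (a \<odot>\<^bsub>free {..<n}\<^esub> v) i else D 0 (a \<odot>\<^bsub>free {..<n}\<^esub> v) 0) =
          a \<odot>\<^bsub>free {..<Suc m}\<^esub> (\<lambda>i\<in>{..<Suc m}. if i < m then \<beta> v i else D 0 v 0)"
        using v by (intro free_eqI[OF hc] free_closed(2)[OF hc hc])
          (auto simp: free_smult free_smult[OF k0] Homs_smult[OF \<beta>(1)] Homs_smult[OF H0])
    qed
    have "card {..<n} \<le> card {..<Suc m}"
    proof (rule injective_Homs_free_card_le[OF hH])
      fix v assume v: "v \<in> carrier (free {..<n})" and hv: "h v = \<zero>\<^bsub>free {..<Suc m}\<^esub>"
      have hi: "(if i < m then \<beta> v i else D 0 v 0) = \<zero>" if "i < Suc m" for i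
        using that v fun_cong[OF hv, of i] free_zero[of i "{..<Suc m}"] unfolding h_def by simp
      have "\<beta> v = \<zero>\<^bsub>free {..<m}\<^esub>"
      proof (rule free_eqI[OF Homs_closed[OF \<beta>(1) v] F.zero_closed])
        fix i assume "i \<in> {..<m}"
        then show "\<beta> v i = \<zero>\<^bsub>free {..<m}\<^esub> i" using hi[of i] by (simp add: free_zero)
      qed
      then have "\<alpha> v = \<zero>\<^bsub>free {..<n}\<^esub>" using \<beta>(2)[OF v] Homs_zero[OF free_module free_module H1] by simp
      moreover have "D 0 v 0 = \<zero>" using hi[of m] by simp
      ultimately have "x \<odot>\<^bsub>free {..<n}\<^esub> v = \<zero>\<^bsub>free {..<n}\<^esub>"
        using v w(1) xc module_minus_eq_zero_iff[OF free_module, of "x \<odot>\<^bsub>free {..<n}\<^esub> v" "{..<n}" "\<zero>\<^bsub>free {..<n}\<^esub>"]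
        unfolding \<alpha>_def by simp
      then have "x \<otimes> v i = \<zero>" if "i < n" for i
        using that free_smult[of i "{..<n}" x v] free_zero[of i "{..<n}"] by simp
      then show "v = \<zero>\<^bsub>free {..<n}\<^esub>"
        using reg free_coord[OF v] by (intro free_eqI[OF v F.zero_closed]) (simp add: free_zero)
    qed auto
    then show ?thesis by simp
  qed
  ultimately show ?thesis unfolding m_def n_def by simp
qed

text \<open>An inextendable regular sequence is a longest one, so it realises the supremum. The
  ideal it generates is proper because its entries lie in \<open>\<mm>\<close>.\<close>

lemma depth_eq:
  assumes ys: "regular_seq_mod R {\<zero>} ys" "set ys \<subseteq> \<mm>" "\<And>y. y \<in> \<mm> \<Longrightarrow> \<not> regular_mod R (adjoins R {\<zero>} ys) y"
  shows "depth R \<mm> = enat (length ys)"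
proof (rule antisym)
  have c: "set xs \<subseteq> carrier R" if "set xs \<subseteq> \<mm>" for xs using that m_carrier by blast
  show "depth R \<mm> \<le> enat (length ys)"
    unfolding depth_def
  proof (rule Sup_least)
    fix e assume "e \<in> {enat (length xs) | xs. regular_sequence R xs \<and> set xs \<subseteq> \<mm>}"
    then obtain xs where xs: "e = enat (length xs)" "regular_sequence R xs" "set xs \<subseteq> \<mm>" by blast
    have "length xs \<le> length ys"
      by (rule regular_seq_length_le[OF _ xs(3) ys]) (use xs regular_sequence_iff c in blast)
    then show "e \<le> enat (length ys)" using xs(1) by simp
  qed
  have "Idl (set ys) \<subseteq> \<mm>" using genideal_minimal[OF m_ideal ys(2)] .
  then have "Idl (set ys) \<noteq> carrier R" using one_notin by blast
  then have "regular_sequence R ys" using regular_sequence_iff[OF c[OF ys(2)]] ys(1) by blast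
  then show "enat (length ys) \<le> depth R \<mm>" unfolding depth_def using ys(2) by (intro Sup_upper) blast
qed

text \<open>The supremum need not be attained, hence only a sequence of length at least
  \<open>n\<close> is claimed. Entries outside \<open>\<mm>\<close> would be units, whose cosets
  cannot lie in the proper ideal \<open>nn\<close>.\<close>

lemma quot_depth_lift:
  assumes I: "ideal I R" and nn: "maximalideal nn (R Quot I)" and n: "enat n \<le> depth (R Quot I) nn"
  obtains xs where "regular_seq_mod R I xs" "set xs \<subseteq> \<mm>" "n \<le> length xs"
proof (cases n)
  case 0
  then show ?thesis using that[of "[]"] by simp
next
  case (Suc k)
  have "enat k < depth (R Quot I) nn" using n Suc by (simp add: less_le_trans[of _ "enat (Suc k)"])
  then obtain e where "enat k < e" "e \<in> {enat (length Xs) | Xs. regular_sequence (R Quot I) Xs \<and> set Xs \<subseteq> nn}"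
    unfolding depth_def less_Sup_iff by (rule bexE)
  then obtain Xs where Xs: "k < length Xs" "regular_sequence (R Quot I) Xs" "set Xs \<subseteq> nn" by auto
  obtain xs where xs: "Xs = map ((+>) I) xs" "set xs \<subseteq> carrier R" "regular_seq_mod R I xs"
    using regular_sequence_quot_lift[OF I Xs(2)] by blast
  have nni: "ideal nn (R Quot I)" using nn maximalideal.axioms(1) by blast
  have "x \<in> \<mm>" if x: "x \<in> set xs" for x
  proof (rule ccontr)
    assume "x \<notin> \<mm>"
    then have u: "x \<in> Units R" using unit_iff x xs(2) by blast
    have "I +> x \<in> nn" using x Xs(3) xs(1) by auto
    then have "(I +> x) \<otimes>\<^bsub>R Quot I\<^esub> (I +> inv x) \<in> nn"
      using ideal.I_r_closed[OF nni] quot_carrierI[OF I] u by blast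
    then have "I +> \<one> \<in> nn" using quot_mult[OF I Units_closed[OF u] Units_inv_closed[OF u]] u by simp
    then have "\<one>\<^bsub>R Quot I\<^esub> \<in> nn" by (simp add: FactRing_def)
    then show False using ideal.one_imp_carrier[OF nni] maximalideal.I_notcarr[OF nn] by blast
  qed
  then show ?thesis using that[of xs] xs Xs(1) Suc by auto
qed

lemma cohen_macaulay_height_two:
  assumes CM: "depth R \<mm> = krull_dim R" and I: "cohen_macaulay_ideal R I" and ht: "height R I = 2"
  shows "ideal I R" "I \<subseteq> \<mm>" "\<exists>x\<in>I. regular_mod R {\<zero>} x"
    "\<And>K D p. free_resolution R \<mm> K D I \<Longrightarrow> K p \<noteq> {} \<Longrightarrow> (\<And>i. i > p \<Longrightarrow> K i = {}) \<Longrightarrow> p \<le> 2"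
proof -
  show Ii: "ideal I R" using I unfolding cohen_macaulay_ideal_def by blast
  obtain nn where nn: "cohen_macaulay_local_ring (R Quot I) nn" using I unfolding cohen_macaulay_ideal_def by blast
  let ?H = "prime_height R ` {Q. primeideal Q R \<and> I \<subseteq> Q}"
  \<comment> \<open>The infimum of the empty set is infinite. A nonempty set of extended naturals
    attains its infimum, so some prime above \<open>I\<close> has height exactly two.\<close>
  have ne: "?H \<noteq> {}" using ht unfolding height_def by (metis Inf_enat_def infinity_ne_i1 numeral_ne_infinity)
  then have "Inf ?H \<in> ?H" unfolding Inf_enat_def by (simp only: if_False) (metis LeastI_ex ex_in_conv)
  then obtain Q where Q: "primeideal Q R" "I \<subseteq> Q" "prime_height R Q = 2"
    using ht unfolding height_def by (metis (mono_tags, lifting) imageE mem_Collect_eq)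
  have hmin: "2 \<le> prime_height R P" if "primeideal P R" "I \<subseteq> P" for P
    using ht that unfolding height_def by (metis (mono_tags, lifting) Inf_lower imageI mem_Collect_eq)
  have Qi: "ideal Q R" using Q(1) primeideal.axioms(1) by blast
  have "Q \<noteq> carrier R" using primeideal.I_notcarr[OF Q(1)] by blast
  then show Im: "I \<subseteq> \<mm>" using proper_ideal_le[OF Qi] Q(2) by blast
  have Iproper: "I \<noteq> carrier R" using Im one_notin by blast
  have zI: "{\<zero>} \<subseteq> I" and zm: "{\<zero>} \<subseteq> \<mm>"
    using additive_subgroup.zero_closed[OF ideal.axioms(1)[OF Ii]] additive_subgroup.zero_closed[OF ideal.axioms(1)[OF m_ideal]] by auto
  obtain xs where xs: "regular_seq_mod R {\<zero>} ([] @ xs)" "set xs \<subseteq> I"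
    "\<And>x. x \<in> I \<Longrightarrow> \<not> regular_mod R (adjoins R {\<zero>} ([] @ xs)) x"
    by (rule inextendable_regular_seq[OF zeroideal Ii Iproper zI, of "[]"]) auto
  have xsm: "set xs \<subseteq> \<mm>" using xs(2) Im by blast
  have xsc: "set xs \<subseteq> carrier R" using xsm m_carrier by blast
  let ?J = "adjoins R {\<zero>} xs"
  have Ji: "ideal ?J R" by (rule adjoins_ideal[OF zeroideal xsc])
  have len2: "length xs \<le> 2"
  proof -
    have "{\<zero>} \<subseteq> Q" "set xs \<subseteq> Q" using zI xs(2) Q(2) by auto
    then obtain p where "prime_chain R (length xs) p" "p (length xs) = Q"
      using prime_chain_below[OF zeroideal _ Q(1)] xs(1) by auto
    then have "enat (length xs) \<le> 2" using prime_height_ge Q(3) by metis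
    then show ?thesis by (metis enat_ord_simps(1) numeral_eq_enat)
  qed
  obtain z where z: "z \<in> carrier R" "z \<notin> ?J" "I \<subseteq> colon R ?J z" "primeideal (colon R ?J z) R"
    using zero_divisors_in_associated_prime[OF Ji Ii] xs(3) by auto
  have m_ne: "\<mm> \<noteq> carrier R" using one_notin by blast
  obtain ys where ys: "regular_seq_mod R {\<zero>} (xs @ ys)" "set ys \<subseteq> \<mm>"
    "\<And>x. x \<in> \<mm> \<Longrightarrow> \<not> regular_mod R (adjoins R {\<zero>} (xs @ ys)) x"
    by (rule inextendable_regular_seq[OF zeroideal m_ideal m_ne zm _ xsm]) (use xs(1) in auto)
  have setm: "set (xs @ ys) \<subseteq> \<mm>" using xsm ys(2) by simp
  have dim: "krull_dim R = enat (length xs + length ys)"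
    using depth_eq[OF ys(1) setm ys(3)] CM by simp
  have "regular_seq_mod R ?J ys" using ys(1) by (simp add: regular_seq_mod_append)
  then obtain p where p: "prime_chain R (length ys) p" "p 0 = colon R ?J z"
    using prime_chain_above[OF Ji _ ys(2) z(1,2,4)] by blast
  \<comment> \<open>The associated prime contains \<open>I\<close>, so it has height at least two,
    and the chain over it adds \<open>length ys\<close>. Comparison with
    \<open>dim R = length xs + length ys\<close> shows that \<open>xs\<close> is nonempty; its first
    entry is the regular element of \<open>I\<close>.\<close>
  have "enat (2 + length ys) \<le> krull_dim R"
    using prime_height_plus_le[OF p(1), of 2] hmin[OF z(4,3)] p(2) by (simp add: numeral_eq_enat)
  then have "xs \<noteq> []" using dim by auto
  then obtain x xs' where x: "xs = x # xs'" by (cases xs) auto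
  show "\<exists>x\<in>I. regular_mod R {\<zero>} x" using xs(1,2) unfolding x by auto
  fix K D q assume res: "free_resolution R \<mm> K D I" and q: "K q \<noteq> {}" "\<And>i. i > q \<Longrightarrow> K i = {}"
  have nnmax: "maximalideal nn (R Quot I)" using nn unfolding cohen_macaulay_local_ring_def local_ring_def by blast
  have "enat (length ys) \<le> depth (R Quot I) nn"
    using quot_krull_dim_ge[OF Ii p(1)] p(2) z(3) nn unfolding cohen_macaulay_local_ring_def by simp
  then obtain us where us: "regular_seq_mod R I us" "set us \<subseteq> \<mm>" "length ys \<le> length us"
    using quot_depth_lift[OF Ii nnmax] by blast
  have "q + length us \<le> length (xs @ ys)"
    by (rule depth_inequality[OF res q us(1,2) ys(1) setm ys(3)])
  then show "q \<le> 2" using us(3) len2 by simp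
qed

end

section \<open>The top Ext module\<close>

lemma (in module) submoduleI_smult:
  assumes "H \<subseteq> carrier M" "\<zero>\<^bsub>M\<^esub> \<in> H"
    and "\<And>a b. a \<in> H \<Longrightarrow> b \<in> H \<Longrightarrow> a \<oplus>\<^bsub>M\<^esub> b \<in> H"
    and smult: "\<And>a x. a \<in> carrier R \<Longrightarrow> x \<in> H \<Longrightarrow> a \<odot>\<^bsub>M\<^esub> x \<in> H"
  shows "submodule H R M"
proof (rule submoduleI[OF assms(1,2) _ assms(3,4)])
  fix a assume a: "a \<in> H"
  then have "\<ominus>\<^bsub>M\<^esub> a = (\<ominus> \<one>) \<odot>\<^bsub>M\<^esub> a" using assms(1) smult_l_minus[of \<one> a] by auto
  then show "\<ominus>\<^bsub>M\<^esub> a \<in> H" using smult[OF _ a] by simp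
qed

section \<open>Quotient modules\<close>

context
  fixes R :: "('a, 'r) ring_scheme" and M :: "('a, 'b) module" and N
  assumes M: "module R M" and N: "submodule N R M"
begin

interpretation M: module R M by (rule M)

interpretation N: abelian_subgroup N M
  by (rule abelian_subgroupI3[OF _ M.abelian_group_axioms])
    (rule additive_subgroup.intro[OF submodule.axioms(1)[OF N]])

lemma quotient_carrier: "carrier (quotient_module M N) = (\<lambda>x. N +>\<^bsub>M\<^esub> x) ` carrier M"
  unfolding quotient_module_def A_RCOSETS_def' by auto

lemma quotient_add:
  "x \<in> carrier M \<Longrightarrow> y \<in> carrier M \<Longrightarrow>
    (N +>\<^bsub>M\<^esub> x) \<oplus>\<^bsub>quotient_module M N\<^esub> (N +>\<^bsub>M\<^esub> y) = N +>\<^bsub>M\<^esub> (x \<oplus>\<^bsub>M\<^esub> y)"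
  unfolding quotient_module_def by (simp add: N.a_rcos_sum)

lemma quotient_zero: "\<zero>\<^bsub>quotient_module M N\<^esub> = N +>\<^bsub>M\<^esub> \<zero>\<^bsub>M\<^esub>"
  unfolding quotient_module_def using N.a_subset by (simp add: M.a_coset_add_zero)

lemma quotient_coset_eq_iff:
  assumes "x \<in> carrier M" "y \<in> carrier M"
  shows "N +>\<^bsub>M\<^esub> x = N +>\<^bsub>M\<^esub> y \<longleftrightarrow> (\<exists>b\<in>N. x = b \<oplus>\<^bsub>M\<^esub> y)"
proof
  assume "N +>\<^bsub>M\<^esub> x = N +>\<^bsub>M\<^esub> y"
  then have "x \<in> N +>\<^bsub>M\<^esub> y" using N.a_rcos_self[OF assms(1)] by simp
  then show "\<exists>b\<in>N. x = b \<oplus>\<^bsub>M\<^esub> y" unfolding a_r_coset_def' by auto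
next
  assume "\<exists>b\<in>N. x = b \<oplus>\<^bsub>M\<^esub> y"
  then have "x \<in> N +>\<^bsub>M\<^esub> y" unfolding a_r_coset_def' by auto
  then show "N +>\<^bsub>M\<^esub> x = N +>\<^bsub>M\<^esub> y" using N.a_repr_independence'[OF _ assms(2)] by simp
qed

text \<open>The scalar product is defined as a union over representatives. They all yield the same
  coset, as \<open>N\<close> is closed under scalars.\<close>

lemma quotient_smult:
  assumes a: "a \<in> carrier R" and x: "x \<in> carrier M"
  shows "a \<odot>\<^bsub>quotient_module M N\<^esub> (N +>\<^bsub>M\<^esub> x) = N +>\<^bsub>M\<^esub> (a \<odot>\<^bsub>M\<^esub> x)"
proof -
  have eq: "N +>\<^bsub>M\<^esub> (a \<odot>\<^bsub>M\<^esub> y) = N +>\<^bsub>M\<^esub> (a \<odot>\<^bsub>M\<^esub> x)" if y: "y \<in> N +>\<^bsub>M\<^esub> x" for y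
  proof -
    obtain b where b: "b \<in> N" "y = b \<oplus>\<^bsub>M\<^esub> x" using y unfolding a_r_coset_def' by auto
    have bc: "b \<in> carrier M" using b N.a_subset by blast
    have "a \<odot>\<^bsub>M\<^esub> y = a \<odot>\<^bsub>M\<^esub> b \<oplus>\<^bsub>M\<^esub> a \<odot>\<^bsub>M\<^esub> x" using b bc a x by (simp add: M.smult_r_distr)
    moreover have "a \<odot>\<^bsub>M\<^esub> b \<in> N" using submodule.smult_closed[OF N a b(1)] .
    ultimately show ?thesis using quotient_coset_eq_iff[of "a \<odot>\<^bsub>M\<^esub> y" "a \<odot>\<^bsub>M\<^esub> x"] a x b bc by auto
  qed
  have "a \<odot>\<^bsub>quotient_module M N\<^esub> (N +>\<^bsub>M\<^esub> x) = (\<Union>y\<in>N +>\<^bsub>M\<^esub> x. N +>\<^bsub>M\<^esub> (a \<odot>\<^bsub>M\<^esub> y))"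
    unfolding quotient_module_def by simp
  also have "\<dots> = (\<Union>y\<in>N +>\<^bsub>M\<^esub> x. N +>\<^bsub>M\<^esub> (a \<odot>\<^bsub>M\<^esub> x))" using eq by simp
  also have "\<dots> = N +>\<^bsub>M\<^esub> (a \<odot>\<^bsub>M\<^esub> x)" using N.a_rcos_self[OF x] by blast
  finally show ?thesis .
qed

lemma quotient_module: "module R (quotient_module M N)"
proof (rule moduleI[OF M.R.is_cring])
  let ?Q = "quotient_module M N"
  show "abelian_group ?Q"
  proof (rule abelian_groupI)
    fix X assume "X \<in> carrier ?Q"
    then obtain x where x: "x \<in> carrier M" "X = N +>\<^bsub>M\<^esub> x" unfolding quotient_carrier by blast
    have "(N +>\<^bsub>M\<^esub> \<ominus>\<^bsub>M\<^esub> x) \<oplus>\<^bsub>?Q\<^esub> X = \<zero>\<^bsub>?Q\<^esub>"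
      unfolding x(2) quotient_zero using quotient_add[of "\<ominus>\<^bsub>M\<^esub> x" x] x by (simp add: M.l_neg)
    then show "\<exists>Y\<in>carrier ?Q. Y \<oplus>\<^bsub>?Q\<^esub> X = \<zero>\<^bsub>?Q\<^esub>"
      unfolding quotient_carrier using x by blast
  qed (auto simp: quotient_carrier quotient_add quotient_zero M.a_ac)
qed (auto simp: quotient_carrier quotient_add quotient_smult M.smult_l_distr M.smult_r_distr M.smult_assoc1)

end

lemma submodule_of_submodule:
  assumes M: "module R M" and Z: "submodule Z R M" and B: "submodule B R M" "B \<subseteq> Z"
  shows "submodule B R (M\<lparr>carrier := Z\<rparr>)"
proof -
  interpret M: module R M by fact
  interpret Z: module R "M\<lparr>carrier := Z\<rparr>" by (rule submodule.submodule_is_module[OF Z M])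
  show ?thesis
    by (rule Z.submoduleI_smult)
      (use B(2) M.submoduleE(4,5)[OF B(1)] subgroup.one_closed[OF submodule.axioms(1)[OF B(1)]] in auto)
qed

section \<open>The module of homomorphisms, cocycles and coboundaries\<close>

lemma Hom_module_add: "x \<in> carrier M \<Longrightarrow> (f \<oplus>\<^bsub>Hom_module R M N\<^esub> g) x = f x \<oplus>\<^bsub>N\<^esub> g x"
  and Hom_module_smult: "x \<in> carrier M \<Longrightarrow> (a \<odot>\<^bsub>Hom_module R M N\<^esub> f) x = a \<odot>\<^bsub>N\<^esub> f x"
  and Hom_module_zero: "x \<in> carrier M \<Longrightarrow> \<zero>\<^bsub>Hom_module R M N\<^esub> x = \<zero>\<^bsub>N\<^esub>"
  by (simp_all add: Hom_module_def)

lemma Hom_module_closed: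
  assumes M: "module R M" and N: "module R N"
  shows "\<zero>\<^bsub>Hom_module R M N\<^esub> \<in> Homs R M N"
    and "f \<in> Homs R M N \<Longrightarrow> g \<in> Homs R M N \<Longrightarrow> f \<oplus>\<^bsub>Hom_module R M N\<^esub> g \<in> Homs R M N"
    and "f \<in> Homs R M N \<Longrightarrow> a \<in> carrier R \<Longrightarrow> a \<odot>\<^bsub>Hom_module R M N\<^esub> f \<in> Homs R M N"
proof -
  interpret M: module R M by fact
  interpret N: module R N by fact
  have eq: "\<zero>\<^bsub>Hom_module R M N\<^esub> = (\<lambda>x\<in>carrier M. \<zero>\<^bsub>N\<^esub>)"
    "f \<oplus>\<^bsub>Hom_module R M N\<^esub> g = (\<lambda>x\<in>carrier M. f x \<oplus>\<^bsub>N\<^esub> g x)"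
    "a \<odot>\<^bsub>Hom_module R M N\<^esub> f = (\<lambda>x\<in>carrier M. a \<odot>\<^bsub>N\<^esub> f x)" for f g a
    by (simp_all add: Hom_module_def)
  show "\<zero>\<^bsub>Hom_module R M N\<^esub> \<in> Homs R M N" unfolding eq by (rule Homs_restrictI[OF M]) auto
  show "f \<oplus>\<^bsub>Hom_module R M N\<^esub> g \<in> Homs R M N" if "f \<in> Homs R M N" "g \<in> Homs R M N"
    unfolding eq by (rule Homs_restrictI[OF M])
      (auto simp: Homs_closed[OF that(1)] Homs_closed[OF that(2)] Homs_add[OF that(1)] Homs_add[OF that(2)]
        Homs_smult[OF that(1)] Homs_smult[OF that(2)] N.smult_r_distr N.a_ac)
  show "a \<odot>\<^bsub>Hom_module R M N\<^esub> f \<in> Homs R M N" if f: "f \<in> Homs R M N" and a: "a \<in> carrier R"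
    unfolding eq by (rule Homs_restrictI[OF M])
      (use a in \<open>auto simp: Homs_closed[OF f] Homs_add[OF f] Homs_smult[OF f] N.smult_r_distr N.smult_assoc1[symmetric] M.R.m_comm\<close>)
qed

lemma Hom_module_module:
  assumes M: "module R M" and N: "module R N"
  shows "module R (Hom_module R M N)"
proof -
  interpret M: module R M by fact
  interpret N: module R N by fact
  note cl = Hom_module_closed[OF M N]
  show ?thesis
  proof (rule moduleI[OF M.R.is_cring])
    show "abelian_group (Hom_module R M N)"
    proof (rule abelian_groupI)
      fix f assume f: "f \<in> Homs R M N"
      have "(\<ominus>\<^bsub>R\<^esub> \<one>\<^bsub>R\<^esub>) \<odot>\<^bsub>Hom_module R M N\<^esub> f \<oplus>\<^bsub>Hom_module R M N\<^esub> f = \<zero>\<^bsub>Hom_module R M N\<^esub>"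
        by (rule Homs_eqI[OF cl(2)[OF cl(3)[OF f] f] cl(1)])
          (auto simp: Hom_module_add Hom_module_smult Hom_module_zero Homs_closed[OF f] N.smult_l_minus N.l_neg)
      then show "\<exists>g\<in>Homs R M N. g \<oplus>\<^bsub>Hom_module R M N\<^esub> f = \<zero>\<^bsub>Hom_module R M N\<^esub>"
        using cl(3)[OF f] by (metis M.R.a_inv_closed M.R.one_closed)
    qed (auto intro!: Homs_eqI[of _ R M N] cl simp: Hom_module_add Hom_module_zero Homs_closed N.a_ac)
  qed (auto intro!: Homs_eqI[of _ R M N] cl simp: Hom_module_add Hom_module_smult Homs_closed
      N.smult_l_distr N.smult_r_distr N.smult_assoc1)
qed

text \<open>The dual of \<open>\<phi>\<close>. For consecutive differentials in place of
  \<open>\<phi>\<close>, the kernel of one dual map gives the cocycles and the image of the other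
  the coboundaries, so both are submodules.\<close>

lemma Hom_module_precompose:
  assumes L: "module R L" and M: "module R M" and N: "module R N" and \<phi>: "\<phi> \<in> Homs R L M"
  shows "(\<lambda>f\<in>Homs R M N. compose (carrier L) f \<phi>) \<in> Homs R (Hom_module R M N) (Hom_module R L N)"
proof (rule Homs_restrictI[OF Hom_module_module[OF M N]])
  note cl = Hom_module_closed[OF M N] and clL = Hom_module_closed[OF L N]
  note comp = Homs_compose[OF L \<phi>]
  show "compose (carrier L) f \<phi> \<in> Homs R L N" if "f \<in> Homs R M N" for f by (rule comp[OF that])
  show "compose (carrier L) (f \<oplus>\<^bsub>Hom_module R M N\<^esub> g) \<phi> = compose (carrier L) f \<phi> \<oplus>\<^bsub>Hom_module R L N\<^esub> compose (carrier L) g \<phi>"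
    if "f \<in> Homs R M N" "g \<in> Homs R M N" for f g
    using that by (intro Homs_eqI[OF comp[OF cl(2)] clL(2)[OF comp comp]])
      (auto simp: compose_def Hom_module_add Homs_closed[OF \<phi>])
  show "compose (carrier L) (a \<odot>\<^bsub>Hom_module R M N\<^esub> f) \<phi> = a \<odot>\<^bsub>Hom_module R L N\<^esub> compose (carrier L) f \<phi>"
    if "a \<in> carrier R" "f \<in> Homs R M N" for a f
    using that by (intro Homs_eqI[OF comp[OF cl(3)] clL(3)[OF comp]])
      (auto simp: compose_def Hom_module_smult Homs_closed[OF \<phi>])
qed

lemma Ext_submodules:
  assumes res: "projective_resolution R P d \<epsilon> M" and N: "module R N"
  shows "submodule (Ext_cocycles R P d (Suc n) N) R (Hom_module R (P (Suc n)) N)"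
    and "submodule (Ext_coboundaries R P d (Suc n) N) R (Hom_module R (P (Suc n)) N)"
    and "Ext_coboundaries R P d (Suc n) N \<subseteq> Ext_cocycles R P d (Suc n) N"
proof -
  note D = projective_resolutionD[OF res]
  have H: "module R (Hom_module R (P k) N)" for k by (rule Hom_module_module[OF D(2) N])
  show "submodule (Ext_cocycles R P d (Suc n) N) R (Hom_module R (P (Suc n)) N)"
    using Homs_kernel_submodule[OF H H Hom_module_precompose[OF D(2) D(2) N D(5)[of "Suc n"]]]
    unfolding Ext_cocycles_def by (simp cong: conj_cong)
  show "submodule (Ext_coboundaries R P d (Suc n) N) R (Hom_module R (P (Suc n)) N)"
    using Homs_image_submodule[OF H H Hom_module_precompose[OF D(2) D(2) N D(5)[of n]]]
    unfolding Ext_coboundaries_def by simp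
  show "Ext_coboundaries R P d (Suc n) N \<subseteq> Ext_cocycles R P d (Suc n) N"
  proof
    fix f assume "f \<in> Ext_coboundaries R P d (Suc n) N"
    then obtain g where g: "g \<in> Homs R (P n) N" "f = compose (carrier (P (Suc n))) g (d n)"
      unfolding Ext_coboundaries_def by auto
    have f: "f \<in> Homs R (P (Suc n)) N" unfolding g(2) by (rule Homs_compose[OF D(2) D(5) g(1)])
    have "compose (carrier (P (Suc (Suc n)))) f (d (Suc n)) = \<zero>\<^bsub>Hom_module R (P (Suc (Suc n))) N\<^esub>"
    proof (rule Homs_eqI[OF Homs_compose[OF D(2) D(5) f] Hom_module_closed(1)[OF D(2) N]])
      fix x assume x: "x \<in> carrier (P (Suc (Suc n)))"
      have "d n (d (Suc n) x) = \<zero>\<^bsub>P n\<^esub>" using D(8)[of n] x by blast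
      then show "compose (carrier (P (Suc (Suc n)))) f (d (Suc n)) x = \<zero>\<^bsub>Hom_module R (P (Suc (Suc n))) N\<^esub> x"
        using x Homs_closed[OF D(5) x] Homs_zero[OF D(2) N g(1)] by (simp add: g(2) compose_def Hom_module_zero)
    qed
    then show "f \<in> Ext_cocycles R P d (Suc n) N" using f unfolding Ext_cocycles_def by simp
  qed
qed

section \<open>Linear forms on free modules, and the resolution of \<open>R/I\<close>\<close>

context cring
begin

lemma Homs_free_ring_coord:
  fixes X :: "'x set"
  assumes h: "h \<in> Homs R (free X) (ring_module R)" and X: "finite X" and v: "v \<in> carrier (free X)"
  shows "h v = (\<Oplus>x\<in>X. v x \<otimes> h (unit_vec R X x))"
proof -
  interpret M: module R "ring_module R" by (rule ring_module)
  have fs: "finsum (ring_module R) k S = finsum R k S" if "finite S" "k \<in> S \<rightarrow> carrier R" for k :: "'x \<Rightarrow> 'a" and S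
    using that by (induction S) (auto simp: ring_module_simps Pi_iff)
  have hc: "h (unit_vec R X x) \<in> carrier (ring_module R)" for x using Homs_closed[OF h unit_vec_closed] .
  have "h v = lincomb R (ring_module R) X (\<lambda>x. h (unit_vec R X x)) v" by (rule Homs_free_eq_lincomb[OF ring_module h v])
  also have "\<dots> = (\<Oplus>\<^bsub>ring_module R\<^esub>x\<in>X. v x \<odot>\<^bsub>ring_module R\<^esub> h (unit_vec R X x))"
    by (rule lincomb_eq[OF ring_module v _ X]) (use hc in auto)
  also have "\<dots> = (\<Oplus>x\<in>X. v x \<otimes> h (unit_vec R X x))"
    unfolding ring_module_simps by (rule fs[OF X]) (use hc free_coord[OF v] in \<open>auto simp: ring_module_simps\<close>)
  finally show ?thesis .
qed

lemma Homs_free_ring_in_ideal: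
  assumes J: "ideal J R" and h: "h \<in> Homs R (free X) (ring_module R)" and X: "finite X" and v: "v \<in> carrier (free X)"
    and vJ: "\<And>x. x \<in> X \<Longrightarrow> v x \<in> J"
  shows "h v \<in> J"
proof -
  have hc: "h (unit_vec R X x) \<in> carrier R" for x
    using Homs_closed[OF h unit_vec_closed] by (simp add: ring_module_simps)
  show ?thesis
    unfolding Homs_free_ring_coord[OF h X v]
    by (rule finsum_in_ideal[OF J X]) (use vJ hc ideal.I_r_closed[OF J] in blast)
qed

text \<open>Induction on a bound \<open>k\<close> for the indices of basis vectors on which
  \<open>h\<close> does not vanish; subtracting a multiple of a coordinate function lowers the
  bound. Coordinate functions therefore generate the dual.\<close>

lemma dual_generated_by_coordinates:
  assumes T: "submodule T R (Hom_module R (free {..<m::nat}) (ring_module R))"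
    and coord: "\<And>j. j < m \<Longrightarrow> (\<lambda>v\<in>carrier (free {..<m}). v j) \<in> T"
    and h: "h \<in> Homs R (free {..<m}) (ring_module R)"
  shows "h \<in> T"
proof -
  let ?H = "Hom_module R (free {..<m}) (ring_module R)" and ?e = "unit_vec R {..<m}"
  interpret H: module R ?H by (rule Hom_module_module[OF free_module ring_module])
  note cl = Hom_module_closed[OF free_module[of "{..<m}"] ring_module]
  define \<phi> where "\<phi> j = (\<lambda>v\<in>carrier (free {..<m}). v j)" for j
  have \<phi>T: "\<phi> j \<in> T" and \<phi>: "\<phi> j \<in> Homs R (free {..<m}) (ring_module R)" if "j < m" for j
    using coord[OF that] H.submoduleE(1)[OF T] unfolding \<phi>_def by auto
  have hc: "h (?e j) \<in> carrier R" if "h \<in> Homs R (free {..<m}) (ring_module R)" for h j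
    using Homs_closed[OF that unit_vec_closed] by (simp add: ring_module_simps)
  have "h \<in> T" if "h \<in> Homs R (free {..<m}) (ring_module R)" "\<And>j. j < m \<Longrightarrow> k \<le> j \<Longrightarrow> h (?e j) = \<zero>" "k \<le> m" for h k
    using that
  proof (induction k arbitrary: h)
    case 0
    have "h = \<zero>\<^bsub>?H\<^esub>"
      by (rule Homs_eqI[OF 0(1) cl(1)], rule Homs_free_eqI[OF ring_module 0(1) cl(1)])
        (use 0 in \<open>auto simp: Hom_module_zero unit_vec_closed ring_module_simps\<close>)
    then show ?case using subgroup.one_closed[OF submodule.axioms(1)[OF T]] by simp
  next
    case (Suc k)
    have km: "k < m" using Suc.prems by simp
    define a where "a = h (?e k)"
    have a: "a \<in> carrier R" unfolding a_def by (rule hc[OF Suc.prems(1)])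
    define h' where "h' = h \<oplus>\<^bsub>?H\<^esub> ((\<ominus> a) \<odot>\<^bsub>?H\<^esub> \<phi> k)"
    have h': "h' \<in> Homs R (free {..<m}) (ring_module R)"
      unfolding h'_def using Suc.prems(1) \<phi>[OF km] a cl(2,3) by simp
    have h'T: "h' \<in> T"
    proof (rule Suc.IH[OF h'])
      fix j assume j: "j < m" "k \<le> j"
      have "h' (?e j) = h (?e j) \<oplus> (\<ominus> a) \<otimes> ?e j k"
        unfolding h'_def by (simp add: Hom_module_add Hom_module_smult unit_vec_closed ring_module_simps \<phi>_def)
      moreover have "?e j k = (if j = k then \<one> else \<zero>)" using km by (simp add: unit_vec_def)
      moreover have "h (?e j) = \<zero>" if "j \<noteq> k" using Suc.prems(2)[OF j(1)] j(2) that by simp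
      ultimately show "h' (?e j) = \<zero>" using a a_def by (cases "j = k") (simp_all add: r_neg)
    qed (use km in simp)
    have "h = h' \<oplus>\<^bsub>?H\<^esub> (a \<odot>\<^bsub>?H\<^esub> \<phi> k)"
    proof (rule Homs_eqI[OF Suc.prems(1)])
      show "h' \<oplus>\<^bsub>?H\<^esub> (a \<odot>\<^bsub>?H\<^esub> \<phi> k) \<in> Homs R (free {..<m}) (ring_module R)"
        using h' \<phi>[OF km] a cl(2,3) by simp
      fix v assume v: "v \<in> carrier (free {..<m})"
      have "h v \<in> carrier R" "\<phi> k v \<in> carrier R"
        using Homs_closed[OF Suc.prems(1) v] Homs_closed[OF \<phi>[OF km] v] by (simp_all add: ring_module_simps)
      then have "h v = h v \<oplus> (\<ominus> a) \<otimes> \<phi> k v \<oplus> a \<otimes> \<phi> k v" using a by algebra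
      then show "h v = (h' \<oplus>\<^bsub>?H\<^esub> (a \<odot>\<^bsub>?H\<^esub> \<phi> k)) v"
        unfolding h'_def using v by (simp add: Hom_module_add Hom_module_smult ring_module_simps)
    qed
    then show ?case using h'T \<phi>T[OF km] a H.submoduleE(4,5)[OF T] by metis
  qed
  from this[OF h, of m] show ?thesis by simp
qed

text \<open>\<open>free_resolution\<close> keeps track of the resolved module only through the image
  of the first differential. The augmentation supplied here is the coset of the single
  coordinate.\<close>

lemma free_resolution_projective:
  assumes res: "free_resolution R \<mm> K D I"
  shows "projective_resolution R (\<lambda>n. free (K n)) D
    (\<lambda>v\<in>carrier (free (K 0)). I +>\<^bsub>ring_module R\<^esub> v 0) (quotient_module (ring_module R) I)"
  unfolding projective_resolution_def
proof (intro conjI allI)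
  note D = free_resolutionD[OF res]
  let ?M = "ring_module R"
  interpret F: module R "free X" for X :: "nat set" by (rule free_module)
  have I: "ideal I R" by (rule free_resolution_ideal[OF res])
  note sub = ideal_submodule[OF I]
  note Q = quotient_carrier[OF ring_module sub] quotient_add[OF ring_module sub] quotient_zero[OF ring_module sub]
    quotient_coset_eq_iff[OF ring_module sub] quotient_smult[OF ring_module sub]
  have k0: "0 \<in> K 0" using D(1) by simp
  have c0: "v 0 \<in> carrier ?M" if "v \<in> carrier (free (K 0))" for v
    using free_coord[OF that k0] by (simp add: ring_module_simps)
  show "module R (quotient_module ?M I)" by (rule quotient_module[OF ring_module sub])
  show "(\<lambda>v\<in>carrier (free (K 0)). I +>\<^bsub>?M\<^esub> v 0) \<in> Homs R (free (K 0)) (quotient_module ?M I)"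
  proof (rule Homs_restrictI[OF free_module])
    show "I +>\<^bsub>?M\<^esub> v 0 \<in> carrier (quotient_module ?M I)" if "v \<in> carrier (free (K 0))" for v
      unfolding Q(1) using c0[OF that] by blast
    show "I +>\<^bsub>?M\<^esub> (v \<oplus>\<^bsub>free (K 0)\<^esub> w) 0 = (I +>\<^bsub>?M\<^esub> v 0) \<oplus>\<^bsub>quotient_module ?M I\<^esub> (I +>\<^bsub>?M\<^esub> w 0)"
      if "v \<in> carrier (free (K 0))" "w \<in> carrier (free (K 0))" for v w
      using Q(2)[OF c0[OF that(1)] c0[OF that(2)]] by (simp add: free_add[OF k0] ring_module_simps)
    show "I +>\<^bsub>?M\<^esub> (a \<odot>\<^bsub>free (K 0)\<^esub> v) 0 = a \<odot>\<^bsub>quotient_module ?M I\<^esub> (I +>\<^bsub>?M\<^esub> v 0)"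
      if "a \<in> carrier R" "v \<in> carrier (free (K 0))" for a v
      using Q(5)[OF that(1) c0[OF that(2)]] by (simp add: free_smult[OF k0] ring_module_simps)
  qed
  show "(\<lambda>v\<in>carrier (free (K 0)). I +>\<^bsub>?M\<^esub> v 0) ` carrier (free (K 0)) = carrier (quotient_module ?M I)"
  proof (intro equalityI subsetI)
    fix X assume "X \<in> carrier (quotient_module ?M I)"
    then obtain a where a: "a \<in> carrier R" "X = I +>\<^bsub>?M\<^esub> a" unfolding Q(1) by (auto simp: ring_module_simps)
    have "(\<lambda>k\<in>K 0. a) \<in> carrier (free (K 0))" unfolding free_carrier_finite[OF D(2)] using a by auto
    then show "X \<in> (\<lambda>v\<in>carrier (free (K 0)). I +>\<^bsub>?M\<^esub> v 0) ` carrier (free (K 0))"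
      using a k0 by (intro image_eqI[of _ _ "\<lambda>k\<in>K 0. a"]) auto
  qed (use c0 in \<open>auto simp: Q(1)\<close>)
  show "D 0 ` carrier (free (K 1)) =
      {x \<in> carrier (free (K 0)). (\<lambda>v\<in>carrier (free (K 0)). I +>\<^bsub>?M\<^esub> v 0) x = \<zero>\<^bsub>quotient_module ?M I\<^esub>}"
  proof -
    have zero: "I +>\<^bsub>?M\<^esub> v 0 = \<zero>\<^bsub>quotient_module ?M I\<^esub> \<longleftrightarrow> v 0 \<in> I" if v: "v \<in> carrier (free (K 0))" for v
    proof -
      have "I +>\<^bsub>?M\<^esub> v 0 = \<zero>\<^bsub>quotient_module ?M I\<^esub> \<longleftrightarrow> (\<exists>b\<in>I. v 0 = b \<oplus> \<zero>)"
        unfolding Q(3) using Q(4)[OF c0[OF v], of "\<zero>\<^bsub>?M\<^esub>"] by (simp add: ring_module_simps)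
      also have "\<dots> \<longleftrightarrow> v 0 \<in> I" using ideal.Icarr[OF I] by auto
      finally show ?thesis .
    qed
    show ?thesis
    proof (intro equalityI subsetI)
      fix v assume "v \<in> D 0 ` carrier (free (K 1))"
      then obtain w where w: "w \<in> carrier (free (K 1))" "v = D 0 w" by blast
      have "v \<in> carrier (free (K 0))" using w Homs_closed[OF D(3)[of 0]] by simp
      moreover have "v 0 \<in> I" using w D(5) by blast
      ultimately show "v \<in> {x \<in> carrier (free (K 0)). (\<lambda>v\<in>carrier (free (K 0)). I +>\<^bsub>?M\<^esub> v 0) x = \<zero>\<^bsub>quotient_module ?M I\<^esub>}"
        using zero by simp
    next
      fix v assume "v \<in> {x \<in> carrier (free (K 0)). (\<lambda>v\<in>carrier (free (K 0)). I +>\<^bsub>?M\<^esub> v 0) x = \<zero>\<^bsub>quotient_module ?M I\<^esub>}"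
      then have v: "v \<in> carrier (free (K 0))" "v 0 \<in> I" using zero by auto
      then obtain w where w: "w \<in> carrier (free (K 1))" "v 0 = D 0 w 0" using D(5) by blast
      have "v = D 0 w"
        by (rule free_eqI[OF v(1)]) (use w D(1) Homs_closed[OF D(3)[of 0]] in auto)
      then show "v \<in> D 0 ` carrier (free (K 1))" using w by blast
    qed
  qed
qed (use free_resolutionD[OF res] free_projective in auto)

end

section \<open>Minimal number of generators of the top Ext module\<close>

context noetherian_local_ring
begin

text \<open>\<open>P\<close> is arbitrary and carries no minimality, so the homotopy equivalences
  \<open>f\<close> and \<open>g\<close> transport the question to the minimal resolution. Its last
  differential has entries in \<open>\<mm>\<close>, so Ext modulo \<open>\<mm>\<close> is the dual
  of the top free module modulo \<open>\<mm>\<close>.\<close>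

lemma min_gens_top_Ext:
  assumes res: "free_resolution R \<mm> (\<lambda>n. {..<r n}) D I" and top: "r (Suc (Suc n)) = 0"
    and P: "projective_resolution R P d \<epsilon> (quotient_module (ring_module R) I)"
  shows "min_gens R (Ext R P d (Suc n) (ring_module R)) = enat (r (Suc n))"
proof -
  let ?F = "\<lambda>n. free {..<r n}" and ?A = "ring_module R"
  let ?m = "r (Suc n)"
  note FR = free_resolution_projective[OF res]
  note FD = projective_resolutionD[OF FR] and PD = projective_resolutionD[OF P] and RD = free_resolutionD[OF res]
  interpret A: module R ?A by (rule ring_module)
  interpret F: module R "free X" for X :: "nat set" by (rule free_module)
  obtain f g k h where "chain_map R ?F D P d f" "chain_map R P d ?F D g"
    "homotopic_to_id R ?F D (\<lambda>n x. g n (f n x)) k" "homotopic_to_id R P d (\<lambda>n x. f n (g n x)) h"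
    by (rule resolutions_homotopy_equivalent[OF FR P]) (rule that)
  note f = chain_mapD[OF this(1)] and g = chain_mapD[OF this(2)]
    and k = homotopic_to_idD[OF this(3)] and h = homotopic_to_idD[OF this(4)]
  let ?H = "Hom_module R (P (Suc n)) ?A"
  define Z where "Z = Ext_cocycles R P d (Suc n) ?A"
  define B where "B = Ext_coboundaries R P d (Suc n) ?A"
  define E where "E = Ext R P d (Suc n) ?A"
  define ZM where "ZM = ?H\<lparr>carrier := Z\<rparr>"
  have H: "module R ?H" by (rule Hom_module_module[OF PD(2) ring_module])
  note subs = Ext_submodules[OF P ring_module, of n, folded Z_def B_def]
  have ZM: "module R ZM" unfolding ZM_def by (rule submodule.submodule_is_module[OF subs(1) H])
  have BZ: "submodule B R ZM" unfolding ZM_def by (rule submodule_of_submodule[OF H subs])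
  have ZMs: "carrier ZM = Z" "\<And>x y. x \<oplus>\<^bsub>ZM\<^esub> y = x \<oplus>\<^bsub>?H\<^esub> y" "\<And>a x. a \<odot>\<^bsub>ZM\<^esub> x = a \<odot>\<^bsub>?H\<^esub> x" "\<zero>\<^bsub>ZM\<^esub> = \<zero>\<^bsub>?H\<^esub>"
    by (simp_all add: ZM_def)
  have Eq: "E = quotient_module ZM B" unfolding E_def Ext_def ZM_def Z_def B_def by simp
  define cl where "cl \<psi> = B +>\<^bsub>ZM\<^esub> \<psi>" for \<psi>
  have Ecar: "carrier E = cl ` Z"
    and Eadd: "\<And>x y. x \<in> Z \<Longrightarrow> y \<in> Z \<Longrightarrow> cl x \<oplus>\<^bsub>E\<^esub> cl y = cl (x \<oplus>\<^bsub>?H\<^esub> y)"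
    and Ezero: "\<zero>\<^bsub>E\<^esub> = cl \<zero>\<^bsub>?H\<^esub>"
    and Ecl: "\<And>x y. x \<in> Z \<Longrightarrow> y \<in> Z \<Longrightarrow> cl x = cl y \<longleftrightarrow> (\<exists>b\<in>B. x = b \<oplus>\<^bsub>?H\<^esub> y)"
    and Esm: "\<And>a x. a \<in> carrier R \<Longrightarrow> x \<in> Z \<Longrightarrow> a \<odot>\<^bsub>E\<^esub> cl x = cl (a \<odot>\<^bsub>?H\<^esub> x)"
    unfolding Eq cl_def
    using quotient_carrier[OF ZM BZ] quotient_add[OF ZM BZ] quotient_zero[OF ZM BZ]
      quotient_coset_eq_iff[OF ZM BZ] quotient_smult[OF ZM BZ] by (simp_all add: ZMs)
  have Emod: "module R E" unfolding Eq by (rule quotient_module[OF ZM BZ])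
  interpret E: module R E by (rule Emod)
  interpret H: module R ?H by (rule H)
  have ZH: "\<psi> \<in> Homs R (P (Suc n)) ?A" if "\<psi> \<in> Z" for \<psi> using that unfolding Z_def Ext_cocycles_def by blast
  have ZI: "\<psi> \<in> Z" if \<psi>: "\<psi> \<in> Homs R (P (Suc n)) ?A" "\<And>x. x \<in> carrier (P (Suc (Suc n))) \<Longrightarrow> \<psi> (d (Suc n) x) = \<zero>" for \<psi>
  proof -
    have "compose (carrier (P (Suc (Suc n)))) \<psi> (d (Suc n)) = \<zero>\<^bsub>Hom_module R (P (Suc (Suc n))) ?A\<^esub>"
      by (rule Homs_eqI[OF Homs_compose[OF PD(2) PD(5) \<psi>(1)] Hom_module_closed(1)[OF PD(2) ring_module]])
        (simp add: compose_def \<psi>(2) Hom_module_zero ring_module_simps)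
    then show ?thesis using \<psi>(1) unfolding Z_def Ext_cocycles_def by simp
  qed
  have Zd: "\<psi> (d (Suc n) x) = \<zero>" if "\<psi> \<in> Z" "x \<in> carrier (P (Suc (Suc n)))" for \<psi> x
  proof -
    have "compose (carrier (P (Suc (Suc n)))) \<psi> (d (Suc n)) x = \<zero>\<^bsub>Hom_module R (P (Suc (Suc n))) ?A\<^esub> x"
      using that(1) unfolding Z_def Ext_cocycles_def by simp
    then show ?thesis using that(2) by (simp add: compose_def Hom_module_zero ring_module_simps)
  qed
  have Fz: "v = \<zero>\<^bsub>?F (Suc (Suc n))\<^esub>" if "v \<in> carrier (?F (Suc (Suc n)))" for v
    by (rule free_eqI[OF that F.zero_closed]) (simp add: top)
  \<comment> \<open>\<open>?F\<close> vanishes in degree \<open>n + 2\<close>, so every linear form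
    on the top free module pulls back to a cocycle.\<close>
  have pull: "compose (carrier (P (Suc n))) \<eta> (g (Suc n)) \<in> Z" if \<eta>: "\<eta> \<in> Homs R (?F (Suc n)) ?A" for \<eta>
  proof (rule ZI[OF Homs_compose[OF PD(2) g(1) \<eta>]])
    fix x assume x: "x \<in> carrier (P (Suc (Suc n)))"
    have "g (Suc n) (d (Suc n) x) = D (Suc n) (g (Suc (Suc n)) x)" using g(2)[OF x] by simp
    also have "g (Suc (Suc n)) x = \<zero>\<^bsub>?F (Suc (Suc n))\<^esub>" by (rule Fz[OF Homs_closed[OF g(1) x]])
    also have "D (Suc n) \<dots> = \<zero>\<^bsub>?F (Suc n)\<^esub>" by (rule Homs_zero[OF free_module free_module RD(3)])
    finally show "compose (carrier (P (Suc n))) \<eta> (g (Suc n)) (d (Suc n) x) = \<zero>"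
      using Homs_closed[OF PD(5) x] Homs_zero[OF free_module ring_module \<eta>] by (simp add: compose_def ring_module_simps)
  qed
  define \<phi> where "\<phi> j = (\<lambda>v\<in>carrier (?F (Suc n)). v j)" for j
  have \<phi>: "\<phi> j \<in> Homs R (?F (Suc n)) ?A" if "j < ?m" for j
    unfolding \<phi>_def
  proof (rule Homs_restrictI[OF free_module])
    show "v j \<in> carrier ?A" if "v \<in> carrier (?F (Suc n))" for v
      using free_coord[OF that, of j] \<open>j < ?m\<close> by (simp add: ring_module_simps)
  qed (use that in \<open>simp_all add: ring_module_simps free_add free_smult\<close>)
  define \<xi> where "\<xi> j = compose (carrier (P (Suc n))) (\<phi> j) (g (Suc n))" for j
  have \<xi>: "\<xi> j \<in> Z" if "j < ?m" for j unfolding \<xi>_def by (rule pull[OF \<phi>[OF that]])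
  have upper: "generates R E (cl ` \<xi> ` {..<?m})"
    unfolding generates_def
  proof (intro conjI allI impI)
    show "finite (cl ` \<xi> ` {..<?m})" by simp
    show "cl ` \<xi> ` {..<?m} \<subseteq> carrier E" unfolding Ecar using \<xi> by auto
    fix S assume S: "submodule S R E" "cl ` \<xi> ` {..<?m} \<subseteq> S"
    let ?\<Gamma> = "\<lambda>\<eta>\<in>Homs R (?F (Suc n)) ?A. cl (compose (carrier (P (Suc n))) \<eta> (g (Suc n)))"
    let ?HF = "Hom_module R (?F (Suc n)) ?A"
    have HF: "module R ?HF" by (rule Hom_module_module[OF free_module ring_module])
    note pre = Hom_module_precompose[OF PD(2) free_module ring_module g(1)[of "Suc n"]]
    have \<Gamma>: "?\<Gamma> \<in> Homs R ?HF E"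
    proof (rule Homs_restrictI[OF HF])
      show "cl (compose (carrier (P (Suc n))) \<eta> (g (Suc n))) \<in> carrier E" if "\<eta> \<in> Homs R (?F (Suc n)) ?A" for \<eta>
        unfolding Ecar using pull[OF that] by blast
      show "cl (compose (carrier (P (Suc n))) (\<eta> \<oplus>\<^bsub>?HF\<^esub> \<theta>) (g (Suc n)))
          = cl (compose (carrier (P (Suc n))) \<eta> (g (Suc n))) \<oplus>\<^bsub>E\<^esub> cl (compose (carrier (P (Suc n))) \<theta> (g (Suc n)))"
        if "\<eta> \<in> Homs R (?F (Suc n)) ?A" "\<theta> \<in> Homs R (?F (Suc n)) ?A" for \<eta> \<theta>
        using Homs_add[OF pre that] Hom_module_closed(2)[OF free_module ring_module that] Eadd[OF pull[OF that(1)] pull[OF that(2)]] that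
        by simp
      show "cl (compose (carrier (P (Suc n))) (a \<odot>\<^bsub>?HF\<^esub> \<eta>) (g (Suc n)))
          = a \<odot>\<^bsub>E\<^esub> cl (compose (carrier (P (Suc n))) \<eta> (g (Suc n)))"
        if "a \<in> carrier R" "\<eta> \<in> Homs R (?F (Suc n)) ?A" for a \<eta>
        using Homs_smult[OF pre that] Hom_module_closed(3)[OF free_module ring_module that(2,1)] Esm[OF that(1) pull[OF that(2)]] that
        by simp
    qed
    let ?T = "{\<eta> \<in> Homs R (?F (Suc n)) ?A. ?\<Gamma> \<eta> \<in> S}"
    have T: "submodule ?T R ?HF" by (rule Homs_vimage_submodule[OF HF Emod \<Gamma> S(1)])
    have \<phi>T: "(\<lambda>v\<in>carrier (?F (Suc n)). v j) \<in> ?T" if j: "j < ?m" for j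
    proof -
      have "cl (\<xi> j) \<in> S" using S(2) j by auto
      then show ?thesis using \<phi>[OF j] unfolding \<xi>_def \<phi>_def by simp
    qed
    show "carrier E \<subseteq> S"
    proof
      fix X assume "X \<in> carrier E"
      then obtain \<psi> where \<psi>: "\<psi> \<in> Z" "X = cl \<psi>" unfolding Ecar by blast
      define \<eta> where "\<eta> = compose (carrier (?F (Suc n))) \<psi> (f (Suc n))"
      have \<eta>: "\<eta> \<in> Homs R (?F (Suc n)) ?A" unfolding \<eta>_def by (rule Homs_compose[OF free_module f(1) ZH[OF \<psi>(1)]])
      have "\<eta> \<in> ?T" by (rule dual_generated_by_coordinates[OF T \<phi>T \<eta>])
      then have inS: "cl (compose (carrier (P (Suc n))) \<eta> (g (Suc n))) \<in> S" using \<eta> by simp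
      \<comment> \<open>Composing the homotopy formula with \<open>\<psi>\<close> kills the term
        through \<open>d (Suc n)\<close>, because \<open>\<psi>\<close> is a cocycle. The other
        term, \<open>\<beta>\<close>, is a coboundary.\<close>
      define \<beta> where "\<beta> = compose (carrier (P (Suc n))) (compose (carrier (P n)) \<psi> (h n)) (d n)"
      have ph: "compose (carrier (P n)) \<psi> (h n) \<in> Homs R (P n) ?A" by (rule Homs_compose[OF PD(2) h(1) ZH[OF \<psi>(1)]])
      have \<beta>: "\<beta> \<in> B" unfolding B_def Ext_coboundaries_def \<beta>_def using ph by auto
      have \<beta>H: "\<beta> \<in> Homs R (P (Suc n)) ?A" unfolding \<beta>_def by (rule Homs_compose[OF PD(2) PD(5) ph])
      note pz = pull[OF \<eta>]
      have "\<psi> = \<beta> \<oplus>\<^bsub>?H\<^esub> compose (carrier (P (Suc n))) \<eta> (g (Suc n))"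
      proof (rule Homs_eqI[OF ZH[OF \<psi>(1)] Hom_module_closed(2)[OF PD(2) ring_module \<beta>H ZH[OF pz]]])
        fix x assume x: "x \<in> carrier (P (Suc n))"
        have gx: "g (Suc n) x \<in> carrier (?F (Suc n))" and dx: "d n x \<in> carrier (P n)" and hx: "h (Suc n) x \<in> carrier (P (Suc (Suc n)))"
          using x Homs_closed[OF g(1) x] Homs_closed[OF PD(5) x] Homs_closed[OF h(1) x] by auto
        have fgx: "f (Suc n) (g (Suc n) x) \<in> carrier (P (Suc n))" using Homs_closed[OF f(1) gx] .
        have hdx: "h n (d n x) \<in> carrier (P (Suc n))" and dhx: "d (Suc n) (h (Suc n) x) \<in> carrier (P (Suc n))"
          using Homs_closed[OF h(1) dx] Homs_closed[OF PD(5) hx] by auto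
        note \<psi>H = ZH[OF \<psi>(1)]
        have "\<psi> (x \<ominus>\<^bsub>P (Suc n)\<^esub> f (Suc n) (g (Suc n) x)) = \<psi> (d (Suc n) (h (Suc n) x) \<oplus>\<^bsub>P (Suc n)\<^esub> h n (d n x))"
          using h(2)[OF x] x by (simp add: compose_def)
        then have "\<psi> x \<ominus>\<^bsub>?A\<^esub> \<psi> (f (Suc n) (g (Suc n) x)) = \<psi> (d (Suc n) (h (Suc n) x)) \<oplus>\<^bsub>?A\<^esub> \<psi> (h n (d n x))"
          using Homs_minus[OF PD(2) ring_module \<psi>H x fgx] Homs_add[OF \<psi>H dhx hdx] by simp
        also have "\<dots> = \<psi> (h n (d n x))"
          using Zd[OF \<psi>(1) hx] Homs_closed[OF \<psi>H hdx] by (simp add: ring_module_simps)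
        finally have "\<psi> x = \<psi> (h n (d n x)) \<oplus>\<^bsub>?A\<^esub> \<psi> (f (Suc n) (g (Suc n) x))"
          using module_minus_eq_iff[OF ring_module Homs_closed[OF \<psi>H x] Homs_closed[OF \<psi>H fgx] Homs_closed[OF \<psi>H hdx]] by simp
        then show "\<psi> x = (\<beta> \<oplus>\<^bsub>?H\<^esub> compose (carrier (P (Suc n))) \<eta> (g (Suc n))) x"
          using x gx dx by (simp add: Hom_module_add \<beta>_def \<eta>_def compose_def)
      qed
      then have "cl \<psi> = cl (compose (carrier (P (Suc n))) \<eta> (g (Suc n)))"
        using Ecl[OF \<psi>(1) pz] \<beta> by blast
      then show "X \<in> S" using inS \<psi>(2) by simp
    qed
  qed
  have lower: "?m \<le> card G" if G: "generates R E G" for G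
  proof (rule ccontr)
    assume "\<not> ?m \<le> card G"
    then have card: "card G < card {..<?m}" by simp
    have Gf: "finite G" "G \<subseteq> carrier E" using G unfolding generates_def by auto
    have "\<exists>\<psi>. \<psi> \<in> Z \<and> X = cl \<psi>" if "X \<in> G" for X using that Gf(2) unfolding Ecar by blast
    then obtain \<rho> where \<rho>: "\<And>X. X \<in> G \<Longrightarrow> \<rho> X \<in> Z" "\<And>X. X \<in> G \<Longrightarrow> X = cl (\<rho> X)"
      using bchoice[of G "\<lambda>X \<psi>. \<psi> \<in> Z \<and> X = cl \<psi>"] by blast
    let ?e = "unit_vec R {..<?m}"
    have fe: "f (Suc n) (?e j) \<in> carrier (P (Suc n))" for j using Homs_closed[OF f(1) unit_vec_closed] .
    have Ac: "\<rho> X (f (Suc n) (?e j)) \<in> carrier R" if "X \<in> G" for X j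
      using Homs_closed[OF ZH[OF \<rho>(1)[OF that]] fe] by (simp add: ring_module_simps)
    \<comment> \<open>Fewer than \<open>?m\<close> generators impose fewer than \<open>?m\<close>
      linear conditions over the residue field on the vector \<open>c\<close>, so some
      \<open>c\<close> with a coordinate outside \<open>\<mm>\<close> meets them all modulo
      \<open>\<mm>\<close>.\<close>
    obtain c where "(\<forall>j\<in>{..<?m}. c j \<in> carrier R) \<and> (\<exists>j\<in>{..<?m}. c j \<notin> \<mm>) \<and>
        (\<forall>X\<in>G. (\<Oplus>j\<in>{..<?m}. c j \<otimes> \<rho> X (f (Suc n) (?e j))) \<in> \<mm>)"
      using solve_mod_prime[OF m_prime Gf(1) finite_lessThan card Ac] by (rule exE)
    then have c: "\<forall>j\<in>{..<?m}. c j \<in> carrier R" "\<exists>j\<in>{..<?m}. c j \<notin> \<mm>"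
      "\<forall>X\<in>G. (\<Oplus>j\<in>{..<?m}. c j \<otimes> \<rho> X (f (Suc n) (?e j))) \<in> \<mm>" by simp_all
    define v where "v = restrict c {..<?m}"
    have v: "v \<in> carrier (?F (Suc n))" unfolding v_def free_carrier_finite[OF finite_lessThan] using c(1) by auto
    define w where "w = f (Suc n) v"
    have w: "w \<in> carrier (P (Suc n))" unfolding w_def using Homs_closed[OF f(1) v] .
    \<comment> \<open>Evaluation at \<open>w\<close> modulo \<open>\<mm>\<close> is well defined on
      Ext: the value of a coboundary at \<open>w = f v\<close> factors through \<open>D n v\<close>,
      whose coordinates are in \<open>\<mm>\<close>.\<close>
    have Bw: "\<beta> w \<in> \<mm>" if \<beta>B: "\<beta> \<in> B" for \<beta>
    proof -
      obtain \<gamma> where \<gamma>: "\<gamma> \<in> Homs R (P n) ?A" "\<beta> = compose (carrier (P (Suc n))) \<gamma> (d n)"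
        using \<beta>B unfolding B_def Ext_coboundaries_def by auto
      have Dv: "D n v \<in> carrier (?F n)" using Homs_closed[OF RD(3) v] .
      have "compose (carrier (?F n)) \<gamma> (f n) (D n v) \<in> \<mm>"
        by (rule Homs_free_ring_in_ideal[OF m_ideal Homs_compose[OF free_module f(1) \<gamma>(1)] finite_lessThan Dv])
          (use RD(6)[OF v] in blast)
      moreover have "\<beta> w = compose (carrier (?F n)) \<gamma> (f n) (D n v)"
        using w v Dv f(2)[OF v] by (simp add: \<gamma>(2) compose_def w_def)
      ultimately show ?thesis by simp
    qed
    have madd: "\<And>a b. a \<in> \<mm> \<Longrightarrow> b \<in> \<mm> \<Longrightarrow> a \<oplus> b \<in> \<mm>" using additive_subgroup.a_closed[OF ideal.axioms(1)[OF m_ideal]] .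
    have mz: "\<zero> \<in> \<mm>" using additive_subgroup.zero_closed[OF ideal.axioms(1)[OF m_ideal]] .
    \<comment> \<open>The classes whose value at \<open>w\<close> lies in \<open>\<mm>\<close> form
      a submodule; by the choice of \<open>c\<close> it contains \<open>G\<close>, hence
      everything.\<close>
    define T where "T = cl ` {\<psi> \<in> Z. \<psi> w \<in> \<mm>}"
    have zZ: "\<zero>\<^bsub>?H\<^esub> \<in> Z" using subgroup.one_closed[OF submodule.axioms(1)[OF subs(1)]] by simp
    have "submodule T R E"
    proof (rule E.submoduleI_smult)
      show "T \<subseteq> carrier E" unfolding T_def Ecar by blast
      show "\<zero>\<^bsub>E\<^esub> \<in> T" unfolding T_def Ezero using zZ mz w by (auto simp: Hom_module_zero ring_module_simps)
      show "X \<oplus>\<^bsub>E\<^esub> Y \<in> T" if XY: "X \<in> T" "Y \<in> T" for X Y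
      proof -
        obtain x y where xy: "x \<in> Z" "x w \<in> \<mm>" "X = cl x" "y \<in> Z" "y w \<in> \<mm>" "Y = cl y" using XY unfolding T_def by blast
        have "(x \<oplus>\<^bsub>?H\<^esub> y) w \<in> \<mm>" using w xy madd by (simp add: Hom_module_add ring_module_simps)
        moreover have "x \<oplus>\<^bsub>?H\<^esub> y \<in> Z" using H.submoduleE(5)[OF subs(1)] xy by blast
        ultimately show ?thesis using Eadd xy unfolding T_def by auto
      qed
      show "a \<odot>\<^bsub>E\<^esub> X \<in> T" if aX: "a \<in> carrier R" "X \<in> T" for a X
      proof -
        obtain x where x: "x \<in> Z" "x w \<in> \<mm>" "X = cl x" using aX unfolding T_def by blast
        have "(a \<odot>\<^bsub>?H\<^esub> x) w \<in> \<mm>" using w x ideal.I_l_closed[OF m_ideal x(2) aX(1)] by (simp add: Hom_module_smult ring_module_simps)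
        moreover have "a \<odot>\<^bsub>?H\<^esub> x \<in> Z" using H.submoduleE(4)[OF subs(1)] x aX by blast
        ultimately show ?thesis using Esm aX(1) x unfolding T_def by auto
      qed
    qed
    moreover have "G \<subseteq> T"
    proof
      fix X assume X: "X \<in> G"
      note \<psi>H = Homs_compose[OF free_module f(1)[of "Suc n"] ZH[OF \<rho>(1)[OF X]]]
      have "\<rho> X w = compose (carrier (?F (Suc n))) (\<rho> X) (f (Suc n)) v" using v by (simp add: compose_def w_def)
      also have "\<dots> = (\<Oplus>j\<in>{..<?m}. v j \<otimes> compose (carrier (?F (Suc n))) (\<rho> X) (f (Suc n)) (?e j))"
        by (rule Homs_free_ring_coord[OF \<psi>H finite_lessThan v])
      also have "\<dots> = (\<Oplus>j\<in>{..<?m}. c j \<otimes> \<rho> X (f (Suc n) (?e j)))"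
        by (rule finsum_cong') (use c(1) Ac[OF X] in \<open>auto simp: v_def compose_def unit_vec_closed\<close>)
      finally have "\<rho> X w \<in> \<mm>" using c(3) X by simp
      then show "X \<in> T" unfolding T_def using \<rho>[OF X] by auto
    qed
    ultimately have all: "carrier E \<subseteq> T" using G unfolding generates_def by blast
    \<comment> \<open>The form \<open>\<xi> i\<close> evaluates at \<open>w\<close> to the
      coordinate \<open>i\<close> of \<open>g (f v)\<close>, which agrees with \<open>v i\<close>
      modulo \<open>\<mm>\<close> by the homotopy and minimality. Thus all coordinates of
      \<open>c\<close> would lie in \<open>\<mm>\<close>.\<close>
    have "v i \<in> \<mm>" if i: "i < ?m" for i
    proof -
      have "cl (\<xi> i) \<in> T" using all \<xi>[OF i] unfolding Ecar by blast
      then obtain \<psi> where \<psi>: "\<psi> \<in> Z" "\<psi> w \<in> \<mm>" "cl (\<xi> i) = cl \<psi>" unfolding T_def by blast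
      then obtain \<beta> where \<beta>: "\<beta> \<in> B" "\<xi> i = \<beta> \<oplus>\<^bsub>?H\<^esub> \<psi>" using Ecl[OF \<xi>[OF i]] by blast
      have "\<xi> i w \<in> \<mm>" using Bw[OF \<beta>(1)] \<psi>(2) madd w unfolding \<beta>(2) by (simp add: Hom_module_add ring_module_simps)
      moreover have gw: "g (Suc n) w \<in> carrier (?F (Suc n))" using Homs_closed[OF g(1) w] .
      ultimately have gwi: "g (Suc n) w i \<in> \<mm>" using w by (simp add: \<xi>_def \<phi>_def compose_def)
      have kv: "k (Suc n) v \<in> carrier (?F (Suc (Suc n)))" and Dv: "D n v \<in> carrier (?F n)"
        using Homs_closed[OF k(1) v] Homs_closed[OF RD(3) v] by auto
      have "v \<ominus>\<^bsub>?F (Suc n)\<^esub> g (Suc n) w = D (Suc n) (k (Suc n) v) \<oplus>\<^bsub>?F (Suc n)\<^esub> k n (D n v)"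
        using k(2)[OF v] v by (simp add: compose_def w_def)
      then have "v = (D (Suc n) (k (Suc n) v) \<oplus>\<^bsub>?F (Suc n)\<^esub> k n (D n v)) \<oplus>\<^bsub>?F (Suc n)\<^esub> g (Suc n) w"
        using module_minus_eq_iff[OF free_module v gw] Homs_closed[OF RD(3) kv] Homs_closed[OF k(1) Dv] by simp
      then have "v i = D (Suc n) (k (Suc n) v) i \<oplus> k n (D n v) i \<oplus> g (Suc n) w i"
        using i by (metis free_add lessThan_iff)
      moreover have "D (Suc n) (k (Suc n) v) i \<in> \<mm>" using RD(6)[OF kv] i by simp
      moreover have "k n (D n v) i \<in> \<mm>"
        by (rule Homs_free_ideal_coords[OF m_ideal k(1) Dv]) (use RD(6)[OF v] i in auto)
      ultimately show ?thesis using gwi madd by simp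
    qed
    then show False using c(2) unfolding v_def by auto
  qed
  obtain G where G: "generates R E G" "min_gens R E = enat (card G)" "\<And>G'. generates R E G' \<Longrightarrow> card G \<le> card G'"
    using min_gens_attained[OF Emod upper] by blast
  have "card (cl ` \<xi> ` {..<?m}) \<le> ?m"
    using card_image_le[of "\<xi> ` {..<?m}" cl] card_image_le[of "{..<?m}" \<xi>] by simp
  then have "card G = ?m" using G(3)[OF upper] lower[OF G(1)] by simp
  then show ?thesis using G(2) unfolding E_def by simp
qed

end

text \<open>The resolution \<open>P\<close> computing Ext and the modules over \<open>'q\<close>
  witnessing finite projective dimension are unrelated; each of them is compared with the minimal
  resolution only.\<close>

theorem corollary1p5:
  fixes R :: "('a, 'r) ring_scheme" and \<mm> I :: "'a set"
    and P :: "nat \<Rightarrow> ('a, 'p) module" and d :: "nat \<Rightarrow> 'p \<Rightarrow> 'p" and \<epsilon> :: "'p \<Rightarrow> 'a set"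
  assumes "cohen_macaulay_local_ring R \<mm>"
    and "cohen_macaulay_ideal R I"
    and "height R I = 2"
    and "finite_projective_dimension TYPE('q) R (ideal_module R I)"
    and "projective_resolution R P d \<epsilon> (quotient_module (ring_module R) I)"
  shows "min_gens R (Ext R P d 2 (ring_module R)) + 1 = min_gens R (ideal_module R I)"
proof -
  have CM: "noetherian_ring R" "local_ring R \<mm>" "depth R \<mm> = krull_dim R"
    using assms(1) unfolding cohen_macaulay_local_ring_def by auto
  interpret noetherian_local_ring R \<mm>
    using CM(1,2) unfolding local_ring_def
    by (auto intro!: noetherian_local_ring.intro noetherian_cring.intro noetherian_local_ring_axioms.intro)
  note I = cohen_macaulay_height_two[OF CM(3) assms(2,3)]
  obtain r :: "nat \<Rightarrow> nat" and D where res: "free_resolution R \<mm> (\<lambda>n. {..<r n}) D I"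
    and gens: "min_gens R (ideal_module R I) = enat (r 1)"
    using minimal_resolution_exists[OF I(1,2)] by blast
  obtain N where "\<forall>n>N. {..<r n} = {}" using minimal_resolution_bounded[OF res assms(4)] by (rule exE)
  then have N: "r n = 0" if "n > N" for n using that by (metis empty_iff gr0I lessThan_iff)
  have r3: "r 3 = 0"
  proof (rule ccontr)
    assume "r 3 \<noteq> 0"
    have fin: "finite {i. r i \<noteq> 0}" by (rule finite_subset[of _ "{..N}"]) (use N in \<open>auto simp: not_less[symmetric]\<close>)
    \<comment> \<open>The bound on the length concerns the top degree of the resolution, which
      exists because \<open>r\<close> vanishes beyond \<open>N\<close>.\<close>
    let ?p = "Max {i. r i \<noteq> 0}"
    have "?p \<in> {i. r i \<noteq> 0}" by (rule Max_in[OF fin]) (use \<open>r 3 \<noteq> 0\<close> in blast)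
    then have "0 \<in> {..<r ?p}" by simp
    then have ne: "{..<r ?p} \<noteq> {}" by (metis empty_iff)
    have zero: "{..<r i} = {}" if "i > ?p" for i
    proof -
      have "r i = 0" using Max_ge[OF fin, of i] that by (metis linorder_not_le mem_Collect_eq)
      then show ?thesis by simp
    qed
    have "?p \<le> 2" by (rule I(4)[OF res ne zero])
    moreover have "3 \<le> ?p" using Max_ge[OF fin, of 3] \<open>r 3 \<noteq> 0\<close> by simp
    ultimately show False by simp
  qed
  obtain x where x: "x \<in> I" "regular_mod R {\<zero>\<^bsub>R\<^esub>} x" using I(3) by blast
  have "r 2 + 1 = r 1" by (rule resolution_rank[OF res r3 x])
  moreover have "min_gens R (Ext R P d 2 (ring_module R)) = enat (r 2)"
    using min_gens_top_Ext[OF res _ assms(5), of 1] r3 by (simp add: numeral_2_eq_2 numeral_3_eq_3)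
  ultimately show ?thesis unfolding gens by (metis eSuc_enat plus_1_eSuc(2) Suc_eq_plus1)
qed

end
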